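(* For all $m,n\ge1$ the map $$\phi_{m,n}\otimes\eta_{m,n}:\mathcal A'_{m,n}\otimes\tilde\Bbbk_{n\delta_m}\to\mathcal A_{m,n}\otimes\Bbbk_{m\delta_n}$$ is an isomorphism of $\dot U(\mathfrak p(n))\otimes\dot U(\tilde{\mathfrak p}(m))$-modules and has parity $\overline{mn}$.
   Context: $\Bbbk$ is an algebraically closed field of characteristic zero; everything is $\mathbb Z_2$-graded, $[x,y]=xy-(-1)^{|x||y|}yx$. A homogeneous linear map $f$ is a module homomorphism if $f(x.v)=(-1)^{|f||x|}x.f(v)$. Lie superalgebras. $I_{n|n}=\{1,\dots,n,-1,\dots,-n\}$, $|i|=\bar0$ for $i>0$, $|i|=\bar1$ for $i<0$. $V_n$ has basis $v_i$ ($i\in I_{n|n}$) and $W_m$ has basis $w_i$ ($i\in I_{m|m}$), with $|v_i|=|w_i|=|i|$. $\mathfrak p(n)\subset\mathfrak{gl}(V_n)$: matrices $\begin{bmatrix}A&B\\ C&-A^T\end{bmatrix}$, $B$ symmetric, $C$ skew-symmetric; basis $a_{i,j}=E_{i,j}-E_{-j,-i}$, $b_{i,j}=2^{-\delta_{i,j}}(E_{i,-j}+E_{j,-i})$ ($i\le j$), $c_{i,j}=E_{-i,j}-E_{-j,i}$ ($i<j$). $\tilde{\mathfrak p}(m)\subset\mathfrak{gl}(W_m)$: matrices $\begin{bmatrix}A&C\\ B&-A^T\end{bmatrix}$, $B$ symmetric, $C$ skew-symmetric; basis $\tilde a_{i,j}=E_{i,j}-E_{-j,-i}$, $\tilde b_{i,j}=2^{-\delta_{i,j}}(E_{-i,j}+E_{-j,i})$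 ($i\le j$), $\tilde c_{i,j}=E_{i,-j}-E_{j,-i}$ ($i<j$). $X(T_n)=\bigoplus_{i=1}^n\mathbb Z\varepsilon_i$, $(\varepsilon_i,\varepsilon_j)=\delta_{i,j}$, $\delta_n=\varepsilon_1+\dots+\varepsilon_n$, $\alpha_i=\varepsilon_i-\varepsilon_{i+1}$, $\beta_i=\varepsilon_i+\varepsilon_{i+1}$. Weights are with respect to the diagonal matrices: $v_{\pm j}$, $w_{\pm j}$ have weight $\pm\varepsilon_j$ ($j>0$). Categories. $\dot{\mathbf U}(\mathfrak p(n))$ is the $\Bbbk$-linear supercategory with objects $X(T_n)$ and generating morphisms, for each $\lambda$ and $1\le i\le n-1$: even $E_i:\lambda\to\lambda+\alpha_i$, $F_i:\lambda\to\lambda-\alpha_i$; odd $B_{1,1}:\lambda\to\lambda+2\varepsilon_1$, $B_i:\lambda\to\lambda+\beta_i$, $C_i:\lambda\to\lambda-\beta_i$. Relations, precomposed with $1_\lambda$ for every $\lambda$, for all admissible indices: $[E_i,F_j]1_\lambda=\delta_{i,j}(\alpha_i,\lambda)1_\lambda$; $[E_i,E_j]=[F_i,F_j]=0$ if $j\ne i\pm1$; $[E_i,[E_i,E_j]]=[F_i,[F_i,F_j]]=0$ if $j=i\pm1$; $[B_i,B_j]=[C_i,C_j]=0$; $[B_i,C_j]1_\lambda=-(\alpha_i,\lambda)1_\lambda$ if $j=i$, $[F_{i-1},F_i]1_\lambda$ if $j=i-1$, $[E_i,E_{i+1}]1_\lambda$ if $j=i+1$, $0$ otherwise; $[B_i,F_j]=0$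 if $j\ne i,i+1$; $[B_i,E_j]=0$ if $j\neq i,i-1$; $[B_i,F_i]=[B_{i+1},E_{i+1}]$; $[B_i,F_{i+1}]=[B_{i+1},E_i]$; $[F_j,C_i]=0$ if $j\ne i-1$; $[E_j,C_i]=0$ if $j\ne i+1$; $[F_i,C_{i+1}]=[E_{i+1},C_i]$; $[[B_i,F_i],F_j]=2B_{i+1}$ if $j=i+1$, $0$ otherwise; $[[B_1,F_1],E_1]=2B_1$; $[[B_1,E_1],E_j]=0$; $[[C_{i+1},F_i],F_j]=C_i$ if $j=i+1$, $0$ if $j\ne i\pm1$; $2B_{1,1}=[E_1,B_1]$; $B_{1,1}^2=0$. $\dot{\mathbf U}(\tilde{\mathfrak p}(m))$ is the $\Bbbk$-linear supercategory with objects $X(T_m)$ and generating morphisms even $\tilde E_i:\lambda\to\lambda+\alpha_i$, $\tilde F_i:\lambda\to\lambda-\alpha_i$, odd $\tilde B_{1,1}:\lambda\to\lambda-2\varepsilon_1$, $\tilde B_i:\lambda\to\lambda-\beta_i$, $\tilde C_i:\lambda\to\lambda+\beta_i$, whose relations are exactly those obtained from the relations of $\dot{\mathbf U}(\mathfrak p(m))$ by the substitution $1_\lambda\mapsto1_{-\lambda}$, $E_i\mapsto-\tilde F_i$, $F_i\mapsto-\tilde E_i$, $B_{1,1}\mapsto\tilde B_{1,1}$, $B_i\mapsto\tilde B_i$, $C_i\mapsto\tilde C_i$. $\dot U(\mathfrak p(n))$, $\dot U(\tilde{\mathfrak p}(m))$ are the locally unital superalgebras given by the direct sum of all Hom spaces,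 with product composition when defined and zero otherwise. Modules. $\mathcal A=\mathcal A_{m,n}=S(V_n)^{\otimes m}$, identified with the symmetric superalgebra on $z_{k,j}=1^{\otimes(k-1)}\otimes v_j\otimes1^{\otimes(m-k)}$ ($1\le k\le m$, $j\in I_{n|n}$). $\mathcal A'=\mathcal A'_{m,n}=S(W_m)^{\otimes n}$, identified with the symmetric superalgebra on $z'_{j,\ell}=1^{\otimes(\ell-1)}\otimes w_j\otimes1^{\otimes(n-\ell)}$ ($j\in I_{m|m}$, $1\le\ell\le n$). $z_{k,j}$, $z'_{j,\ell}$ also denote left multiplications; $\partial_{k,j}$, $\partial'_{j,\ell}$ are the superderivations of parity $|j|$ dual to these generators ($\partial_{k,j}(z_{k',j'})=\delta_{k,k'}\delta_{j,j'}$, likewise for primes). $\pi_\lambda$ denotes the projection onto $S^{\lambda_1}(V_n)\otimes\cdots\otimes S^{\lambda_m}(V_n)$ ($\lambda\in X(T_m)$), and $\pi'_\mu$ the projection onto $S^{\mu_1}(W_m)\otimes\cdots\otimes S^{\mu_n}(W_m)$ ($\mu\in X(T_n)$), both zero if some entry is negative. On $\mathcal A$: $\dot U(\mathfrak p(n))$ acts through the natural action of $\mathfrak p(n)$ ($1_\mu$ is projection onto the $\mu$-weight space; $E_i,F_i,B_{1,1},B_i,C_i$ act as $a_{i,i+1},a_{i+1,i},b_{1,1},b_{i,i+1},c_{i,i+1}$); $\dot U(\tilde{\mathfrak p}(m))$ acts by $1_\lambda=\pi_\lambda$ and by letting $\tilde E_i1_\lambda,\tilde F_i1_\lambda,\tilde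 B_{1,1}1_\lambda,\tilde B_i1_\lambda,\tilde C_i1_\lambda$ act as $\pi_\lambda$ followed by, respectively, $\sum_{r\in I_{n|n}}z_{i,r}\partial_{i+1,r}$, $\sum_{r\in I_{n|n}}z_{i+1,r}\partial_{i,r}$, $\sum_{r=1}^n\partial_{1,r}\partial_{1,-r}$, $\sum_{r\in I_{n|n}}\partial_{i,r}\partial_{i+1,-r}$, $\sum_{r\in I_{n|n}}(-1)^{|r|}z_{i,r}z_{i+1,-r}$. On $\mathcal A'$: $\dot U(\tilde{\mathfrak p}(m))$ acts through the natural action of $\tilde{\mathfrak p}(m)$ ($1_\lambda$ is projection onto the $\lambda$-weight space; $\tilde E_i,\tilde F_i,\tilde B_{1,1},\tilde B_i,\tilde C_i$ act as $\tilde a_{i,i+1},\tilde a_{i+1,i},\tilde b_{1,1},\tilde b_{i,i+1},\tilde c_{i,i+1}$); $\dot U(\mathfrak p(n))$ acts by $1_\mu=\pi'_\mu$ and by letting $E_i1_\mu,F_i1_\mu,B_{1,1}1_\mu,B_i1_\mu,C_i1_\mu$ act as $\pi'_\mu$ followed by, respectively, $\sum_{r\in I_{m|m}}z'_{r,i}\partial'_{r,i+1}$, $\sum_{r\in I_{m|m}}z'_{r,i+1}\partial'_{r,i}$, $\sum_{r=1}^mz'_{r,1}z'_{-r,1}$, $\sum_{r\in I_{m|m}}z'_{r,i}z'_{-r,i+1}$, $\sum_{r\in I_{m|m}}(-1)^{|r|}\partial'_{-r,i}\partial'_{r,i+1}$. For $a\in\mathbb Z$, $\Bbbk_{a\delta_n}=\Bbbk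 v_{a\delta_n}$ is the one-dimensional purely even $\mathfrak p(n)$-module of weight $a\delta_n$ (the supertrace scaled by $a/2$), with trivial $\tilde{\mathfrak p}(m)$-action; $\tilde\Bbbk_{a\delta_m}=\Bbbk\tilde v_{a\delta_m}$ is the analogous $\tilde{\mathfrak p}(m)$-module of weight $a\delta_m$ with trivial $\mathfrak p(n)$-action. Tensoring with them shifts weights: on $\mathcal A\otimes\Bbbk_{m\delta_n}$ the idempotent $1_\mu$ of $\dot U(\mathfrak p(n))$ projects onto (the $(\mu-m\delta_n)$-weight space of $\mathcal A$)$\,\otimes\Bbbk_{m\delta_n}$, and on $\mathcal A'\otimes\tilde\Bbbk_{n\delta_m}$ the idempotent $1_\lambda$ of $\dot U(\tilde{\mathfrak p}(m))$ projects onto (the $(\lambda-n\delta_m)$-weight space of $\mathcal A'$)$\,\otimes\tilde\Bbbk_{n\delta_m}$; the other generators act on the first factor. The maps: $\eta_{m,n}(\tilde v_{n\delta_m})=v_{m\delta_n}$, and $\phi_{m,n}:S(W_m)^{\otimes n}\to S(V_n)^{\otimes m}$ is the linear map $$\bigotimes_{\ell=1}^n\prod_{k=1}^mw_k^{d_{k\ell}}w_{-k}^{\varepsilon_{k\ell}}\mapsto(-1)^{\kappa(\varepsilon)+\chi(\varepsilon)}\bigotimes_{k=1}^m\prod_{\ell=1}^nv_\ell^{d_{k\ell}}v_{-\ell}^{1-\varepsilon_{k\ell}}$$ for $d_{k\ell}\in\mathbb Z_{\ge0}$, $\varepsilon_{k\ell}\in\{0,1\}$, with products in increasing order of the index, where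 $\kappa(\varepsilon)=\sum_{1\le k<k'\le m,\ 1\le\ell'<\ell\le n}(1-\varepsilon_{k\ell})(1-\varepsilon_{k'\ell'})$ and $\chi(\varepsilon)=\sum_{1\le k\le m,\,1\le\ell\le n}(m\ell+m+mn+k+1)\varepsilon_{k\ell}$. *)

theory Defs
  imports
    "HOL-Computational_Algebra.Polynomial"
    "HOL-Library.Poly_Mapping"
    "HOL-Library.Set_Algebras"
    "HOL-Library.Z2"
begin

section \<open>Free vector spaces\<close>

text \<open>The vector space with basis \<open>'b\<close> is the type \<open>'b \<Rightarrow>\<^sub>0 'k\<close>; the subspace spanned by a
  set \<open>B\<close> of basis vectors is \<open>{x. keys x \<subseteq> B}\<close>. Parities are elements of \<open>bit\<close>, the
  field with two elements.\<close>

abbreviation keys :: "('b \<Rightarrow>\<^sub>0 'k::zero) \<Rightarrow> 'b set" where "keys \<equiv> Poly_Mapping.keys"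
abbreviation lookup :: "('b \<Rightarrow>\<^sub>0 'k::zero) \<Rightarrow> 'b \<Rightarrow> 'k" where "lookup \<equiv> Poly_Mapping.lookup"

definition ksign :: "bit \<Rightarrow> 'k::field" where
  "ksign p = (if p = 0 then 1 else - 1)"

definition scl :: "'k::field \<Rightarrow> ('b \<Rightarrow>\<^sub>0 'k) \<Rightarrow> ('b \<Rightarrow>\<^sub>0 'k)" where
  "scl c x = Poly_Mapping.map ((*) c) x"

abbreviation basvec :: "'b \<Rightarrow> ('b \<Rightarrow>\<^sub>0 'k::field)" where
  "basvec b \<equiv> Poly_Mapping.single b 1"

definition lin :: "('a \<Rightarrow> ('b \<Rightarrow>\<^sub>0 'k::field)) \<Rightarrow> ('a \<Rightarrow>\<^sub>0 'k) \<Rightarrow> ('b \<Rightarrow>\<^sub>0 'k)" where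
  "lin f x = (\<Sum>a\<in>keys x. scl (lookup x a) (f a))"

definition bilin ::
  "('a \<Rightarrow> 'b \<Rightarrow> ('c \<Rightarrow>\<^sub>0 'k::field)) \<Rightarrow> ('a \<Rightarrow>\<^sub>0 'k) \<Rightarrow> ('b \<Rightarrow>\<^sub>0 'k) \<Rightarrow> ('c \<Rightarrow>\<^sub>0 'k)" where
  "bilin f x y = lin (\<lambda>a. lin (f a) y) x"

lemma lookup_scl: "lookup (scl c x) b = c * lookup x b"
  by (simp add: scl_def Poly_Mapping.map.rep_eq when_def)

lemma vector_space_scl: "vector_space (scl :: 'k::field \<Rightarrow> ('b \<Rightarrow>\<^sub>0 'k) \<Rightarrow> _)"
  by standard (auto intro!: poly_mapping_eqI simp: lookup_scl lookup_add algebra_simps)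

lemma scl_single: "scl c (Poly_Mapping.single b d) = Poly_Mapping.single b (c * d)"
  by (rule poly_mapping_eqI) (simp add: lookup_scl lookup_single when_def)

lemma lin_single: "lin f (Poly_Mapping.single a c) = scl c (f a)"
  by (rule poly_mapping_eqI) (simp add: lin_def lookup_scl)

definition span :: "('b \<Rightarrow>\<^sub>0 'k::field) set \<Rightarrow> ('b \<Rightarrow>\<^sub>0 'k) set" where
  "span = module.span scl"

record 'b sspace =
  basis :: "'b set"
  bpar :: "'b \<Rightarrow> bit"

definition vecs :: "'b sspace \<Rightarrow> ('b \<Rightarrow>\<^sub>0 'k::field) set" where
  "vecs M = {x. keys x \<subseteq> basis M}"

definition hvecs :: "'b sspace \<Rightarrow> bit \<Rightarrow> ('b \<Rightarrow>\<^sub>0 'k::field) set" where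
  "hvecs M p = {x. keys x \<subseteq> {b \<in> basis M. bpar M b = p}}"

definition tensor_space :: "'a sspace \<Rightarrow> 'b sspace \<Rightarrow> ('a \<times> 'b) sspace" where
  "tensor_space M N = \<lparr>basis = basis M \<times> basis N, bpar = (\<lambda>(a, b). bpar M a + bpar N b)\<rparr>"

definition tensor_vec :: "('a \<Rightarrow>\<^sub>0 'k::field) \<Rightarrow> ('b \<Rightarrow>\<^sub>0 'k) \<Rightarrow> ('a \<times> 'b \<Rightarrow>\<^sub>0 'k)" where
  "tensor_vec = bilin (\<lambda>a b. basvec (a, b))"

text \<open>The map \<open>f \<otimes> g\<close>. It is only used for even \<open>g\<close>, so that there is no sign.\<close>

definition tensor_map ::
  "(('a \<Rightarrow>\<^sub>0 'k::field) \<Rightarrow> ('c \<Rightarrow>\<^sub>0 'k)) \<Rightarrow> (('b \<Rightarrow>\<^sub>0 'k) \<Rightarrow> ('d \<Rightarrow>\<^sub>0 'k)) \<Rightarrow>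
   ('a \<times> 'b \<Rightarrow>\<^sub>0 'k) \<Rightarrow> ('c \<times> 'd \<Rightarrow>\<^sub>0 'k)" where
  "tensor_map f g = lin (\<lambda>(a, b). tensor_vec (f (basvec a)) (g (basvec b)))"


section \<open>Locally unital superalgebras\<close>

text \<open>\<open>part U p\<close> is the projection onto the homogeneous component of parity \<open>p\<close>;
  \<open>idm U a\<close>, for \<open>a \<in> objs U\<close>, are the distinguished orthogonal even idempotents.\<close>

record ('k, 'o, 'x) lusalg =
  carr :: "'x set"
  add :: "'x \<Rightarrow> 'x \<Rightarrow> 'x"
  smul :: "'k \<Rightarrow> 'x \<Rightarrow> 'x"
  mult :: "'x \<Rightarrow> 'x \<Rightarrow> 'x"
  part :: "bit \<Rightarrow> 'x \<Rightarrow> 'x"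
  objs :: "'o set"
  idm :: "'o \<Rightarrow> 'x"

definition hcomp :: "('k, 'o, 'x) lusalg \<Rightarrow> bit \<Rightarrow> 'x set" where
  "hcomp U p = {x \<in> carr U. part U p x = x}"

text \<open>The algebra with basis \<open>B\<close> and with structure maps given on basis vectors.\<close>

definition based_alg ::
  "'b set \<Rightarrow> ('b \<Rightarrow> 'b \<Rightarrow> ('b \<Rightarrow>\<^sub>0 'k::field)) \<Rightarrow> (bit \<Rightarrow> 'b \<Rightarrow> ('b \<Rightarrow>\<^sub>0 'k)) \<Rightarrow>
   'o set \<Rightarrow> ('o \<Rightarrow> 'b) \<Rightarrow> ('k, 'o, 'b \<Rightarrow>\<^sub>0 'k) lusalg" where
  "based_alg B bmult bpart obs u =
    \<lparr>carr = {x. keys x \<subseteq> B}, add = (+), smul = scl, mult = bilin bmult,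
     part = (\<lambda>p. lin (bpart p)), objs = obs, idm = (\<lambda>a. basvec (u a))\<rparr>"

text \<open>The quotient by a homogeneous two-sided ideal \<open>I\<close>: its elements are the cosets \<open>x + I\<close>.\<close>

definition quot :: "('k, 'o, 'x::plus) lusalg \<Rightarrow> 'x set \<Rightarrow> ('k, 'o, 'x set) lusalg" where
  "quot R I =
    \<lparr>carr = (\<lambda>x. x +o I) ` carr R,
     add = (\<lambda>X Y. \<Union>x\<in>X. \<Union>y\<in>Y. add R x y +o I),
     smul = (\<lambda>c X. \<Union>x\<in>X. smul R c x +o I),
     mult = (\<lambda>X Y. \<Union>x\<in>X. \<Union>y\<in>Y. mult R x y +o I),
     part = (\<lambda>p X. \<Union>x\<in>X. part R p x +o I),
     objs = objs R,
     idm = (\<lambda>a. idm R a +o I)\<rparr>"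

definition ideal_gen ::
  "('k::field, 'o, 'b \<Rightarrow>\<^sub>0 'k) lusalg \<Rightarrow> ('b \<Rightarrow>\<^sub>0 'k) set \<Rightarrow> ('b \<Rightarrow>\<^sub>0 'k) set" where
  "ideal_gen R S = span {mult R (mult R x r) y |x r y. x \<in> carr R \<and> r \<in> S \<and> y \<in> carr R}"

text \<open>The tensor product of two algebras: the free vector space on pairs \<open>(x, y)\<close> modulo the
  bilinearity relations, with \<open>(x \<otimes> y)(x' \<otimes> y') = (-1)\<^bsup>|y||x'|\<^esup> xx' \<otimes> yy'\<close> for homogeneous
  \<open>y\<close> and \<open>x'\<close>.\<close>

definition pairs_alg ::
  "('k::field, 'o, 'x) lusalg \<Rightarrow> ('k, 'q, 'y) lusalg \<Rightarrow> ('k, 'o \<times> 'q, 'x \<times> 'y \<Rightarrow>\<^sub>0 'k) lusalg" where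
  "pairs_alg U U' = based_alg (carr U \<times> carr U')
     (\<lambda>(x, y) (x', y'). \<Sum>p\<in>{0, 1}. \<Sum>q\<in>{0, 1}.
        Poly_Mapping.single (mult U x (part U q x'), mult U' (part U' p y) y') (ksign (p * q)))
     (\<lambda>r (x, y). \<Sum>p\<in>{0, 1}. basvec (part U p x, part U' (r - p) y))
     (objs U \<times> objs U') (\<lambda>(a, b). (idm U a, idm U' b))"

definition bilinear_rels ::
  "('k::field, 'o, 'x) lusalg \<Rightarrow> ('k, 'q, 'y) lusalg \<Rightarrow> ('x \<times> 'y \<Rightarrow>\<^sub>0 'k) set" where
  "bilinear_rels U U' = span
    ({basvec (add U x x', y) - basvec (x, y) - basvec (x', y)
        |x x' y. x \<in> carr U \<and> x' \<in> carr U \<and> y \<in> carr U'} \<union>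
     {basvec (x, add U' y y') - basvec (x, y) - basvec (x, y')
        |x y y'. x \<in> carr U \<and> y \<in> carr U' \<and> y' \<in> carr U'} \<union>
     {basvec (smul U c x, y) - scl c (basvec (x, y)) |c x y. x \<in> carr U \<and> y \<in> carr U'} \<union>
     {basvec (x, smul U' c y) - scl c (basvec (x, y)) |c x y. x \<in> carr U \<and> y \<in> carr U'})"

definition tensor_alg ::
  "('k::field, 'o, 'x) lusalg \<Rightarrow> ('k, 'q, 'y) lusalg \<Rightarrow>
   ('k, 'o \<times> 'q, ('x \<times> 'y \<Rightarrow>\<^sub>0 'k) set) lusalg" where
  "tensor_alg U U' = quot (pairs_alg U U') (bilinear_rels U U')"


section \<open>Supermodules\<close>

text \<open>The last assumption says that the module is the (automatically direct) sum of the
  images of the distinguished idempotents.\<close>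

locale supermodule =
  fixes U :: "('k::field, 'o, 'x) lusalg"
    and M :: "'b sspace"
    and act :: "'x \<Rightarrow> ('b \<Rightarrow>\<^sub>0 'k) \<Rightarrow> ('b \<Rightarrow>\<^sub>0 'k)"
  assumes act_closed: "x \<in> carr U \<Longrightarrow> v \<in> vecs M \<Longrightarrow> act x v \<in> vecs M"
    and act_add_right:
      "x \<in> carr U \<Longrightarrow> v \<in> vecs M \<Longrightarrow> w \<in> vecs M \<Longrightarrow> act x (v + w) = act x v + act x w"
    and act_scl_right: "x \<in> carr U \<Longrightarrow> v \<in> vecs M \<Longrightarrow> act x (scl c v) = scl c (act x v)"
    and act_add_left:
      "x \<in> carr U \<Longrightarrow> y \<in> carr U \<Longrightarrow> v \<in> vecs M \<Longrightarrow> act (add U x y) v = act x v + act y v"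
    and act_smul_left: "x \<in> carr U \<Longrightarrow> v \<in> vecs M \<Longrightarrow> act (smul U c x) v = scl c (act x v)"
    and act_mult:
      "x \<in> carr U \<Longrightarrow> y \<in> carr U \<Longrightarrow> v \<in> vecs M \<Longrightarrow> act (mult U x y) v = act x (act y v)"
    and act_parity: "x \<in> hcomp U p \<Longrightarrow> v \<in> hvecs M q \<Longrightarrow> act x v \<in> hvecs M (p + q)"
    and act_idm:
      "v \<in> vecs M \<Longrightarrow> \<exists>S. finite S \<and> S \<subseteq> objs U \<and> (\<Sum>a\<in>S. act (idm U a) v) = v"

locale supermodule_hom =
  source: supermodule U M act + target: supermodule U N act'
  for U :: "('k::field, 'o, 'x) lusalg"
    and M :: "'b sspace" and act
    and N :: "'c sspace" and act' +
  fixes f :: "('b \<Rightarrow>\<^sub>0 'k) \<Rightarrow> ('c \<Rightarrow>\<^sub>0 'k)" and p :: bit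
  assumes hom_add: "v \<in> vecs M \<Longrightarrow> w \<in> vecs M \<Longrightarrow> f (v + w) = f v + f w"
    and hom_scl: "v \<in> vecs M \<Longrightarrow> f (scl c v) = scl c (f v)"
    and hom_parity: "v \<in> hvecs M q \<Longrightarrow> f v \<in> hvecs N (q + p)"
    and hom_act:
      "x \<in> hcomp U q \<Longrightarrow> v \<in> vecs M \<Longrightarrow> f (act x v) = scl (ksign (p * q)) (act' x (f v))"

locale supermodule_iso = supermodule_hom +
  assumes bij: "bij_betw f (vecs M) (vecs N)"

text \<open>The action of a quotient algebra induced by an action of the original algebra: a coset
  acts through any of its elements. If the ideal does not act by zero on \<open>v\<close>, then
  \<open>quot_act a X v\<close> is one and the same unspecified vector for all cosets \<open>X\<close>; this is
  incompatible with \<^const>\<open>supermodule\<close> unless the vector is zero, and then all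
  idempotents kill \<open>v\<close>, so \<open>v = 0\<close>. So well-definedness is part of being a supermodule.\<close>

definition quot_act :: "('x \<Rightarrow> 'v \<Rightarrow> 'v) \<Rightarrow> 'x set \<Rightarrow> 'v \<Rightarrow> 'v" where
  "quot_act a X v = the_elem ((\<lambda>x. a x v) ` X)"

text \<open>The action of \<open>U \<otimes> U'\<close> given by \<open>(x \<otimes> y).v = x.(y.v)\<close>.\<close>

definition tensor_act ::
  "('x \<Rightarrow> ('b \<Rightarrow>\<^sub>0 'k::field) \<Rightarrow> ('b \<Rightarrow>\<^sub>0 'k)) \<Rightarrow> ('y \<Rightarrow> ('b \<Rightarrow>\<^sub>0 'k) \<Rightarrow> ('b \<Rightarrow>\<^sub>0 'k)) \<Rightarrow>
   ('x \<times> 'y \<Rightarrow>\<^sub>0 'k) set \<Rightarrow> ('b \<Rightarrow>\<^sub>0 'k) \<Rightarrow> ('b \<Rightarrow>\<^sub>0 'k)" where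
  "tensor_act a a' = quot_act (\<lambda>z v. lin (\<lambda>(x, y). a x (a' y v)) z)"


section \<open>Supercategories given by generators and relations\<close>

type_synonym weight = "nat \<Rightarrow>\<^sub>0 int"

text \<open>A path \<open>([g\<^sub>1, \<dots>, g\<^sub>r], \<mu>)\<close> stands for the morphism \<open>g\<^sub>1 \<circ> \<dots> \<circ> g\<^sub>r \<circ> 1\<^sub>\<mu>\<close>, where a
  generator \<open>g\<close> with source \<open>\<nu>\<close> has target \<open>\<nu> + wt g\<close>. The paths form a basis of the direct sum
  of all Hom spaces of the free supercategory.\<close>

type_synonym 'g path = "'g list \<times> weight"

definition path_alg ::
  "weight set \<Rightarrow> 'g set \<Rightarrow> ('g \<Rightarrow> weight) \<Rightarrow> ('g \<Rightarrow> bit) \<Rightarrow>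
   ('k::field, weight, 'g path \<Rightarrow>\<^sub>0 'k) lusalg" where
  "path_alg X G wt par = based_alg (lists G \<times> X)
     (\<lambda>(w, \<nu>) (w', \<mu>). if \<nu> = \<mu> + sum_list (map wt w') then basvec (w @ w', \<mu>) else 0)
     (\<lambda>p (w, \<mu>). if sum_list (map par w) = p then basvec (w, \<mu>) else 0)
     X (\<lambda>\<mu>. ([], \<mu>))"

text \<open>If \<open>r\<close> is a linear combination of words in the generators, then \<open>at_obj \<mu> r\<close>
  is \<open>r 1\<^sub>\<mu>\<close>.\<close>

definition at_obj :: "weight \<Rightarrow> ('g list \<Rightarrow>\<^sub>0 'k::field) \<Rightarrow> ('g path \<Rightarrow>\<^sub>0 'k)" where
  "at_obj \<mu> = lin (\<lambda>w. basvec (w, \<mu>))"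

text \<open>The direct sum of all Hom spaces of the supercategory with objects \<open>X\<close>, generating
  morphisms \<open>G\<close> and relations \<open>r 1\<^sub>\<mu> = 0\<close> for \<open>\<mu> \<in> X\<close>, \<open>r \<in> R \<mu>\<close>.\<close>

definition presented_alg ::
  "weight set \<Rightarrow> 'g set \<Rightarrow> ('g \<Rightarrow> weight) \<Rightarrow> ('g \<Rightarrow> bit) \<Rightarrow>
   (weight \<Rightarrow> ('g list \<Rightarrow>\<^sub>0 'k::field) set) \<Rightarrow> ('k, weight, ('g path \<Rightarrow>\<^sub>0 'k) set) lusalg" where
  "presented_alg X G wt par R =
    quot (path_alg X G wt par)
      (ideal_gen (path_alg X G wt par) {at_obj \<mu> r |\<mu> r. \<mu> \<in> X \<and> r \<in> R \<mu>})"

text \<open>The action in which \<open>1\<^sub>\<mu>\<close> acts as \<open>P \<mu>\<close> and \<open>g 1\<^sub>\<mu>\<close> as \<open>P \<mu>\<close> followed by \<open>Q g\<close>.\<close>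

fun path_act ::
  "('g \<Rightarrow> weight) \<Rightarrow> (weight \<Rightarrow> 'v \<Rightarrow> 'v) \<Rightarrow> ('g \<Rightarrow> 'v \<Rightarrow> 'v) \<Rightarrow> 'g path \<Rightarrow> 'v \<Rightarrow> 'v" where
  "path_act wt P Q ([], \<mu>) = P \<mu>"
| "path_act wt P Q (g # w, \<mu>) =
     Q g \<circ> P (\<mu> + sum_list (map wt w)) \<circ> path_act wt P Q (w, \<mu>)"

definition presented_act ::
  "('g \<Rightarrow> weight) \<Rightarrow> (weight \<Rightarrow> ('b \<Rightarrow>\<^sub>0 'k) \<Rightarrow> ('b \<Rightarrow>\<^sub>0 'k)) \<Rightarrow>
   ('g \<Rightarrow> ('b \<Rightarrow>\<^sub>0 'k) \<Rightarrow> ('b \<Rightarrow>\<^sub>0 'k)) \<Rightarrow>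
   ('g path \<Rightarrow>\<^sub>0 'k::field) set \<Rightarrow> ('b \<Rightarrow>\<^sub>0 'k) \<Rightarrow> ('b \<Rightarrow>\<^sub>0 'k)" where
  "presented_act wt P Q = quot_act (\<lambda>x v. lin (\<lambda>b. path_act wt P Q b v) x)"


section \<open>The supercategories of types \<open>\<pp>(n)\<close> and \<open>\<pp>~(m)\<close>\<close>

definition Xwt :: "nat \<Rightarrow> weight set" where
  "Xwt n = {\<mu>. keys \<mu> \<subseteq> {1..n}}"

definition eps :: "nat \<Rightarrow> weight" where
  "eps i = Poly_Mapping.single i 1"

definition wform :: "weight \<Rightarrow> weight \<Rightarrow> int" where
  "wform \<mu> \<nu> = (\<Sum>i\<in>keys \<mu>. lookup \<mu> i * lookup \<nu> i)"

definition alpha :: "nat \<Rightarrow> weight" where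
  "alpha i = eps i - eps (i + 1)"

definition beta :: "nat \<Rightarrow> weight" where
  "beta i = eps i + eps (i + 1)"

text \<open>\<open>adelta a n\<close> is \<open>a\<delta>\<^sub>n\<close>.\<close>

definition adelta :: "nat \<Rightarrow> nat \<Rightarrow> weight" where
  "adelta a n = (\<Sum>i = 1..n. Poly_Mapping.single i (int a))"

text \<open>The same names are used for the generators of both supercategories.\<close>

datatype gen = GE nat | GF nat | GB11 | GB nat | GC nat

definition gens :: "nat \<Rightarrow> gen set" where
  "gens n = {GB11} \<union> (\<Union>i\<in>{1..<n}. {GE i, GF i, GB i, GC i})"

fun gpar :: "gen \<Rightarrow> bit" where
  "gpar (GE i) = 0"
| "gpar (GF i) = 0"
| "gpar GB11 = 1"
| "gpar (GB i) = 1"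
| "gpar (GC i) = 1"

fun wt_p :: "gen \<Rightarrow> weight" where
  "wt_p (GE i) = alpha i"
| "wt_p (GF i) = - alpha i"
| "wt_p GB11 = eps 1 + eps 1"
| "wt_p (GB i) = beta i"
| "wt_p (GC i) = - beta i"

fun wt_pt :: "gen \<Rightarrow> weight" where
  "wt_pt (GE i) = alpha i"
| "wt_pt (GF i) = - alpha i"
| "wt_pt GB11 = - (eps 1 + eps 1)"
| "wt_pt (GB i) = - beta i"
| "wt_pt (GC i) = beta i"

definition wmult ::
  "(gen list \<Rightarrow>\<^sub>0 'k::field) \<Rightarrow> (gen list \<Rightarrow>\<^sub>0 'k) \<Rightarrow> (gen list \<Rightarrow>\<^sub>0 'k)" where
  "wmult = bilin (\<lambda>w w'. basvec (w @ w'))"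

definition wbr ::
  "(gen list \<Rightarrow>\<^sub>0 'k::field) \<Rightarrow> (gen list \<Rightarrow>\<^sub>0 'k) \<Rightarrow> (gen list \<Rightarrow>\<^sub>0 'k)"
  (\<open>\<lbrace>_, _\<rbrace>\<close>) where
  "wbr = bilin (\<lambda>w w'. basvec (w @ w') -
     scl (ksign (sum_list (map gpar w) * sum_list (map gpar w'))) (basvec (w' @ w)))"

abbreviation wE :: "nat \<Rightarrow> (gen list \<Rightarrow>\<^sub>0 'k::field)" where "wE i \<equiv> basvec [GE i]"
abbreviation wF :: "nat \<Rightarrow> (gen list \<Rightarrow>\<^sub>0 'k::field)" where "wF i \<equiv> basvec [GF i]"
abbreviation wB :: "nat \<Rightarrow> (gen list \<Rightarrow>\<^sub>0 'k::field)" where "wB i \<equiv> basvec [GB i]"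
abbreviation wC :: "nat \<Rightarrow> (gen list \<Rightarrow>\<^sub>0 'k::field)" where "wC i \<equiv> basvec [GC i]"
abbreviation wB11 :: "gen list \<Rightarrow>\<^sub>0 'k::field" where "wB11 \<equiv> basvec [GB11]"
abbreviation wone :: "gen list \<Rightarrow>\<^sub>0 'k::field" where "wone \<equiv> basvec []"

abbreviation adm :: "nat \<Rightarrow> nat \<Rightarrow> bool" where "adm n i \<equiv> 1 \<le> i \<and> i < n"
abbreviation adj :: "nat \<Rightarrow> nat \<Rightarrow> bool" where "adj i j \<equiv> j = i + 1 \<or> i = j + 1"

text \<open>A relation \<open>l = r\<close> at the object \<open>\<mu>\<close> is recorded as the element \<open>l - r\<close>.\<close>

inductive_set rels_p :: "nat \<Rightarrow> weight \<Rightarrow> (gen list \<Rightarrow>\<^sub>0 'k::field) set"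
  for n :: nat and \<mu> :: weight where
  EF: "adm n i \<Longrightarrow> adm n j \<Longrightarrow>
    \<lbrace>wE i, wF j\<rbrace> - (if i = j then scl (of_int (wform (alpha i) \<mu>)) wone else 0) \<in> rels_p n \<mu>"
| EE: "adm n i \<Longrightarrow> adm n j \<Longrightarrow> \<not> adj i j \<Longrightarrow> \<lbrace>wE i, wE j\<rbrace> \<in> rels_p n \<mu>"
| FF: "adm n i \<Longrightarrow> adm n j \<Longrightarrow> \<not> adj i j \<Longrightarrow> \<lbrace>wF i, wF j\<rbrace> \<in> rels_p n \<mu>"
| EEE: "adm n i \<Longrightarrow> adm n j \<Longrightarrow> adj i j \<Longrightarrow> \<lbrace>wE i, \<lbrace>wE i, wE j\<rbrace>\<rbrace> \<in> rels_p n \<mu>"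
| FFF: "adm n i \<Longrightarrow> adm n j \<Longrightarrow> adj i j \<Longrightarrow> \<lbrace>wF i, \<lbrace>wF i, wF j\<rbrace>\<rbrace> \<in> rels_p n \<mu>"
| BB: "adm n i \<Longrightarrow> adm n j \<Longrightarrow> \<lbrace>wB i, wB j\<rbrace> \<in> rels_p n \<mu>"
| CC: "adm n i \<Longrightarrow> adm n j \<Longrightarrow> \<lbrace>wC i, wC j\<rbrace> \<in> rels_p n \<mu>"
| BC: "adm n i \<Longrightarrow> adm n j \<Longrightarrow>
    \<lbrace>wB i, wC j\<rbrace> -
      (if j = i then - scl (of_int (wform (alpha i) \<mu>)) wone
       else if i = j + 1 then \<lbrace>wF (i - 1), wF i\<rbrace>
       else if j = i + 1 then \<lbrace>wE i, wE (i + 1)\<rbrace>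
       else 0) \<in> rels_p n \<mu>"
| BF: "adm n i \<Longrightarrow> adm n j \<Longrightarrow> j \<noteq> i \<Longrightarrow> j \<noteq> i + 1 \<Longrightarrow> \<lbrace>wB i, wF j\<rbrace> \<in> rels_p n \<mu>"
| BE: "adm n i \<Longrightarrow> adm n j \<Longrightarrow> j \<noteq> i \<Longrightarrow> i \<noteq> j + 1 \<Longrightarrow> \<lbrace>wB i, wE j\<rbrace> \<in> rels_p n \<mu>"
| BF_BE: "adm n i \<Longrightarrow> adm n (i + 1) \<Longrightarrow>
    \<lbrace>wB i, wF i\<rbrace> - \<lbrace>wB (i + 1), wE (i + 1)\<rbrace> \<in> rels_p n \<mu>"
| BF_BE': "adm n i \<Longrightarrow> adm n (i + 1) \<Longrightarrow>
    \<lbrace>wB i, wF (i + 1)\<rbrace> - \<lbrace>wB (i + 1), wE i\<rbrace> \<in> rels_p n \<mu>"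
| FC: "adm n i \<Longrightarrow> adm n j \<Longrightarrow> i \<noteq> j + 1 \<Longrightarrow> \<lbrace>wF j, wC i\<rbrace> \<in> rels_p n \<mu>"
| EC: "adm n i \<Longrightarrow> adm n j \<Longrightarrow> j \<noteq> i + 1 \<Longrightarrow> \<lbrace>wE j, wC i\<rbrace> \<in> rels_p n \<mu>"
| FC_EC: "adm n i \<Longrightarrow> adm n (i + 1) \<Longrightarrow>
    \<lbrace>wF i, wC (i + 1)\<rbrace> - \<lbrace>wE (i + 1), wC i\<rbrace> \<in> rels_p n \<mu>"
| BFF: "adm n i \<Longrightarrow> adm n j \<Longrightarrow>
    \<lbrace>\<lbrace>wB i, wF i\<rbrace>, wF j\<rbrace> - (if j = i + 1 then scl 2 (wB (i + 1)) else 0) \<in> rels_p n \<mu>"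
| BFE: "adm n 1 \<Longrightarrow> \<lbrace>\<lbrace>wB 1, wF 1\<rbrace>, wE 1\<rbrace> - scl 2 (wB 1) \<in> rels_p n \<mu>"
| BEE: "adm n 1 \<Longrightarrow> adm n j \<Longrightarrow> \<lbrace>\<lbrace>wB 1, wE 1\<rbrace>, wE j\<rbrace> \<in> rels_p n \<mu>"
| CFF: "adm n i \<Longrightarrow> adm n (i + 1) \<Longrightarrow>
    \<lbrace>\<lbrace>wC (i + 1), wF i\<rbrace>, wF (i + 1)\<rbrace> - wC i \<in> rels_p n \<mu>"
| CFF0: "adm n i \<Longrightarrow> adm n (i + 1) \<Longrightarrow> adm n j \<Longrightarrow> \<not> adj i j \<Longrightarrow>
    \<lbrace>\<lbrace>wC (i + 1), wF i\<rbrace>, wF j\<rbrace> \<in> rels_p n \<mu>"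
| EB: "adm n 1 \<Longrightarrow> scl 2 wB11 - \<lbrace>wE 1, wB 1\<rbrace> \<in> rels_p n \<mu>"
| B11: "wmult wB11 wB11 \<in> rels_p n \<mu>"

text \<open>The substitution \<open>E\<^sub>i \<mapsto> -F\<^sub>i\<close>, \<open>F\<^sub>i \<mapsto> -E\<^sub>i\<close>, fixing the odd generators.\<close>

fun tilde_gen :: "gen \<Rightarrow> (gen list \<Rightarrow>\<^sub>0 'k::field)" where
  "tilde_gen (GE i) = - wF i"
| "tilde_gen (GF i) = - wE i"
| "tilde_gen GB11 = wB11"
| "tilde_gen (GB i) = wB i"
| "tilde_gen (GC i) = wC i"

definition tilde_subst :: "(gen list \<Rightarrow>\<^sub>0 'k::field) \<Rightarrow> (gen list \<Rightarrow>\<^sub>0 'k)" where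
  "tilde_subst = lin (\<lambda>w. foldr (\<lambda>g. wmult (tilde_gen g)) w wone)"

definition rels_pt :: "nat \<Rightarrow> weight \<Rightarrow> (gen list \<Rightarrow>\<^sub>0 'k::field) set" where
  "rels_pt m \<mu> = tilde_subst ` rels_p m (- \<mu>)"

definition Udot_p :: "nat \<Rightarrow> ('k::field, weight, (gen path \<Rightarrow>\<^sub>0 'k) set) lusalg" where
  "Udot_p n = presented_alg (Xwt n) (gens n) wt_p gpar (rels_p n)"

definition Udot_pt :: "nat \<Rightarrow> ('k::field, weight, (gen path \<Rightarrow>\<^sub>0 'k) set) lusalg" where
  "Udot_pt m = presented_alg (Xwt m) (gens m) wt_pt gpar (rels_pt m)"


section \<open>Tensor powers of symmetric superalgebras\<close>

text \<open>\<open>Ind n\<close> is \<open>I\<^bsub>n|n\<^esub>\<close>.\<close>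

definition Ind :: "nat \<Rightarrow> int set" where
  "Ind n = {1..int n} \<union> {- int n..- 1}"

definition ipar :: "int \<Rightarrow> bit" where
  "ipar j = (if j < 0 then 1 else 0)"

text \<open>Both \<open>V\<^sub>r\<close> and \<open>W\<^sub>r\<close> have a basis indexed by \<open>Ind r\<close> with the same parities. The variable
  \<open>(t, j)\<close> is the basis vector with index \<open>j\<close> placed in the tensor factor \<open>t\<close>. An exponent
  function \<open>e\<close> stands for the monomial that is the tensor product over increasing \<open>t\<close> of
  the products over increasing \<open>l = 1, \<dots>, r\<close> of \<open>v\<^sub>l\<^bsup>e(t,l)\<^esup> v\<^bsub>-l\<^esub>\<^bsup>e(t,-l)\<^esup>\<close>; in the symmetric
  superalgebra this is the ordered product of its variables.\<close>

type_synonym var = "nat \<times> int"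
type_synonym mono = "var \<Rightarrow>\<^sub>0 nat"

definition sym_basis :: "nat \<Rightarrow> nat \<Rightarrow> mono set" where
  "sym_basis N r = {e. keys e \<subseteq> {1..N} \<times> Ind r \<and> (\<forall>(t, j)\<in>keys e. j < 0 \<longrightarrow> lookup e (t, j) = 1)}"

definition oddvars :: "mono \<Rightarrow> var set" where
  "oddvars e = {a \<in> keys e. snd a < 0}"

definition mpar :: "mono \<Rightarrow> bit" where
  "mpar e = of_nat (card (oddvars e))"

text \<open>The tensor power with \<open>N\<close> factors of the symmetric superalgebra of the
  \<open>r|r\<close>-dimensional superspace.\<close>

definition Sym :: "nat \<Rightarrow> nat \<Rightarrow> mono sspace" where
  "Sym N r = \<lparr>basis = sym_basis N r, bpar = mpar\<rparr>"

definition vless :: "var \<Rightarrow> var \<Rightarrow> bool" where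
  "vless a b \<longleftrightarrow> fst a < fst b \<or> (fst a = fst b \<and> \<bar>snd a\<bar> < \<bar>snd b\<bar>)"

text \<open>The sign comes from moving the odd variables of \<open>f\<close> past the larger odd variables
  of \<open>e\<close>.\<close>

definition mono_mult :: "mono \<Rightarrow> mono \<Rightarrow> (mono \<Rightarrow>\<^sub>0 'k::field)" where
  "mono_mult e f =
    (if oddvars e \<inter> oddvars f = {}
     then Poly_Mapping.single (e + f)
       ((- 1) ^ card {(a, b). a \<in> oddvars e \<and> b \<in> oddvars f \<and> vless b a})
     else 0)"

definition sym_mult :: "(mono \<Rightarrow>\<^sub>0 'k::field) \<Rightarrow> (mono \<Rightarrow>\<^sub>0 'k) \<Rightarrow> (mono \<Rightarrow>\<^sub>0 'k)" where
  "sym_mult = bilin mono_mult"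

text \<open>\<open>zz a\<close> is the left multiplication by the variable \<open>a\<close>, and \<open>dd a\<close> the superderivation
  dual to it: an odd derivation passes all smaller odd variables. See \<open>dd_variable\<close> and
  \<open>dd_mono_mult\<close> below.\<close>

definition zz :: "var \<Rightarrow> (mono \<Rightarrow>\<^sub>0 'k::field) \<Rightarrow> (mono \<Rightarrow>\<^sub>0 'k)" where
  "zz a = sym_mult (basvec (Poly_Mapping.single a 1))"

definition dd :: "var \<Rightarrow> (mono \<Rightarrow>\<^sub>0 'k::field) \<Rightarrow> (mono \<Rightarrow>\<^sub>0 'k)" where
  "dd a = lin (\<lambda>e. Poly_Mapping.single (e - Poly_Mapping.single a 1)
     (of_nat (lookup e a) * (if snd a < 0 then (- 1) ^ card {b \<in> oddvars e. vless b a} else 1)))"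

lemma dd_variable:
  "dd a (basvec (Poly_Mapping.single b 1)) = (if a = b then basvec 0 else (0 :: mono \<Rightarrow>\<^sub>0 'k::field))"
proof -
  have "{x \<in> oddvars (Poly_Mapping.single a (1::nat)). vless x a} = {}"
    by (auto simp: oddvars_def vless_def)
  then have "card {x \<in> oddvars (Poly_Mapping.single a (Suc 0)). vless x a} = 0"
    by (simp only: One_nat_def card.empty)
  then show ?thesis
    unfolding dd_def lin_single scl_single by (auto simp: lookup_single)
qed

definition cbelow :: "var \<Rightarrow> var set \<Rightarrow> nat" where
  "cbelow a S = card {b \<in> S. vless b a}"

definition cinv :: "var set \<Rightarrow> var set \<Rightarrow> nat" where
  "cinv S T = card {(a, b). a \<in> S \<and> b \<in> T \<and> vless b a}"

lemma cinv_remove_left: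
  assumes "finite S" "finite T" "a \<in> S"
  shows "cinv S T = cinv (S - {a}) T + cbelow a T"
proof -
  have eq: "{(x, y). x \<in> S \<and> y \<in> T \<and> vless y x} =
      {(x, y). x \<in> S - {a} \<and> y \<in> T \<and> vless y x} \<union> Pair a ` {y \<in> T. vless y a}"
    using assms(3) by auto
  have fin: "finite {(x, y). x \<in> S - {a} \<and> y \<in> T \<and> vless y x}"
    by (rule finite_subset[of _ "S \<times> T"]) (use assms in auto)
  show ?thesis
    unfolding cinv_def cbelow_def eq
    by (subst card_Un_disjoint) (use fin assms(2) in \<open>auto simp: card_image inj_on_def\<close>)
qed

lemma cinv_remove_right:
  assumes "finite S" "finite T" "a \<in> T"
  shows "cinv S T = cinv S (T - {a}) + card {x \<in> S. vless a x}"
proof -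
  have eq: "{(x, y). x \<in> S \<and> y \<in> T \<and> vless y x} =
      {(x, y). x \<in> S \<and> y \<in> T - {a} \<and> vless y x} \<union> (\<lambda>x. (x, a)) ` {x \<in> S. vless a x}"
    using assms(3) by auto
  have fin: "finite {(x, y). x \<in> S \<and> y \<in> T - {a} \<and> vless y x}"
    by (rule finite_subset[of _ "S \<times> T"]) (use assms in auto)
  show ?thesis
    unfolding cinv_def eq
    by (subst card_Un_disjoint) (use fin assms(1) in \<open>auto simp: card_image inj_on_def\<close>)
qed

lemma card_split_odd:
  assumes "finite S" "\<And>x. x \<in> S \<Longrightarrow> snd x < 0" "snd a < 0"
  shows "card S = cbelow a S + card {x \<in> S. vless a x} + (if a \<in> S then 1 else 0)"
proof -
  have eq: "S = ({x \<in> S. vless x a} \<union> {x \<in> S. vless a x}) \<union> (if a \<in> S then {a} else {})"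
  proof -
    have "vless x a \<or> vless a x \<or> x = a" if "x \<in> S" for x
      using assms(2)[OF that] assms(3) by (auto simp: vless_def prod_eq_iff)
    then show ?thesis by auto
  qed
  have "card S = card ({x \<in> S. vless x a} \<union> {x \<in> S. vless a x}) + card (if a \<in> S then {a} else {})"
    by (subst eq, rule card_Un_disjoint) (use assms(1) in \<open>auto simp: vless_def\<close>)
  also have "card ({x \<in> S. vless x a} \<union> {x \<in> S. vless a x}) = cbelow a S + card {x \<in> S. vless a x}"
    unfolding cbelow_def by (rule card_Un_disjoint) (use assms(1) in \<open>auto simp: vless_def\<close>)
  finally show ?thesis by simp
qed

lemma cbelow_Un:
  assumes "finite S" "finite T" "S \<inter> T = {}"
  shows "cbelow a (S \<union> T) = cbelow a S + cbelow a T"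
proof -
  have "{b \<in> S \<union> T. vless b a} = {b \<in> S. vless b a} \<union> {b \<in> T. vless b a}" by auto
  then show ?thesis
    unfolding cbelow_def using assms by (auto intro!: card_Un_disjoint)
qed

lemma finite_oddvars: "finite (oddvars e)"
  unfolding oddvars_def by simp

definition csgn :: "var set \<Rightarrow> var set \<Rightarrow> 'k::field" where
  "csgn S T = (if S \<inter> T = {} then (- 1) ^ cinv S T else 0)"

lemma mono_mult_alt:
  "mono_mult e f = Poly_Mapping.single (e + f) (csgn (oddvars e) (oddvars f))"
  by (simp add: mono_mult_def cinv_def csgn_def)

lemma dd_single:
  "dd a (Poly_Mapping.single e c) = Poly_Mapping.single (e - Poly_Mapping.single a 1)
     (c * of_nat (lookup e a) * (if snd a < 0 then (- 1) ^ cbelow a (oddvars e) else 1))"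
  by (simp add: dd_def lin_single scl_single cbelow_def mult.assoc)

lemma sym_mult_single:
  "sym_mult (Poly_Mapping.single e c) (Poly_Mapping.single f d) = scl (c * d) (mono_mult e f)"
  by (rule poly_mapping_eqI) (simp add: sym_mult_def bilin_def lin_single lookup_scl mult.assoc)

text \<open>The superderivation property: \<open>\<partial>(ef) = \<partial>(e) f + (-1)\<^bsup>|\<partial>||e|\<^esup> e \<partial>(f)\<close>.\<close>

lemma dd_mono_mult:
  fixes e f :: mono
  assumes e: "e \<in> sym_basis N r" and f: "f \<in> sym_basis N r"
  shows "dd a (mono_mult e f) =
    sym_mult (dd a (basvec e)) (basvec f) +
    scl (ksign (ipar (snd a) * mpar e) :: 'k::field) (sym_mult (basvec e) (dd a (basvec f)))"
proof -
  define A where "A = Poly_Mapping.single a (1::nat)"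
  let ?O = "oddvars e" and ?P = "oddvars f"
  let ?D = "\<lambda>g. if snd a < 0 then (- 1) ^ cbelow a (oddvars g) else (1::'k)"
  let ?s = "ksign (ipar (snd a) * mpar e) :: 'k"
  note fin = finite_oddvars[of e] finite_oddvars[of f]
  have sub_l: "e - A + f = e + f - A" if "lookup e a \<noteq> 0"
    using that unfolding A_def
    by (auto intro!: poly_mapping_eqI simp: lookup_add lookup_minus lookup_single when_def)
  have sub_r: "e + (f - A) = e + f - A" if "lookup f a \<noteq> 0"
    using that unfolding A_def
    by (auto intro!: poly_mapping_eqI simp: lookup_add lookup_minus lookup_single when_def)
  define X where "X = csgn ?O ?P * of_nat (lookup e a + lookup f a) * ?D (e + f)"
  define Y where "Y = of_nat (lookup e a) * ?D e * csgn (oddvars (e - A)) ?P"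
  define Z where "Z = ?s * (of_nat (lookup f a) * ?D f * csgn ?O (oddvars (f - A)))"
  have lhs: "dd a (mono_mult e f) = Poly_Mapping.single (e + f - A) X"
    by (simp only: mono_mult_alt dd_single X_def A_def lookup_add)
  have rhs1: "sym_mult (dd a (basvec e)) (basvec f) = Poly_Mapping.single (e + f - A) Y"
  proof -
    have "sym_mult (dd a (basvec e)) (basvec f) = Poly_Mapping.single (e - A + f) Y"
      by (simp only: dd_single sym_mult_single mono_mult_alt scl_single Y_def A_def mult_1 mult_1_right)
    then show ?thesis using sub_l by (cases "lookup e a = 0") (simp_all add: Y_def)
  qed
  have rhs2: "scl ?s (sym_mult (basvec e) (dd a (basvec f))) = Poly_Mapping.single (e + f - A) Z"
  proof -
    have "scl ?s (sym_mult (basvec e) (dd a (basvec f))) = Poly_Mapping.single (e + (f - A)) Z"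
      by (simp only: dd_single sym_mult_single mono_mult_alt scl_single Z_def A_def mult_1 mult_1_right)
    then show ?thesis using sub_r by (cases "lookup f a = 0") (simp_all add: Z_def)
  qed
  have "X = Y + Z"
  proof (cases "snd a < 0")
    case False
    have "oddvars (g - A) = oddvars g" for g
      using False unfolding A_def
      by (auto simp: oddvars_def in_keys_iff lookup_minus lookup_single when_def split: if_splits)
    with False show ?thesis
      by (simp add: X_def Y_def Z_def ipar_def ksign_def algebra_simps)
  next
    case True
    have le: "lookup g a = (if a \<in> oddvars g then 1 else 0)" if "g \<in> sym_basis N r" for g
      using that True by (cases a) (auto simp: sym_basis_def oddvars_def in_keys_iff)
    have minus: "oddvars (g - A) = oddvars g - {a}" if "g \<in> sym_basis N r" for g
    proof -
      have "lookup (g - A) b = (if b = a then 0 else lookup g b)" for b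
        using le[OF that] by (auto simp: A_def lookup_minus lookup_single when_def)
      then show ?thesis by (auto simp: oddvars_def in_keys_iff)
    qed
    have odd_add: "oddvars (e + f) = ?O \<union> ?P"
      by (auto simp: oddvars_def in_keys_iff lookup_add)
    have "(ksign (of_nat k) :: 'k) = (- 1) ^ k" for k
      by (induction k) (auto simp: ksign_def)
    moreover have "ipar (snd a) * mpar e = of_nat (card ?O)"
      using True by (simp only: ipar_def mpar_def if_True mult_1)
    ultimately have sgn: "?s = (- 1) ^ card ?O"
      by simp
    have cO: "card ?O = cbelow a ?O + card {x \<in> ?O. vless a x} + (if a \<in> ?O then 1 else 0)"
      by (rule card_split_odd) (use fin True in \<open>auto simp: oddvars_def\<close>)
    note L = cinv_remove_left[OF fin, of a] and R = cinv_remove_right[OF fin, of a]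
    consider "a \<in> ?O" "a \<in> ?P" | "a \<in> ?O" "a \<notin> ?P" | "a \<notin> ?O" "a \<in> ?P"
      | "a \<notin> ?O" "a \<notin> ?P" by blast
    then show ?thesis
    proof cases
      case 1
      have disj: "?O \<inter> (?P - {a}) = (?O - {a}) \<inter> ?P" by auto
      have X0: "X = 0" using 1 by (auto simp: X_def csgn_def)
      have "cinv (?O - {a}) ?P + cbelow a ?P = cinv ?O (?P - {a}) + card {x \<in> ?O. vless a x}"
        using L R 1 by simp
      moreover have "card ?O = cbelow a ?O + card {x \<in> ?O. vless a x} + 1"
        using cO 1 by simp
      ultimately have "card ?O + cbelow a ?P + cinv ?O (?P - {a}) =
          cbelow a ?O + cinv (?O - {a}) ?P + 1 + 2 * cbelow a ?P"
        by linarith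
      then have "(- 1 :: 'k) ^ (card ?O + cbelow a ?P + cinv ?O (?P - {a})) =
          (- 1) ^ (cbelow a ?O + cinv (?O - {a}) ?P + 1 + 2 * cbelow a ?P)"
        by (rule arg_cong)
      then have "(- 1 :: 'k) ^ card ?O * ((- 1) ^ cbelow a ?P * (- 1) ^ cinv ?O (?P - {a})) =
          - ((- 1) ^ cbelow a ?O * (- 1) ^ cinv (?O - {a}) ?P)"
        by (simp add: power_add power_mult mult.assoc)
      moreover have "Z = (- 1) ^ card ?O * (of_nat (lookup f a) * ?D f * csgn ?O (oddvars (f - A)))"
        by (simp only: Z_def sgn)
      ultimately show ?thesis
        using 1 True
        by (simp add: X0 Y_def csgn_def minus[OF e] minus[OF f] le[OF e] le[OF f] disj)
    next
      case 2
      then have disj: "(?O - {a}) \<inter> ?P = ?O \<inter> ?P" by auto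
      have "cinv ?O ?P + (cbelow a ?O + cbelow a ?P) =
          cbelow a ?O + cinv (?O - {a}) ?P + 2 * cbelow a ?P"
        using L 2 by simp
      then have "(- 1 :: 'k) ^ (cinv ?O ?P + (cbelow a ?O + cbelow a ?P)) =
          (- 1) ^ (cbelow a ?O + cinv (?O - {a}) ?P + 2 * cbelow a ?P)"
        by (rule arg_cong)
      then have "(- 1 :: 'k) ^ cinv ?O ?P * (- 1) ^ (cbelow a ?O + cbelow a ?P) =
          (- 1) ^ cbelow a ?O * (- 1) ^ cinv (?O - {a}) ?P"
        by (simp add: power_add power_mult)
      with 2 True show ?thesis
        by (cases "?O \<inter> ?P = {}")
          (simp_all add: X_def Y_def Z_def csgn_def minus[OF e] le[OF e] le[OF f] odd_add
            cbelow_Un[OF fin] disj)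
    next
      case 3
      then have disj: "?O \<inter> (?P - {a}) = ?O \<inter> ?P" by auto
      have "cinv ?O ?P + (cbelow a ?O + cbelow a ?P) =
          card ?O + cbelow a ?P + cinv ?O (?P - {a})"
        using R cO 3 by simp
      then have "(- 1 :: 'k) ^ (cinv ?O ?P + (cbelow a ?O + cbelow a ?P)) =
          (- 1) ^ (card ?O + cbelow a ?P + cinv ?O (?P - {a}))"
        by (rule arg_cong)
      then have "(- 1 :: 'k) ^ cinv ?O ?P * (- 1) ^ (cbelow a ?O + cbelow a ?P) =
          (- 1) ^ card ?O * ((- 1) ^ cbelow a ?P * (- 1) ^ cinv ?O (?P - {a}))"
        by (simp only: power_add mult.assoc)
      moreover have "Z = (- 1) ^ card ?O * (of_nat (lookup f a) * ?D f * csgn ?O (oddvars (f - A)))"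
        by (simp only: Z_def sgn)
      ultimately show ?thesis
        using 3 True
        by (cases "?O \<inter> ?P = {}")
          (simp_all add: X_def Y_def csgn_def minus[OF f] le[OF e] le[OF f] odd_add
            cbelow_Un[OF fin] disj)
    next
      case 4
      then show ?thesis by (simp add: X_def Y_def Z_def le[OF e] le[OF f])
    qed
  qed
  then show ?thesis
    unfolding lhs rhs1 rhs2 by (simp add: single_add)
qed

text \<open>Weight with respect to the diagonal matrices, and multidegree with respect to the
  tensor factors.\<close>

definition mweight :: "mono \<Rightarrow> weight" where
  "mweight e = (\<Sum>(t, j)\<in>keys e.
     Poly_Mapping.single (nat \<bar>j\<bar>) (sgn j * int (lookup e (t, j))))"

definition mdegree :: "mono \<Rightarrow> weight" where
  "mdegree e = (\<Sum>(t, j)\<in>keys e. Poly_Mapping.single t (int (lookup e (t, j))))"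

definition proj :: "(mono \<Rightarrow> bool) \<Rightarrow> (mono \<Rightarrow>\<^sub>0 'k::field) \<Rightarrow> (mono \<Rightarrow>\<^sub>0 'k)" where
  "proj Q = lin (\<lambda>e. if Q e then basvec e else 0)"


section \<open>The actions\<close>

definition Emat :: "int \<Rightarrow> int \<Rightarrow> int \<Rightarrow> int \<Rightarrow> 'k::field" where
  "Emat i j = (\<lambda>r s. if r = i \<and> s = j then 1 else 0)"

definition mat_a :: "int \<Rightarrow> int \<Rightarrow> int \<Rightarrow> int \<Rightarrow> 'k::field" where
  "mat_a i j = (\<lambda>r s. Emat i j r s - Emat (- j) (- i) r s)"

definition mat_b :: "int \<Rightarrow> int \<Rightarrow> int \<Rightarrow> int \<Rightarrow> 'k::field" where
  "mat_b i j = (\<lambda>r s. (if i = j then 1 / 2 else 1) * (Emat i (- j) r s + Emat j (- i) r s))"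

definition mat_c :: "int \<Rightarrow> int \<Rightarrow> int \<Rightarrow> int \<Rightarrow> 'k::field" where
  "mat_c i j = (\<lambda>r s. Emat (- i) j r s - Emat (- j) i r s)"

definition mat_bt :: "int \<Rightarrow> int \<Rightarrow> int \<Rightarrow> int \<Rightarrow> 'k::field" where
  "mat_bt i j = (\<lambda>r s. (if i = j then 1 / 2 else 1) * (Emat (- i) j r s + Emat (- j) i r s))"

definition mat_ct :: "int \<Rightarrow> int \<Rightarrow> int \<Rightarrow> int \<Rightarrow> 'k::field" where
  "mat_ct i j = (\<lambda>r s. Emat i (- j) r s - Emat j (- i) r s)"

text \<open>The natural action of a matrix: the superderivation extending, in each of the \<open>N\<close> tensor
  factors, the given linear map \<open>v\<^sub>j \<mapsto> (\<Sum>i. X i j v\<^sub>i)\<close>.\<close>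

definition nat_act ::
  "nat \<Rightarrow> nat \<Rightarrow> (int \<Rightarrow> int \<Rightarrow> 'k::field) \<Rightarrow> (mono \<Rightarrow>\<^sub>0 'k) \<Rightarrow> (mono \<Rightarrow>\<^sub>0 'k)" where
  "nat_act N r X v =
    (\<Sum>t = 1..N. \<Sum>i\<in>Ind r. \<Sum>j\<in>Ind r. scl (X i j) (zz (t, i) (dd (t, j) v)))"

lemma finite_Ind: "finite (Ind r)"
  by (simp add: Ind_def)

lemma zz_one: "zz a (basvec 0) = basvec (Poly_Mapping.single a 1)"
  unfolding zz_def sym_mult_single mono_mult_alt scl_single
  by (simp add: csgn_def oddvars_def cinv_def)

lemma zz_zero: "zz a 0 = 0"
  by (rule poly_mapping_eqI) (simp add: zz_def sym_mult_def bilin_def lin_single lookup_scl, simp add: lin_def)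

lemma scl_zero: "scl c 0 = 0"
  by (rule poly_mapping_eqI) (simp add: lookup_scl)

lemma nat_act_variable:
  assumes "t \<in> {1..N}" and "j \<in> Ind r"
  shows "nat_act N r X (basvec (Poly_Mapping.single (t, j) 1)) =
    (\<Sum>i\<in>Ind r. scl (X i j :: 'k::field) (basvec (Poly_Mapping.single (t, i) 1)))"
proof -
  have "scl (X i j') (zz (t', i) (dd (t', j') (basvec (Poly_Mapping.single (t, j) 1)))) =
      (if t' = t then if j' = j then scl (X i j) (basvec (Poly_Mapping.single (t, i) 1)) else 0 else 0)"
    for t' i j'
    unfolding dd_variable by (cases "t' = t"; cases "j' = j")
      (simp_all only: prod.inject if_True if_False simp_thms zz_one zz_zero scl_zero)
  then have "nat_act N r X (basvec (Poly_Mapping.single (t, j) 1)) =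
    (\<Sum>t' = 1..N. \<Sum>i\<in>Ind r. \<Sum>j'\<in>Ind r.
       if t' = t then if j' = j then scl (X i j) (basvec (Poly_Mapping.single (t, i) 1)) else 0 else 0)"
    unfolding nat_act_def by (simp only:)
  also have "\<dots> = (\<Sum>t' = 1..N. if t' = t
      then \<Sum>i\<in>Ind r. scl (X i j) (basvec (Poly_Mapping.single (t, i) 1)) else 0)"
    by (rule sum.cong[OF refl]) (use assms(2) in \<open>simp add: finite_Ind\<close>)
  also have "\<dots> = (\<Sum>i\<in>Ind r. scl (X i j) (basvec (Poly_Mapping.single (t, i) 1)))"
    using assms(1) by simp
  finally show ?thesis .
qed

text \<open>The one-dimensional even superspaces spanned by \<open>v\<^bsub>a\<delta>\<^esub>\<close>.\<close>

definition line :: "unit sspace" where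
  "line = \<lparr>basis = UNIV, bpar = (\<lambda>_. 0)\<rparr>"

text \<open>The module \<open>\<A> \<otimes> \<k>\<^bsub>m\<delta>\<^sub>n\<^esub>\<close>, whose variables are \<open>z\<^bsub>k,j\<^esub> = zz (k, j)\<close>.\<close>

definition MA :: "nat \<Rightarrow> nat \<Rightarrow> (mono \<times> unit) sspace" where
  "MA m n = tensor_space (Sym m n) line"

fun opA_p :: "nat \<Rightarrow> nat \<Rightarrow> gen \<Rightarrow> (mono \<Rightarrow>\<^sub>0 'k::field) \<Rightarrow> (mono \<Rightarrow>\<^sub>0 'k)" where
  "opA_p m n (GE i) = nat_act m n (mat_a (int i) (int i + 1))"
| "opA_p m n (GF i) = nat_act m n (mat_a (int i + 1) (int i))"
| "opA_p m n GB11 = nat_act m n (mat_b 1 1)"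
| "opA_p m n (GB i) = nat_act m n (mat_b (int i) (int i + 1))"
| "opA_p m n (GC i) = nat_act m n (mat_c (int i) (int i + 1))"

fun opA_pt :: "nat \<Rightarrow> nat \<Rightarrow> gen \<Rightarrow> (mono \<Rightarrow>\<^sub>0 'k::field) \<Rightarrow> (mono \<Rightarrow>\<^sub>0 'k)" where
  "opA_pt m n (GE i) v = (\<Sum>r\<in>Ind n. zz (i, r) (dd (i + 1, r) v))"
| "opA_pt m n (GF i) v = (\<Sum>r\<in>Ind n. zz (i + 1, r) (dd (i, r) v))"
| "opA_pt m n GB11 v = (\<Sum>r = 1..int n. dd (1, r) (dd (1, - r) v))"
| "opA_pt m n (GB i) v = (\<Sum>r\<in>Ind n. dd (i, r) (dd (i + 1, - r) v))"
| "opA_pt m n (GC i) v =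
     (\<Sum>r\<in>Ind n. scl (ksign (ipar r)) (zz (i, r) (zz (i + 1, - r) v)))"

definition actA_p ::
  "nat \<Rightarrow> nat \<Rightarrow> (gen path \<Rightarrow>\<^sub>0 'k::field) set \<Rightarrow> (mono \<times> unit \<Rightarrow>\<^sub>0 'k) \<Rightarrow> (mono \<times> unit \<Rightarrow>\<^sub>0 'k)" where
  "actA_p m n = presented_act wt_p
     (\<lambda>\<mu>. tensor_map (proj (\<lambda>e. mweight e = \<mu> - adelta m n)) id)
     (\<lambda>g. tensor_map (opA_p m n g) id)"

definition actA_pt ::
  "nat \<Rightarrow> nat \<Rightarrow> (gen path \<Rightarrow>\<^sub>0 'k::field) set \<Rightarrow> (mono \<times> unit \<Rightarrow>\<^sub>0 'k) \<Rightarrow> (mono \<times> unit \<Rightarrow>\<^sub>0 'k)" where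
  "actA_pt m n = presented_act wt_pt
     (\<lambda>\<mu>. tensor_map (proj (\<lambda>e. mdegree e = \<mu>)) id)
     (\<lambda>g. tensor_map (opA_pt m n g) id)"

definition actA ::
  "nat \<Rightarrow> nat \<Rightarrow> ((gen path \<Rightarrow>\<^sub>0 'k) set \<times> (gen path \<Rightarrow>\<^sub>0 'k) set \<Rightarrow>\<^sub>0 'k::field) set \<Rightarrow>
   (mono \<times> unit \<Rightarrow>\<^sub>0 'k) \<Rightarrow> (mono \<times> unit \<Rightarrow>\<^sub>0 'k)" where
  "actA m n = tensor_act (actA_p m n) (actA_pt m n)"

text \<open>The module \<open>\<A>' \<otimes> \<k>~\<^bsub>n\<delta>\<^sub>m\<^esub>\<close>. Here the tensor factor is the second index of
  \<open>z'\<^bsub>j,l\<^esub>\<close>.\<close>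

definition MA' :: "nat \<Rightarrow> nat \<Rightarrow> (mono \<times> unit) sspace" where
  "MA' m n = tensor_space (Sym n m) line"

definition zz' :: "int \<Rightarrow> nat \<Rightarrow> (mono \<Rightarrow>\<^sub>0 'k::field) \<Rightarrow> (mono \<Rightarrow>\<^sub>0 'k)" where
  "zz' j l = zz (l, j)"

definition dd' :: "int \<Rightarrow> nat \<Rightarrow> (mono \<Rightarrow>\<^sub>0 'k::field) \<Rightarrow> (mono \<Rightarrow>\<^sub>0 'k)" where
  "dd' j l = dd (l, j)"

fun opA'_pt :: "nat \<Rightarrow> nat \<Rightarrow> gen \<Rightarrow> (mono \<Rightarrow>\<^sub>0 'k::field) \<Rightarrow> (mono \<Rightarrow>\<^sub>0 'k)" where
  "opA'_pt m n (GE i) = nat_act n m (mat_a (int i) (int i + 1))"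
| "opA'_pt m n (GF i) = nat_act n m (mat_a (int i + 1) (int i))"
| "opA'_pt m n GB11 = nat_act n m (mat_bt 1 1)"
| "opA'_pt m n (GB i) = nat_act n m (mat_bt (int i) (int i + 1))"
| "opA'_pt m n (GC i) = nat_act n m (mat_ct (int i) (int i + 1))"

fun opA'_p :: "nat \<Rightarrow> nat \<Rightarrow> gen \<Rightarrow> (mono \<Rightarrow>\<^sub>0 'k::field) \<Rightarrow> (mono \<Rightarrow>\<^sub>0 'k)" where
  "opA'_p m n (GE i) v = (\<Sum>r\<in>Ind m. zz' r i (dd' r (i + 1) v))"
| "opA'_p m n (GF i) v = (\<Sum>r\<in>Ind m. zz' r (i + 1) (dd' r i v))"
| "opA'_p m n GB11 v = (\<Sum>r = 1..int m. zz' r 1 (zz' (- r) 1 v))"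
| "opA'_p m n (GB i) v = (\<Sum>r\<in>Ind m. zz' r i (zz' (- r) (i + 1) v))"
| "opA'_p m n (GC i) v =
     (\<Sum>r\<in>Ind m. scl (ksign (ipar r)) (dd' (- r) i (dd' r (i + 1) v)))"

definition actA'_p ::
  "nat \<Rightarrow> nat \<Rightarrow> (gen path \<Rightarrow>\<^sub>0 'k::field) set \<Rightarrow> (mono \<times> unit \<Rightarrow>\<^sub>0 'k) \<Rightarrow> (mono \<times> unit \<Rightarrow>\<^sub>0 'k)" where
  "actA'_p m n = presented_act wt_p
     (\<lambda>\<mu>. tensor_map (proj (\<lambda>e. mdegree e = \<mu>)) id)
     (\<lambda>g. tensor_map (opA'_p m n g) id)"

definition actA'_pt ::
  "nat \<Rightarrow> nat \<Rightarrow> (gen path \<Rightarrow>\<^sub>0 'k::field) set \<Rightarrow> (mono \<times> unit \<Rightarrow>\<^sub>0 'k) \<Rightarrow> (mono \<times> unit \<Rightarrow>\<^sub>0 'k)" where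
  "actA'_pt m n = presented_act wt_pt
     (\<lambda>\<mu>. tensor_map (proj (\<lambda>e. mweight e = \<mu> - adelta n m)) id)
     (\<lambda>g. tensor_map (opA'_pt m n g) id)"

definition actA' ::
  "nat \<Rightarrow> nat \<Rightarrow> ((gen path \<Rightarrow>\<^sub>0 'k) set \<times> (gen path \<Rightarrow>\<^sub>0 'k) set \<Rightarrow>\<^sub>0 'k::field) set \<Rightarrow>
   (mono \<times> unit \<Rightarrow>\<^sub>0 'k) \<Rightarrow> (mono \<times> unit \<Rightarrow>\<^sub>0 'k)" where
  "actA' m n = tensor_act (actA'_p m n) (actA'_pt m n)"


section \<open>The map \<open>\<phi> \<otimes> \<eta>\<close>\<close>

definition kappa :: "nat \<Rightarrow> nat \<Rightarrow> (nat \<Rightarrow> nat \<Rightarrow> nat) \<Rightarrow> nat" where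
  "kappa m n \<epsilon> = (\<Sum>(k, k', l, l') \<in>
     {(k, k', l, l'). 1 \<le> k \<and> k < k' \<and> k' \<le> m \<and> 1 \<le> l' \<and> l' < l \<and> l \<le> n}.
       (1 - \<epsilon> k l) * (1 - \<epsilon> k' l'))"

definition chi :: "nat \<Rightarrow> nat \<Rightarrow> (nat \<Rightarrow> nat \<Rightarrow> nat) \<Rightarrow> nat" where
  "chi m n \<epsilon> = (\<Sum>k = 1..m. \<Sum>l = 1..n. (m * l + m + m * n + k + 1) * \<epsilon> k l)"

text \<open>In a monomial \<open>e\<close> of \<open>\<A>'\<close>, the exponents \<open>d\<^bsub>kl\<^esub>\<close> and \<open>\<epsilon>\<^bsub>kl\<^esub>\<close> of \<open>w\<^sub>k\<close> and \<open>w\<^bsub>-k\<^esub>\<close> in the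
  tensor factor \<open>l\<close> are \<open>e(l, k)\<close> and \<open>e(l, -k)\<close>.\<close>

definition phi :: "nat \<Rightarrow> nat \<Rightarrow> (mono \<Rightarrow>\<^sub>0 'k::field) \<Rightarrow> (mono \<Rightarrow>\<^sub>0 'k)" where
  "phi m n = lin (\<lambda>e.
    let d = (\<lambda>k l. lookup e (l, int k));
        \<epsilon> = (\<lambda>k l. lookup e (l, - int k))
    in Poly_Mapping.single
      (\<Sum>k = 1..m. \<Sum>l = 1..n.
         Poly_Mapping.single (k, int l) (d k l) + Poly_Mapping.single (k, - int l) (1 - \<epsilon> k l))
      ((- 1) ^ (kappa m n \<epsilon> + chi m n \<epsilon>)))"

definition eta :: "(unit \<Rightarrow>\<^sub>0 'k::field) \<Rightarrow> (unit \<Rightarrow>\<^sub>0 'k)" where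
  "eta = lin (\<lambda>_. basvec ())"

end

theory Submission
  imports Defs
begin

text \<open>
  Write \<open>z\<^bsub>k,j\<^esub>\<close> and \<open>\<partial>\<^bsub>k,j\<^esub>\<close> for the multiplications and superderivations on \<open>\<A>\<close>. They generate a
  super Weyl algebra: a Weyl algebra in the even variables and a Clifford algebra in the odd
  ones. The operators \<open>T\<^bsub>i,j\<^esub> = (\<Sum>k. z\<^bsub>k,i\<^esub> \<partial>\<^bsub>k,j\<^esub>)\<close> satisfy the commutation rules of the matrix units of
  \<open>\<gg>\<ll>(n|n)\<close> (\<open>T_gl_rep\<close>), and the action of \<open>\<pp>(n)\<close> is given by the usual combinations
  of them. Its defining relations are therefore bracket computations (\<open>relations_vanish\<close>); the
  two that mention the weight hold on weight spaces.

  The other algebra enters through a duality. A Clifford algebra does not distinguish odd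
  variables from odd derivations, so one may put, for \<open>k, l > 0\<close>,
  \<open>z\<^sup>*\<^bsub>l,k\<^esub> = z\<^bsub>k,l\<^esub>\<close>, \<open>\<partial>\<^sup>*\<^bsub>l,k\<^esub> = \<partial>\<^bsub>k,l\<^esub>\<close>, \<open>z\<^sup>*\<^bsub>l,-k\<^esub> = \<partial>\<^bsub>k,-l\<^esub>\<close>, \<open>\<partial>\<^sup>*\<^bsub>l,-k\<^esub> = z\<^bsub>k,-l\<^esub>\<close>. These satisfy the same
  rules with \<open>m\<close> and \<open>n\<close> exchanged (\<open>dual\<close>), and the differential operators through which
  \<open>\<pp>~(m)\<close> acts on \<open>\<A>\<close> are the natural action written in the dual generators (\<open>dual_gens\<close>).
  As \<open>\<pp>~(m)\<close> is \<open>\<pp>(m)\<close> with the two halves of the index set exchanged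
  (\<open>gl_rep_flip\<close>), its relations follow from those of \<open>\<pp>(m)\<close>. The two actions supercommute because
  the operators of \<open>\<pp>~(m)\<close> are contractions over the index \<open>r \<in> I\<^bsub>n|n\<^esub>\<close> that are invariant under
  \<open>\<pp>(n)\<close> (\<open>supercommute_gens\<close>). The same applies to \<open>\<A>'\<close> with the two algebras exchanged.

  So the theorem says that \<open>\<phi>\<close> matches the dual generators on \<open>\<A>'\<close> with the generators on \<open>\<A>\<close>.
  By construction \<open>\<phi>\<close> matches the even generators and complements the set of odd
  variables in each monomial, so it exchanges odd variables and odd derivations up to a
  sign. The exponents \<open>\<kappa>\<close> and \<open>\<chi>\<close> are such that this sign is always \<open>(-1)\<^bsup>mn\<^esup>\<close>
  (\<open>phi_sign_plus_odd\<close>, \<open>phi_op_vars\<close>). Composing \<open>\<phi>\<close> with the \<open>mn\<close>-th power of the parity operator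
  removes the sign and yields a map that strictly intertwines all generators and all weight
  projections (\<open>twisted_phi_gens\<close>, \<open>twisted_phi_weights\<close>); going back to \<open>\<phi>\<close> produces the sign in
  the definition of a homomorphism of parity \<open>mn\<close>.

  The algebras are iterated quotients whose elements are cosets. The relation ``the element
  \<open>x\<close> acts as the operator \<open>f\<close>'' (\<open>operator_rep\<close>) passes to quotients by ideals that act by zero and to
  tensor products of supercommuting actions. It gives well-definedness of the actions on cosets
  and all module axioms at once, and reduces statements about the algebras to statements
  about the operators of their generators.
\<close>

section \<open>The endomorphism ring of a free vector space\<close>

interpretation scl: vector_space "scl :: 'k::field \<Rightarrow> ('b \<Rightarrow>\<^sub>0 'k) \<Rightarrow> _"
  by (rule vector_space_scl)

lemma lin_sum_superset:
  assumes "finite S" "keys x \<subseteq> S"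
  shows "lin f x = (\<Sum>a\<in>S. scl (lookup x a) (f a))"
  unfolding lin_def
  by (rule sum.mono_neutral_left) (use assms in \<open>auto simp: in_keys_iff\<close>)

lemma lin_add: "lin f (x + y) = lin f x + lin f y"
proof -
  let ?S = "keys x \<union> keys y"
  have "keys (x + y) \<subseteq> ?S" by (rule Poly_Mapping.keys_add)
  then show ?thesis
    by (subst (1 2 3) lin_sum_superset[where S = ?S])
      (auto simp: lookup_add scl.scale_left_distrib sum.distrib)
qed

lemma lin_scl: "lin f (scl c x) = scl c (lin f x)"
proof -
  have "keys (scl c x) \<subseteq> keys x" by (auto simp: in_keys_iff lookup_scl)
  then show ?thesis
    by (subst (1 2) lin_sum_superset[where S = "keys x"])
      (auto simp: lookup_scl scl.scale_sum_right)
qed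

lemma lin_zero [simp]: "lin f 0 = 0"
  by (simp add: lin_def)

lemma lin_basvec [simp]: "lin f (basvec b) = f b"
  by (simp add: lin_single)

lemma lin_cong: "(\<And>a. a \<in> keys x \<Longrightarrow> f a = g a) \<Longrightarrow> lin f x = lin g x"
  by (simp add: lin_def)

lemma basvec_expansion: "lin basvec x = x"
  by (rule poly_mapping_eqI)
    (auto simp: lin_def lookup_sum lookup_scl lookup_single when_def in_keys_iff if_distrib cong: if_cong)

lemma keys_scl: "keys (scl c x) \<subseteq> keys x"
  by (auto simp: in_keys_iff lookup_scl)

lemma keys_uminus': "keys (- x :: 'b \<Rightarrow>\<^sub>0 'k::field) = keys x"
  by (auto simp: in_keys_iff)

lemma keys_minus': "keys (x - y :: 'b \<Rightarrow>\<^sub>0 'k::field) \<subseteq> keys x \<union> keys y"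
  by (auto simp: in_keys_iff lookup_minus)

lemma keys_sum': "keys (sum f A) \<subseteq> (\<Union>a\<in>A. keys (f a))"
proof
  fix x assume "x \<in> keys (sum f A)"
  then have "(\<Sum>a\<in>A. lookup (f a) x) \<noteq> 0" by (simp add: in_keys_iff lookup_sum)
  then obtain a where "a \<in> A" "lookup (f a) x \<noteq> 0" by (rule sum.not_neutral_contains_not_neutral)
  then show "x \<in> (\<Union>a\<in>A. keys (f a))" by (auto simp: in_keys_iff)
qed

lemma keys_lin: "keys (lin f x) \<subseteq> (\<Union>a\<in>keys x. keys (f a))"
  unfolding lin_def using keys_sum'[of "\<lambda>a. scl (lookup x a) (f a)" "keys x"] keys_scl by fastforce

text \<open>Operators form a ring under composition, so that relations between them become ring
  identities.\<close>

typedef (overloaded) ('b, 'k::field) endo =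
  "{f :: ('b \<Rightarrow>\<^sub>0 'k) \<Rightarrow> ('b \<Rightarrow>\<^sub>0 'k).
      (\<forall>x y. f (x + y) = f x + f y) \<and> (\<forall>c x. f (scl c x) = scl c (f x))}"
  morphisms app Endo
  by (rule exI[of _ "\<lambda>x. x"]) simp

setup_lifting type_definition_endo

instantiation endo :: (type, field) ring_1
begin

lift_definition zero_endo :: "('a, 'b) endo" is "\<lambda>_. 0" by simp
lift_definition one_endo :: "('a, 'b) endo" is "\<lambda>x. x" by simp
lift_definition plus_endo :: "('a, 'b) endo \<Rightarrow> ('a, 'b) endo \<Rightarrow> ('a, 'b) endo"
  is "\<lambda>f g x. f x + g x" by (simp add: scl.scale_right_distrib algebra_simps)
lift_definition minus_endo :: "('a, 'b) endo \<Rightarrow> ('a, 'b) endo \<Rightarrow> ('a, 'b) endo"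
  is "\<lambda>f g x. f x - g x" by (simp add: scl.scale_right_diff_distrib algebra_simps)
lift_definition uminus_endo :: "('a, 'b) endo \<Rightarrow> ('a, 'b) endo"
  is "\<lambda>f x. - f x" by simp
lift_definition times_endo :: "('a, 'b) endo \<Rightarrow> ('a, 'b) endo \<Rightarrow> ('a, 'b) endo"
  is "\<lambda>f g x. f (g x)" by simp

instance
proof
  fix a b c :: "('a, 'b) endo"
  show "a + b + c = a + (b + c)" by transfer (simp add: add.assoc)
  show "a + b = b + a" by transfer (simp add: add.commute)
  show "0 + a = a" by transfer simp
  show "- a + a = 0" by transfer simp
  show "a - b = a + - b" by transfer simp
  show "a * b * c = a * (b * c)" by transfer simp
  show "(a + b) * c = a * c + b * c" by transfer simp
  show "a * (b + c) = a * b + a * c" by transfer simp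
  show "1 * a = a" by transfer simp
  show "a * 1 = a" by transfer simp
  have "(\<lambda>_. 0) \<noteq> (\<lambda>x :: 'a \<Rightarrow>\<^sub>0 'b. x)"
    by (metis single_zero lookup_single_eq lookup_zero one_neq_zero)
  then show "(0 :: ('a, 'b) endo) \<noteq> 1" by transfer simp
qed

end

lift_definition scalar :: "'k::field \<Rightarrow> ('b, 'k) endo" is "\<lambda>c x. scl c x"
  by (simp add: scl.scale_right_distrib mult.commute)

lift_definition elin :: "('b \<Rightarrow> ('b \<Rightarrow>\<^sub>0 'k::field)) \<Rightarrow> ('b, 'k) endo" is lin
  by (simp add: lin_add lin_scl)

lemma app_zero_endo [simp]: "app 0 x = 0" by transfer simp
lemma app_one [simp]: "app 1 x = x" by transfer simp
lemma app_plus: "app (f + g) x = app f x + app g x" by transfer simp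
lemma app_minus: "app (f - g) x = app f x - app g x" by transfer simp
lemma app_uminus: "app (- f) x = - app f x" by transfer simp
lemma app_times: "app (f * g) x = app f (app g x)" by transfer simp
lemma app_scalar: "app (scalar c) x = scl c x" by transfer simp
lemma app_elin: "app (elin g) = lin g" by transfer simp

lemma app_add: "app f (x + y) = app f x + app f y" by transfer simp
lemma app_scl: "app f (scl c x) = scl c (app f x)" by transfer simp
lemma app_zero [simp]: "app f 0 = 0" using app_scl[of f 0 0] by simp
lemma app_sum: "app f (sum g A) = (\<Sum>a\<in>A. app f (g a))"
  by (induction A rule: infinite_finite_induct) (simp_all add: app_add)
lemma app_sum_endo: "app (sum F A) x = (\<Sum>a\<in>A. app (F a) x)"
  by (induction A rule: infinite_finite_induct) (simp_all add: app_plus)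
lemma app_lin: "app f (lin g x) = lin (\<lambda>a. app f (g a)) x"
  by (simp add: lin_def app_sum app_scl)
lemma app_expand: "app f x = lin (\<lambda>b. app f (basvec b)) x"
  by (metis app_lin basvec_expansion)

lemma app_eqI: "(\<And>x. app f x = app g x) \<Longrightarrow> f = g"
  by (metis app_inject ext)

lemma endo_eqI: "(\<And>b. app f (basvec b) = app g (basvec b)) \<Longrightarrow> f = g"
  by (rule app_eqI) (metis (no_types, lifting) app_expand lin_cong)

lemma scalar_add: "scalar (a + b) = scalar a + scalar b"
  by transfer (auto simp: scl.scale_left_distrib)
lemma scalar_mult: "scalar (a * b) = scalar a * scalar b"
  by transfer auto
lemma scalar_uminus: "scalar (- a) = - scalar a"
  by transfer auto
lemma scalar_zero [simp]: "scalar 0 = 0" by transfer auto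
lemma scalar_one [simp]: "scalar 1 = 1" by transfer auto
lemma scalar_commute: "f * scalar c = scalar c * f" by transfer auto
lemma scalar_left_commute: "f * (scalar c * g) = scalar c * (f * g)"
  by (simp only: mult.assoc[symmetric] scalar_commute[of f])
lemma scalar_of_nat: "scalar (of_nat k) = of_nat k"
  by (induction k) (simp_all add: scalar_add)
lemma scalar_numeral: "scalar (numeral k) = numeral k"
  using scalar_of_nat[of "numeral k"] by simp
lemma scalar_ksign: "scalar (ksign p) = (if p = 0 then 1 else - 1)"
  by (simp add: ksign_def scalar_uminus)

text \<open>The linear extension of a map from basis vectors to operators.\<close>

definition Lin :: "('a \<Rightarrow> ('b, 'k) endo) \<Rightarrow> ('a \<Rightarrow>\<^sub>0 'k::field) \<Rightarrow> ('b, 'k) endo" where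
  "Lin \<alpha> x = (\<Sum>a\<in>keys x. scalar (lookup x a) * \<alpha> a)"

lemma app_Lin: "app (Lin \<alpha> x) v = lin (\<lambda>a. app (\<alpha> a) v) x"
  by (simp add: Lin_def lin_def app_sum_endo app_times app_scalar)

lemma Lin_add: "Lin \<alpha> (x + y) = Lin \<alpha> x + Lin \<alpha> y"
  by (rule app_eqI) (simp add: app_Lin lin_add app_plus)
lemma Lin_scl: "Lin \<alpha> (scl c x) = scalar c * Lin \<alpha> x"
  by (rule app_eqI) (simp add: app_Lin lin_scl app_times app_scalar)
lemma Lin_zero [simp]: "Lin \<alpha> 0 = 0" by (simp add: Lin_def)
lemma Lin_uminus: "Lin \<alpha> (- x) = - Lin \<alpha> x"
  by (metis Lin_add Lin_zero add.right_inverse add_eq_0_iff)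
lemma Lin_minus: "Lin \<alpha> (x - y) = Lin \<alpha> x - Lin \<alpha> y"
  by (metis Lin_add add_diff_cancel diff_add_cancel)
lemma Lin_single: "Lin \<alpha> (Poly_Mapping.single b c) = scalar c * \<alpha> b"
  by (rule app_eqI) (simp add: app_Lin lin_single app_times app_scalar)
lemma Lin_sum: "Lin \<alpha> (sum f A) = (\<Sum>a\<in>A. Lin \<alpha> (f a))"
  by (induction A rule: infinite_finite_induct) (simp_all add: Lin_add)
lemma Lin_cong: "(\<And>a. a \<in> keys x \<Longrightarrow> \<alpha> a = \<beta> a) \<Longrightarrow> Lin \<alpha> x = Lin \<beta> x"
  by (simp add: Lin_def)
lemma Lin_lin: "Lin \<alpha> (lin g x) = Lin (\<lambda>b. Lin \<alpha> (g b)) x"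
  by (simp add: lin_def Lin_sum Lin_scl Lin_def[of _ x])
lemma Lin_mult_left: "f * Lin \<alpha> x = Lin (\<lambda>a. f * \<alpha> a) x"
  by (simp add: Lin_def sum_distrib_left scalar_left_commute)
lemma Lin_mult_right: "Lin \<alpha> x * f = Lin (\<lambda>a. \<alpha> a * f) x"
  by (simp add: Lin_def sum_distrib_right mult.assoc)

text \<open>Compatibility with products only has to be checked on basis vectors.\<close>

lemma Lin_bilin:
  assumes "\<And>a b. a \<in> keys x \<Longrightarrow> b \<in> keys y \<Longrightarrow> Lin \<alpha> (h a b) = \<beta> a * \<gamma> b"
  shows "Lin \<alpha> (bilin h x y) = Lin \<beta> x * Lin \<gamma> y"
proof -
  have "Lin (\<lambda>b. Lin \<alpha> (h a b)) y = \<beta> a * Lin \<gamma> y" if "a \<in> keys x" for a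
    unfolding Lin_mult_left by (rule Lin_cong) (rule assms[OF that])
  then show ?thesis
    unfolding bilin_def Lin_lin Lin_mult_right by (intro Lin_cong)
qed

section \<open>Graded spaces\<close>

text \<open>The projection onto the span of a basis, and the operator that is \<open>(-1)\<^sup>p\<close> on vectors
  of parity \<open>p\<close>. An operator is homogeneous if it commutes with the latter up to sign.\<close>

definition diag :: "('b \<Rightarrow> 'k::field) \<Rightarrow> ('b, 'k) endo" where
  "diag h = elin (\<lambda>b. Poly_Mapping.single b (h b))"

definition restr :: "'b sspace \<Rightarrow> ('b, 'k::field) endo" where
  "restr M = diag (\<lambda>b. if b \<in> basis M then 1 else 0)"

definition grade :: "'b sspace \<Rightarrow> ('b, 'k::field) endo" where
  "grade M = diag (\<lambda>b. ksign (bpar M b))"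

lemma app_diag_single: "app (diag h) (Poly_Mapping.single b c) = Poly_Mapping.single b (h b * c)"
  by (simp add: diag_def app_elin lin_single scl_single mult.commute)

lemma lookup_app_diag: "lookup (app (diag h) x) b = h b * lookup x b"
  by (auto simp: diag_def app_elin lin_def lookup_sum lookup_scl lookup_single when_def
      in_keys_iff if_distrib cong: if_cong)

lemma diag_mult: "diag h * diag h' = diag (\<lambda>b. h b * h' b)"
  by (rule endo_eqI) (simp add: app_times app_diag_single)

lemma diag_commute: "diag h * diag h' = diag h' * diag h"
  by (simp add: diag_mult mult.commute)

lemma ksign_mult_self [simp]: "ksign p * ksign p = (1 :: 'k::field)"
  by (simp add: ksign_def)

lemma ksign_add: "ksign (p + q) = (ksign p * ksign q :: 'k::field)"
  by (cases p; cases q) (simp_all add: ksign_def)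

lemma grade_square: "grade M * grade M = 1"
  by (rule endo_eqI) (simp add: grade_def diag_mult app_diag_single)

text \<open>With this characterization, stability of the module under an operator follows if the operator
  commutes with the projection.\<close>

lemma vecs_iff: "v \<in> vecs M \<longleftrightarrow> app (restr M) v = v"
  unfolding vecs_def restr_def poly_mapping_eq_iff fun_eq_iff lookup_app_diag
  by (auto simp: in_keys_iff)

text \<open>The eigenspaces of the parity operator are the homogeneous parts because \<open>1 \<noteq> -1\<close>.\<close>

lemma hvecs_iff:
  fixes v :: "'b \<Rightarrow>\<^sub>0 'k::field_char_0"
  shows "v \<in> hvecs M p \<longleftrightarrow> v \<in> vecs M \<and> app (grade M) v = scl (ksign p) v"
proof -
  have "app (grade M) v = scl (ksign p) v \<longleftrightarrow> (\<forall>b\<in>keys v. bpar M b = p)"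
  proof -
    have "ksign (bpar M b) * lookup v b = ksign p * lookup v b \<longleftrightarrow> (b \<in> keys v \<longrightarrow> bpar M b = p)"
      for b
      by (cases "bpar M b"; cases p) (auto simp: ksign_def in_keys_iff)
    then show ?thesis
      unfolding grade_def poly_mapping_eq_iff fun_eq_iff lookup_app_diag lookup_scl by blast
  qed
  then show ?thesis by (auto simp: hvecs_def vecs_def)
qed

text \<open>If \<open>\<gamma>\<close> is the parity operator, then \<open>\<gamma> f \<gamma> = (-1)\<^sup>p f\<close> for \<open>f\<close> of parity \<open>p\<close>; averaging projects
  onto the operators of parity \<open>p\<close>.\<close>

definition component :: "'b sspace \<Rightarrow> bit \<Rightarrow> ('b, 'k::field) endo \<Rightarrow> ('b, 'k) endo" where
  "component M p f = scalar (1/2) * (f + scalar (ksign p) * (grade M * f * grade M))"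

lemma component_add: "component M p (f + g) = component M p f + component M p g"
  by (simp add: component_def algebra_simps)
lemma component_scalar: "component M p (scalar c * f) = scalar c * component M p f"
  by (simp only: component_def scalar_left_commute[of _ c] mult.assoc distrib_left)
lemma component_zero [simp]: "component M p 0 = 0"
  by (simp add: component_def)
lemma component_sum: "component M p (sum f A) = (\<Sum>a\<in>A. component M p (f a))"
  by (induction A rule: infinite_finite_induct) (simp_all add: component_add)
lemma component_Lin: "component M p (Lin \<alpha> x) = Lin (\<lambda>a. component M p (\<alpha> a)) x"
  by (simp add: Lin_def component_sum component_scalar)

definition homog :: "'b sspace \<Rightarrow> bit \<Rightarrow> ('b, 'k::field) endo \<Rightarrow> bool" where
  "homog M p f \<longleftrightarrow> grade M * f = scalar (ksign p) * (f * grade M)"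

lemma grade_cancel [simp]: "grade M * (grade M * f) = f"
  by (metis grade_square mult.assoc mult_1)

lemma homog_conj: "homog M p f \<Longrightarrow> grade M * f * grade M = scalar (ksign p) * f"
  by (simp add: homog_def mult.assoc grade_square)

lemma homog_component: "homog M p (component M p f)"
proof -
  have "scalar (ksign p) * scalar (ksign p) = (1 :: ('a, 'b) endo)"
    by (metis scalar_mult ksign_mult_self scalar_one)
  then have *: "scalar (ksign p) * (scalar (ksign p) * g) = g" for g :: "('a, 'b) endo"
    by (metis mult.assoc mult_1)
  have swap: "scalar (ksign p) * (scalar (1/2) * g) = scalar (1/2) * (scalar (ksign p) * g)"
    for g :: "('a, 'b) endo"
    by (rule scalar_left_commute)
  show ?thesis
    unfolding homog_def component_def
    by (simp only: scalar_left_commute[of "grade M"] swap distrib_left distrib_right mult.assoc *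
        grade_cancel grade_square mult_1_right add.commute)
qed

lemma component_homog:
  fixes f :: "('b, 'k::field_char_0) endo"
  assumes "homog M p f"
  shows "component M q f = (if q = p then f else 0)"
proof -
  have "scalar (1/2) * (f + f) = f"
  proof -
    have "scalar (1/2) * (f + f) = scalar (1/2) * (scalar 2 * f)"
      by (simp add: scalar_numeral mult_2)
    also have "\<dots> = f" by (simp add: mult.assoc[symmetric] scalar_mult[symmetric])
    finally show ?thesis .
  qed
  then show ?thesis
    unfolding component_def homog_conj[OF assms]
    by (cases p; cases q) (simp_all add: scalar_ksign)
qed

lemma homog_mult:
  assumes "homog M p f" "homog M q g"
  shows "homog M (p + q) (f * g)"
proof -
  have "grade M * (f * g) = scalar (ksign p) * (f * (grade M * g))"
    using assms(1) by (simp add: homog_def mult.assoc[symmetric])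
  also have "\<dots> = scalar (ksign p) * (scalar (ksign q) * (f * g * grade M))"
    using assms(2) by (simp add: homog_def mult.assoc scalar_left_commute[of f])
  finally show ?thesis
    by (simp only: homog_def ksign_add scalar_mult mult.assoc)
qed

lemma component_sum_parities:
  fixes f :: "('b, 'k::field_char_0) endo"
  shows "component M 0 f + component M 1 f = f"
proof -
  have "component M 0 f + component M 1 f = scalar (1/2) * (scalar 2 * f)"
    by (simp add: component_def scalar_ksign scalar_numeral mult_2 distrib_left right_diff_distrib)
  also have "\<dots> = f" by (simp add: mult.assoc[symmetric] scalar_mult[symmetric])
  finally show ?thesis .
qed

lemma component_mult:
  fixes f g :: "('b, 'k::field_char_0) endo"
  shows "component M r (f * g) = (\<Sum>p\<in>{0, 1}. component M p f * component M (r - p) g)"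
proof -
  have fg: "f * g = component M 0 f * component M 0 g + component M 0 f * component M 1 g
      + (component M 1 f * component M 0 g + component M 1 f * component M 1 g)"
    by (simp only: distrib_left[symmetric] distrib_right[symmetric] component_sum_parities)
  have h: "component M r (component M p f * component M q g) =
      (if r = p + q then component M p f * component M q g else 0)" for p q
    by (rule component_homog) (intro homog_mult homog_component)
  show ?thesis
    by (subst fg, simp only: component_add h, cases r) simp_all
qed

section \<open>Elements acting as operators\<close>

text \<open>Being a relation, \<open>acts\<close> extends to cosets: a coset acts as \<open>f\<close> if all its elements do. The
  operators are defined on the whole ambient space, and a module is the image of the
  projection \<open>restr M\<close>.\<close>

locale operator_rep =
  fixes U :: "('k::field_char_0, 'o, 'x) lusalg" and M :: "'b sspace"
    and acts :: "'x \<Rightarrow> ('b, 'k) endo \<Rightarrow> bool"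
  assumes total: "x \<in> carr U \<Longrightarrow> \<exists>f. acts x f"
    and unique: "acts x f \<Longrightarrow> acts x g \<Longrightarrow> f = g"
    and acts_add: "acts x f \<Longrightarrow> acts y g \<Longrightarrow> acts (add U x y) (f + g)"
    and acts_smul: "acts x f \<Longrightarrow> acts (smul U c x) (scalar c * f)"
    and acts_mult: "acts x f \<Longrightarrow> acts y g \<Longrightarrow> acts (mult U x y) (f * g)"
    and acts_part: "acts x f \<Longrightarrow> acts (part U p x) (component M p f)"
    and acts_restr: "acts x f \<Longrightarrow> restr M * f = f * restr M"
    and acts_idm: "v \<in> vecs M \<Longrightarrow>
      \<exists>S e. finite S \<and> S \<subseteq> objs U \<and> (\<forall>a\<in>S. acts (idm U a) (e a)) \<and> (\<Sum>a\<in>S. app (e a) v) = v"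
begin

lemma app_closed:
  assumes "acts x f" "v \<in> vecs M"
  shows "app f v \<in> vecs M"
  using assms acts_restr[OF assms(1)] by (metis app_times vecs_iff)

lemma hcomp_component:
  assumes "x \<in> hcomp U p" "acts x f"
  shows "component M p f = f"
  using assms acts_part[OF assms(2), of p] unique by (metis (mono_tags, lifting) hcomp_def mem_Collect_eq)

lemma supermodule:
  assumes act: "\<And>x f v. acts x f \<Longrightarrow> v \<in> vecs M \<Longrightarrow> act x v = app f v"
  shows "supermodule U M act"
proof
  fix x y :: 'x and v w :: "'b \<Rightarrow>\<^sub>0 'k" and c :: 'k and p q :: bit
  {
    assume x: "x \<in> carr U" and v: "v \<in> vecs M"
    from total[OF x] obtain f where f: "acts x f" ..
    show "act x v \<in> vecs M" using act[OF f v] app_closed[OF f v] by simp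
    have sv: "scl c v \<in> vecs M" using v by (simp add: vecs_iff app_scl)
    show "act x (scl c v) = scl c (act x v)"
      by (simp only: act[OF f v] act[OF f sv] app_scl)
    show "act (smul U c x) v = scl c (act x v)"
      by (simp only: act[OF f v] act[OF acts_smul[OF f] v] app_times app_scalar)
    {
      assume w: "w \<in> vecs M"
      have vw: "v + w \<in> vecs M" using v w by (simp add: vecs_iff app_add)
      show "act x (v + w) = act x v + act x w"
        by (simp only: act[OF f v] act[OF f w] act[OF f vw] app_add)
    }
    assume y: "y \<in> carr U"
    from total[OF y] obtain g where g: "acts y g" ..
    show "act (add U x y) v = act x v + act y v"
      by (simp only: act[OF f v] act[OF g v] act[OF acts_add[OF f g] v] app_plus)
    show "act (mult U x y) v = act x (act y v)"
      by (simp only: act[OF g v] act[OF f app_closed[OF g v]] act[OF acts_mult[OF f g] v] app_times)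
  }
  {
    assume x: "x \<in> hcomp U p" and v: "v \<in> hvecs M q"
    then obtain f where f: "acts x f" using total by (auto simp: hcomp_def)
    have v': "v \<in> vecs M" "app (grade M) v = scl (ksign q) v" using v by (auto simp: hvecs_iff)
    have "homog M p f" using homog_component hcomp_component[OF x f] by metis
    then have "app (grade M * f) v = app (scalar (ksign p) * (f * grade M)) v"
      by (simp add: homog_def)
    then have "app (grade M) (app f v) = scl (ksign (p + q)) (app f v)"
      unfolding ksign_add by (simp add: app_times app_scalar v'(2) app_scl mult.commute)
    then show "act x v \<in> hvecs M (p + q)"
      using act[OF f v'(1)] app_closed[OF f v'(1)] by (simp add: hvecs_iff)
  }
  {
    assume v: "v \<in> vecs M"
    from acts_idm[OF v] obtain S e where S: "finite S" "S \<subseteq> objs U"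
      "\<forall>a\<in>S. acts (idm U a) (e a)" "(\<Sum>a\<in>S. app (e a) v) = v" by blast
    have "(\<Sum>a\<in>S. act (idm U a) v) = v"
      by (subst S(4)[symmetric], rule sum.cong[OF refl], rule act) (use S v in auto)
    then show "\<exists>S. finite S \<and> S \<subseteq> objs U \<and> (\<Sum>a\<in>S. act (idm U a) v) = v"
      using S by blast
  }
qed

end

text \<open>The set \<open>D\<close> of admitted basis elements can be larger than the basis of the algebra; for tensor
  products it consists of all pairs whose entries act.\<close>

definition based_rel :: "'a set \<Rightarrow> ('a \<Rightarrow> ('b, 'k) endo) \<Rightarrow> ('a \<Rightarrow>\<^sub>0 'k::field) \<Rightarrow> ('b, 'k) endo \<Rightarrow> bool" where
  "based_rel D \<alpha> x f \<longleftrightarrow> keys x \<subseteq> D \<and> f = Lin \<alpha> x"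

lemma operator_rep_based:
  fixes \<alpha> :: "'a \<Rightarrow> ('b, 'k::field_char_0) endo"
  assumes "B \<subseteq> D"
    and mult: "\<And>a b. a \<in> D \<Longrightarrow> b \<in> D \<Longrightarrow> keys (bmult a b) \<subseteq> D \<and> Lin \<alpha> (bmult a b) = \<alpha> a * \<alpha> b"
    and part: "\<And>p a. a \<in> D \<Longrightarrow> keys (bpart p a) \<subseteq> D \<and> Lin \<alpha> (bpart p a) = component M p (\<alpha> a)"
    and restr: "\<And>a. a \<in> D \<Longrightarrow> restr M * \<alpha> a = \<alpha> a * restr M"
    and idm: "\<And>v. v \<in> vecs M \<Longrightarrow>
      \<exists>S. finite S \<and> S \<subseteq> obs \<and> e ` S \<subseteq> D \<and> (\<Sum>a\<in>S. app (\<alpha> (e a)) v) = v"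
  shows "operator_rep (based_alg B bmult bpart obs e) M (based_rel D \<alpha>)"
proof
  fix x y :: "'a \<Rightarrow>\<^sub>0 'k" and f g :: "('b, 'k) endo" and c p and v :: "'b \<Rightarrow>\<^sub>0 'k"
  let ?U = "based_alg B bmult bpart obs e"
  show "x \<in> carr ?U \<Longrightarrow> \<exists>f. based_rel D \<alpha> x f"
    using assms(1) by (auto simp: based_alg_def based_rel_def)
  assume x: "based_rel D \<alpha> x f"
  then have kx: "keys x \<subseteq> D" and f: "f = Lin \<alpha> x" by (auto simp: based_rel_def)
  show "based_rel D \<alpha> x g \<Longrightarrow> f = g" using x by (auto simp: based_rel_def)
  show "based_rel D \<alpha> (smul ?U c x) (scalar c * f)"
    using kx keys_scl[of c x] by (auto simp: based_alg_def based_rel_def f Lin_scl)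
  have "Lin \<alpha> (lin (bpart p) x) = component M p f"
    unfolding f Lin_lin component_Lin by (rule Lin_cong) (use kx part in auto)
  moreover have "keys (lin (bpart p) x) \<subseteq> D"
    using keys_lin[of "bpart p" x] kx part by blast
  ultimately show "based_rel D \<alpha> (part ?U p x) (component M p f)"
    by (auto simp: based_alg_def based_rel_def)
  show "restr M * f = f * restr M"
    unfolding f Lin_mult_left Lin_mult_right by (rule Lin_cong) (use kx restr in auto)
  assume y: "based_rel D \<alpha> y g"
  then have ky: "keys y \<subseteq> D" and g: "g = Lin \<alpha> y" by (auto simp: based_rel_def)
  show "based_rel D \<alpha> (add ?U x y) (f + g)"
    using kx ky Poly_Mapping.keys_add[of x y] by (auto simp: based_alg_def based_rel_def f g Lin_add)
  have "Lin \<alpha> (bilin bmult x y) = f * g"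
    unfolding f g by (rule Lin_bilin) (use kx ky mult in blast)
  moreover have "keys (bilin bmult x y) \<subseteq> D"
    unfolding bilin_def
    using keys_lin[of "\<lambda>a. lin (bmult a) y" x] keys_lin[of "bmult _" y] kx ky mult by blast
  ultimately show "based_rel D \<alpha> (mult ?U x y) (f * g)"
    by (auto simp: based_alg_def based_rel_def)
next
  fix v :: "'b \<Rightarrow>\<^sub>0 'k" assume "v \<in> vecs M"
  from idm[OF this] obtain S where
    "finite S" "S \<subseteq> obs" "e ` S \<subseteq> D" "(\<Sum>a\<in>S. app (\<alpha> (e a)) v) = v" by blast
  then show "\<exists>S e'. finite S \<and> S \<subseteq> objs (based_alg B bmult bpart obs e) \<and>
      (\<forall>a\<in>S. based_rel D \<alpha> (idm (based_alg B bmult bpart obs e) a) (e' a)) \<and>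
      (\<Sum>a\<in>S. app (e' a) v) = v"
    by (intro exI[of _ S] exI[of _ "\<lambda>a. \<alpha> (e a)"])
      (auto simp: based_alg_def based_rel_def Lin_single)
qed

definition quot_rel :: "('x \<Rightarrow> ('b, 'k::field) endo \<Rightarrow> bool) \<Rightarrow> 'x set \<Rightarrow> ('b, 'k) endo \<Rightarrow> bool" where
  "quot_rel acts X f \<longleftrightarrow> X \<noteq> {} \<and> (\<forall>x\<in>X. acts x f)"

text \<open>The operations of the quotient are unions over representatives. All representatives of a coset
  act alike, hence so do all elements of such a union.\<close>

lemma operator_rep_quot:
  fixes R :: "('k::field_char_0, 'o, 'x::plus) lusalg" and M :: "'b sspace"
  assumes "operator_rep R M acts"
    and "add R = (+)" and "I \<noteq> {}" and I: "\<And>i. i \<in> I \<Longrightarrow> acts i 0"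
  shows "operator_rep (quot R I) M (quot_rel acts)"
proof -
  interpret operator_rep R M acts by fact
  have coset: "acts y f" if "acts x f" "y \<in> x +o I" for x y f
    using acts_add[OF that(1) I] that(2) by (auto simp: elt_set_plus_def assms(2))
  have ne: "x +o I \<noteq> {}" for x using assms(3) by (auto simp: elt_set_plus_def)
  have unary: "quot_rel acts (\<Union>x\<in>X. h x +o I) f'"
    if "quot_rel acts X f" "\<And>x. acts x f \<Longrightarrow> acts (h x) f'" for X f f' h
    unfolding quot_rel_def
  proof (intro conjI ballI)
    show "(\<Union>x\<in>X. h x +o I) \<noteq> {}" using that(1) ne by (auto simp: quot_rel_def)
    fix y assume "y \<in> (\<Union>x\<in>X. h x +o I)"
    then obtain x where x: "x \<in> X" "y \<in> h x +o I" by blast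
    then have "acts x f" using that(1) by (simp add: quot_rel_def)
    from coset[OF that(2)[OF this] x(2)] show "acts y f'" .
  qed
  have binary: "quot_rel acts (\<Union>x\<in>X. \<Union>y\<in>Y. h x y +o I) f'"
    if "quot_rel acts X f" "quot_rel acts Y g" "\<And>x y. acts x f \<Longrightarrow> acts y g \<Longrightarrow> acts (h x y) f'"
    for X Y f g f' h
    unfolding quot_rel_def
  proof (intro conjI ballI)
    show "(\<Union>x\<in>X. \<Union>y\<in>Y. h x y +o I) \<noteq> {}" using that(1,2) ne by (auto simp: quot_rel_def)
    fix z assume "z \<in> (\<Union>x\<in>X. \<Union>y\<in>Y. h x y +o I)"
    then obtain x y where x: "x \<in> X" "y \<in> Y" "z \<in> h x y +o I" by blast
    then have "acts x f" "acts y g" using that(1,2) by (simp_all add: quot_rel_def)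
    from coset[OF that(3)[OF this] x(3)] show "acts z f'" .
  qed
  show ?thesis
  proof
    fix X f assume X: "quot_rel acts X f"
    then obtain x where x: "x \<in> X" "acts x f" by (auto simp: quot_rel_def)
    show "quot_rel acts X g \<Longrightarrow> f = g" for g using x unique by (auto simp: quot_rel_def)
    show "restr M * f = f * restr M" using acts_restr x by blast
    show "quot_rel acts (smul (quot R I) c X) (scalar c * f)" for c
      unfolding quot_def by simp (rule unary[OF X acts_smul])
    show "quot_rel acts (part (quot R I) p X) (component M p f)" for p
      unfolding quot_def by simp (rule unary[OF X acts_part])
    fix Y g assume Y: "quot_rel acts Y g"
    show "quot_rel acts (add (quot R I) X Y) (f + g)"
      unfolding quot_def by simp (rule binary[OF X Y acts_add])
    show "quot_rel acts (mult (quot R I) X Y) (f * g)"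
      unfolding quot_def by simp (rule binary[OF X Y acts_mult])
  next
    fix X assume "X \<in> carr (quot R I)"
    then obtain x where "X = x +o I" "x \<in> carr R" by (auto simp: quot_def)
    then show "\<exists>f. quot_rel acts X f" using total coset ne by (metis quot_rel_def)
  next
    fix v :: "'b \<Rightarrow>\<^sub>0 'k" assume "v \<in> vecs M"
    from acts_idm[OF this] obtain S e where "finite S" "S \<subseteq> objs R"
      "\<forall>a\<in>S. acts (idm R a) (e a)" "(\<Sum>a\<in>S. app (e a) v) = v" by blast
    then show "\<exists>S e. finite S \<and> S \<subseteq> objs (quot R I) \<and>
        (\<forall>a\<in>S. quot_rel acts (idm (quot R I) a) (e a)) \<and> (\<Sum>a\<in>S. app (e a) v) = v"
      using coset ne by (intro exI[of _ S] exI[of _ e]) (auto simp: quot_rel_def quot_def)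
  qed
qed

lemma quot_act_eq:
  assumes "quot_rel acts X f" "\<And>x. x \<in> X \<Longrightarrow> acts x f \<Longrightarrow> a x v = app f v"
  shows "quot_act a X v = app f v"
proof -
  have "(\<lambda>x. a x v) ` X = {app f v}" using assms by (auto simp: quot_rel_def)
  then show ?thesis by (simp add: quot_act_def)
qed

lemma span_acts_zero:
  fixes \<alpha> :: "'a \<Rightarrow> ('b, 'k::field) endo"
  assumes "\<And>x. x \<in> S \<Longrightarrow> keys x \<subseteq> D \<and> Lin \<alpha> x = 0" "x \<in> span S"
  shows "based_rel D \<alpha> x 0"
proof -
  have "scl.subspace {x. keys x \<subseteq> D \<and> Lin \<alpha> x = 0}"
  proof (rule scl.subspaceI)
    fix x y assume "x \<in> {x. keys x \<subseteq> D \<and> Lin \<alpha> x = 0}" "y \<in> {x. keys x \<subseteq> D \<and> Lin \<alpha> x = 0}"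
    then show "x + y \<in> {x. keys x \<subseteq> D \<and> Lin \<alpha> x = 0}"
      using Poly_Mapping.keys_add[of x y] by (auto simp: Lin_add)
  next
    fix c x assume "x \<in> {x. keys x \<subseteq> D \<and> Lin \<alpha> x = 0}"
    then show "scl c x \<in> {x. keys x \<subseteq> D \<and> Lin \<alpha> x = 0}"
      using keys_scl[of c x] by (auto simp: Lin_scl)
  qed simp
  moreover have "S \<subseteq> {x. keys x \<subseteq> D \<and> Lin \<alpha> x = 0}" using assms(1) by auto
  ultimately show ?thesis
    using scl.span_minimal[of S "{x. keys x \<subseteq> D \<and> Lin \<alpha> x = 0}"] assms(2)
    unfolding span_def based_rel_def by auto
qed

section \<open>Tensor products of representations\<close>

text \<open>The sign rule, for operators that need not be homogeneous.\<close>

definition supercommute :: "'b sspace \<Rightarrow> ('b, 'k::field) endo \<Rightarrow> ('b, 'k) endo \<Rightarrow> bool" where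
  "supercommute M f g \<longleftrightarrow> (\<forall>p q. component M p f * component M q g =
     scalar (ksign (p * q)) * (component M q g * component M p f))"

definition the_op :: "('x \<Rightarrow> ('b, 'k::field) endo \<Rightarrow> bool) \<Rightarrow> 'x \<Rightarrow> ('b, 'k) endo" where
  "the_op acts x = (THE f. acts x f)"

definition tensor_rel where
  "tensor_rel acts acts' = quot_rel (based_rel ({x. \<exists>f. acts x f} \<times> {y. \<exists>g. acts' y g})
     (\<lambda>(x, y). the_op acts x * the_op acts' y))"

lemma (in operator_rep) the_op: "acts x f \<Longrightarrow> the_op acts x = f"
  unfolding the_op_def using unique by blast

text \<open>A pair \<open>(x, y)\<close> acts as the product of the operators of \<open>x\<close> and \<open>y\<close>. Moving the operator of \<open>y\<close>
  past that of \<open>x'\<close> produces the sign in the product of pairs, and bilinearity of the product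
  kills the relations of the tensor product.\<close>

lemma operator_rep_tensor:
  fixes U :: "('k::field_char_0, 'o, 'x) lusalg" and U' :: "('k, 'q, 'y) lusalg" and M :: "'b sspace"
  assumes "operator_rep U M acts" and "operator_rep U' M acts'"
    and sc: "\<And>x f y g. acts x f \<Longrightarrow> acts' y g \<Longrightarrow> supercommute M f g"
  shows "operator_rep (tensor_alg U U') M (tensor_rel acts acts')"
proof -
  interpret A: operator_rep U M acts by fact
  interpret B: operator_rep U' M acts' by fact
  define D where "D = {x. \<exists>f. acts x f} \<times> {y. \<exists>g. acts' y g}"
  define \<alpha> where "\<alpha> = (\<lambda>(x, y). the_op acts x * the_op acts' y)"
  have D_I: "(x, y) \<in> D" if "acts x f" "acts' y g" for x y f g using that by (auto simp: D_def)
  have \<alpha>: "\<alpha> (x, y) = f * g" if "acts x f" "acts' y g" for x y f g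
    using that by (simp add: \<alpha>_def A.the_op B.the_op)
  define bm where "bm = (\<lambda>(x, y) (x', y'). \<Sum>p\<in>{0, 1}. \<Sum>q\<in>{0, 1}. Poly_Mapping.single
      (mult U x (part U q x'), mult U' (part U' p y) y') (ksign (p * q) :: 'k))"
  define bp where "bp = (\<lambda>r (x, y). \<Sum>p\<in>{0, 1}. basvec (part U p x, part U' (r - p) y) :: _ \<Rightarrow>\<^sub>0 'k)"
  have "operator_rep (pairs_alg U U') M (based_rel D \<alpha>)"
    unfolding pairs_alg_def bm_def[symmetric] bp_def[symmetric]
  proof (rule operator_rep_based)
    show "carr U \<times> carr U' \<subseteq> D" using A.total B.total by (auto simp: D_def)
  next
    fix a b assume "a \<in> D" "b \<in> D"
    then obtain x y x' y' f g f' g' where ab: "a = (x, y)" "b = (x', y')"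
      and f: "acts x f" and g: "acts' y g" and f': "acts x' f'" and g': "acts' y' g'"
      by (auto simp: D_def)
    have xx: "acts (mult U x (part U q x')) (f * component M q f')" for q
      by (intro A.acts_mult A.acts_part f f')
    have yy: "acts' (mult U' (part U' p y) y') (component M p g * g')" for p
      by (intro B.acts_mult B.acts_part g g')
    have c: "component M p f' * component M q g =
        scalar (ksign (p * q)) * (component M q g * component M p f')" for p q
      using sc[OF f' g] by (simp add: supercommute_def)
    let ?m = "\<Sum>p\<in>{0, 1}. \<Sum>q\<in>{0, 1}. Poly_Mapping.single
        (mult U x (part U q x'), mult U' (part U' p y) y') (ksign (p * q) :: 'k)"
    have "keys ?m \<subseteq> D"
      by (rule order_trans[OF keys_sum'] UN_least)+ (use D_I[OF xx yy] in auto)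
    moreover have "Lin \<alpha> ?m = \<alpha> a * \<alpha> b"
    proof -
      have "Lin \<alpha> ?m = (\<Sum>p\<in>{0, 1}. \<Sum>q\<in>{0, 1}.
          f * (scalar (ksign (q * p)) * (component M q f' * component M p g)) * g')"
        unfolding Lin_sum Lin_single \<alpha>[OF xx yy]
        by (intro sum.cong refl) (simp only: scalar_left_commute[of f] mult.assoc mult.commute[of "_::bit"])
      also have "\<dots> = (\<Sum>p\<in>{0, 1}. \<Sum>q\<in>{0, 1}. f * (component M p g * component M q f') * g')"
      proof (intro sum.cong refl)
        fix p q :: bit
        have "scalar (ksign (q * p)) * (component M q f' * component M p g) =
            scalar (ksign (q * p) * ksign (q * p)) * (component M p g * component M q f')"
          by (subst c) (simp only: scalar_mult mult.assoc)
        then show "f * (scalar (ksign (q * p)) * (component M q f' * component M p g)) * g' =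
            f * (component M p g * component M q f') * g'" by simp
      qed
      also have "\<dots> = f * ((component M 0 g + component M 1 g) *
          (component M 0 f' + component M 1 f')) * g'"
        by (simp add: distrib_left distrib_right add.assoc mult.assoc)
      also have "\<dots> = \<alpha> a * \<alpha> b"
        by (simp add: component_sum_parities ab \<alpha>[OF f g] \<alpha>[OF f' g'] mult.assoc)
      finally show ?thesis .
    qed
    ultimately show "keys (bm a b) \<subseteq> D \<and> Lin \<alpha> (bm a b) = \<alpha> a * \<alpha> b"
      unfolding ab bm_def prod.case by blast
  next
    fix r a assume "a \<in> D"
    then obtain x y f g where a: "a = (x, y)" and f: "acts x f" and g: "acts' y g"
      by (auto simp: D_def)
    have fg: "\<alpha> (part U p x, part U' (r - p) y) = component M p f * component M (r - p) g" for p
      by (intro \<alpha> A.acts_part B.acts_part f g)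
    let ?m = "\<Sum>p\<in>{0, 1}. basvec (part U p x, part U' (r - p) y) :: _ \<Rightarrow>\<^sub>0 'k"
    have "keys ?m \<subseteq> D"
      by (rule order_trans[OF keys_sum'] UN_least)+
        (use D_I[OF A.acts_part[OF f] B.acts_part[OF g]] in auto)
    moreover have "Lin \<alpha> ?m = component M r (\<alpha> a)"
      unfolding Lin_sum Lin_single fg a \<alpha>[OF f g] component_mult by simp
    ultimately show "keys (bp r a) \<subseteq> D \<and> Lin \<alpha> (bp r a) = component M r (\<alpha> a)"
      unfolding a bp_def prod.case by blast
  next
    fix a assume "a \<in> D"
    then obtain x y f g where a: "a = (x, y)" and f: "acts x f" and g: "acts' y g"
      by (auto simp: D_def)
    show "restr M * \<alpha> a = \<alpha> a * restr M"
      unfolding a \<alpha>[OF f g] by (metis A.acts_restr[OF f] B.acts_restr[OF g] mult.assoc)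
  next
    fix v :: "'b \<Rightarrow>\<^sub>0 'k" assume v: "v \<in> vecs M"
    from A.acts_idm[OF v] obtain S e where S: "finite S" "S \<subseteq> objs U"
      "\<forall>a\<in>S. acts (idm U a) (e a)" "(\<Sum>a\<in>S. app (e a) v) = v" by blast
    from B.acts_idm[OF v] obtain S' e' where S': "finite S'" "S' \<subseteq> objs U'"
      "\<forall>a\<in>S'. acts' (idm U' a) (e' a)" "(\<Sum>a\<in>S'. app (e' a) v) = v" by blast
    have "(\<Sum>ab\<in>S \<times> S'. app (\<alpha> (case ab of (a, b) \<Rightarrow> (idm U a, idm U' b))) v) =
        (\<Sum>(a, b)\<in>S \<times> S'. app (e a) (app (e' b) v))"
    proof (intro sum.cong refl, clarify)
      fix a b assume "a \<in> S" "b \<in> S'"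
      then have "\<alpha> (idm U a, idm U' b) = e a * e' b" using S(3) S'(3) by (intro \<alpha>) auto
      then show "app (\<alpha> (idm U a, idm U' b)) v = app (e a) (app (e' b) v)"
        by (simp add: app_times)
    qed
    also have "\<dots> = v"
      by (simp add: sum.cartesian_product[symmetric] app_sum[symmetric] S S')
    finally have "(\<Sum>ab\<in>S \<times> S'. app (\<alpha> (case ab of (a, b) \<Rightarrow> (idm U a, idm U' b))) v) = v" .
    moreover have "(\<lambda>(a, b). (idm U a, idm U' b)) ` (S \<times> S') \<subseteq> D"
      using S(3) S'(3) by (auto intro!: D_I)
    ultimately show "\<exists>S. finite S \<and> S \<subseteq> objs U \<times> objs U' \<and> (\<lambda>(a, b). (idm U a, idm U' b)) ` S \<subseteq> D \<and>
        (\<Sum>a\<in>S. app (\<alpha> (case a of (a, b) \<Rightarrow> (idm U a, idm U' b))) v) = v"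
      using S S' by (intro exI[of _ "S \<times> S'"]) auto
  qed
  then show ?thesis
    unfolding tensor_alg_def tensor_rel_def D_def[symmetric] \<alpha>_def[symmetric]
  proof (rule operator_rep_quot)
    show "add (pairs_alg U U') = (+)" by (simp add: pairs_alg_def based_alg_def)
    show "bilinear_rels U U' \<noteq> {}"
      unfolding bilinear_rels_def span_def using scl.span_zero by blast
    fix i assume "i \<in> bilinear_rels U U'"
    then show "based_rel D \<alpha> i 0"
      unfolding bilinear_rels_def
    proof (rule span_acts_zero[rotated])
      have k2: "keys (a - b) \<subseteq> D" if "keys a \<subseteq> D" "keys b \<subseteq> D" for a b :: "'x \<times> 'y \<Rightarrow>\<^sub>0 'k"
        using keys_minus'[of a b] that by blast
      have k1: "keys (basvec a :: _ \<Rightarrow>\<^sub>0 'k) \<subseteq> D" if "a \<in> D" for a using that by simp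
      have ks: "keys (scl c (basvec a) :: _ \<Rightarrow>\<^sub>0 'k) \<subseteq> D" if "a \<in> D" for a c
        using that keys_scl[of c "basvec a"] by auto
      fix r assume "r \<in> {basvec (add U x x', y) - basvec (x, y) - basvec (x', y)
            |x x' y. x \<in> carr U \<and> x' \<in> carr U \<and> y \<in> carr U'} \<union>
         {basvec (x, add U' y y') - basvec (x, y) - basvec (x, y')
            |x y y'. x \<in> carr U \<and> y \<in> carr U' \<and> y' \<in> carr U'} \<union>
         {basvec (smul U c x, y) - scl c (basvec (x, y)) |c x y. x \<in> carr U \<and> y \<in> carr U'} \<union>
         {basvec (x, smul U' c y) - scl c (basvec (x, y)) |c x y. x \<in> carr U \<and> y \<in> carr U'}"
      then consider
          (1) x x' y where "r = basvec (add U x x', y) - basvec (x, y) - basvec (x', y)"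
            "x \<in> carr U" "x' \<in> carr U" "y \<in> carr U'"
        | (2) x y y' where "r = basvec (x, add U' y y') - basvec (x, y) - basvec (x, y')"
            "x \<in> carr U" "y \<in> carr U'" "y' \<in> carr U'"
        | (3) c x y where "r = basvec (smul U c x, y) - scl c (basvec (x, y))" "x \<in> carr U" "y \<in> carr U'"
        | (4) c x y where "r = basvec (x, smul U' c y) - scl c (basvec (x, y))" "x \<in> carr U" "y \<in> carr U'"
        by blast
      then show "keys r \<subseteq> D \<and> Lin \<alpha> r = 0"
      proof cases
        case 1
        then obtain f f' g where ops: "acts x f" "acts x' f'" "acts' y g"
          using A.total B.total by metis
        note ops' = A.acts_add[OF ops(1,2)]
        show ?thesis unfolding 1
          by (simp only: Lin_minus Lin_single scalar_one mult_1 \<alpha>[OF ops' ops(3)] \<alpha>[OF ops(1,3)]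
              \<alpha>[OF ops(2,3)]) (intro conjI k2 k1 D_I[OF ops' ops(3)] D_I[OF ops(1,3)] D_I[OF ops(2,3)],
              simp add: algebra_simps)
      next
        case 2
        then obtain f g g' where ops: "acts x f" "acts' y g" "acts' y' g'"
          using A.total B.total by metis
        note ops' = B.acts_add[OF ops(2,3)]
        show ?thesis unfolding 2
          by (simp only: Lin_minus Lin_single scalar_one mult_1 \<alpha>[OF ops(1) ops'] \<alpha>[OF ops(1,2)]
              \<alpha>[OF ops(1,3)]) (intro conjI k2 k1 D_I[OF ops(1) ops'] D_I[OF ops(1,2)] D_I[OF ops(1,3)],
              simp add: algebra_simps)
      next
        case 3
        then obtain f g where ops: "acts x f" "acts' y g"
          using A.total B.total by metis
        note ops' = A.acts_smul[OF ops(1), of c]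
        show ?thesis unfolding 3
          by (simp only: Lin_minus Lin_scl Lin_single scalar_one mult_1 \<alpha>[OF ops' ops(2)] \<alpha>[OF ops])
            (intro conjI k2 k1 ks D_I[OF ops' ops(2)] D_I[OF ops], simp add: mult.assoc)
      next
        case 4
        then obtain f g where ops: "acts x f" "acts' y g"
          using A.total B.total by metis
        note ops' = B.acts_smul[OF ops(2), of c]
        show ?thesis unfolding 4
          by (simp only: Lin_minus Lin_scl Lin_single scalar_one mult_1 \<alpha>[OF ops(1) ops'] \<alpha>[OF ops])
            (intro conjI k2 k1 ks D_I[OF ops(1) ops'] D_I[OF ops], simp add: scalar_left_commute)
      qed
    qed
  qed
qed

lemma tensor_act_eq:
  assumes "operator_rep U M acts" and "operator_rep U' M acts'"
    and "\<And>x f v. acts x f \<Longrightarrow> v \<in> vecs M \<Longrightarrow> a x v = app f v"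
    and "\<And>y g v. acts' y g \<Longrightarrow> v \<in> vecs M \<Longrightarrow> a' y v = app g v"
    and "tensor_rel acts acts' X h" and "v \<in> vecs M"
  shows "tensor_act a a' X v = app h v"
  unfolding tensor_act_def
proof (rule quot_act_eq[OF assms(5)[unfolded tensor_rel_def]])
  interpret A: operator_rep U M acts by fact
  interpret B: operator_rep U' M acts' by fact
  fix z assume "based_rel ({x. \<exists>f. acts x f} \<times> {y. \<exists>g. acts' y g})
     (\<lambda>(x, y). the_op acts x * the_op acts' y) z h"
  then have k: "keys z \<subseteq> {x. \<exists>f. acts x f} \<times> {y. \<exists>g. acts' y g}"
    and h: "h = Lin (\<lambda>(x, y). the_op acts x * the_op acts' y) z" by (auto simp: based_rel_def)
  have "a x (a' y v) = app (the_op acts x * the_op acts' y) v" if "(x, y) \<in> keys z" for x y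
  proof -
    obtain f g where fg: "acts x f" "acts' y g" using k \<open>(x, y) \<in> keys z\<close> by auto
    show ?thesis
      using assms(3)[OF fg(1) B.app_closed[OF fg(2) assms(6)]] assms(4)[OF fg(2) assms(6)]
      by (simp add: A.the_op[OF fg(1)] B.the_op[OF fg(2)] app_times)
  qed
  then show "lin (\<lambda>(x, y). a x (a' y v)) z = app h v"
    unfolding h app_Lin by (intro lin_cong) auto
qed

definition intertwines :: "('b, 'k::field) endo \<Rightarrow> ('x \<Rightarrow> ('b, 'k) endo \<Rightarrow> bool) \<Rightarrow>
    ('x \<Rightarrow> ('b, 'k) endo \<Rightarrow> bool) \<Rightarrow> bool" where
  "intertwines T acts acts' \<longleftrightarrow> (\<forall>x f g. acts x f \<longrightarrow> acts' x g \<longrightarrow> T * f = g * T)"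

lemma intertwines_quot:
  assumes "intertwines T acts acts'"
  shows "intertwines T (quot_rel acts) (quot_rel acts')"
  using assms unfolding intertwines_def quot_rel_def by blast

lemma intertwines_based:
  fixes \<alpha> \<beta> :: "'a \<Rightarrow> ('b, 'k::field) endo"
  assumes "\<And>a. a \<in> D \<Longrightarrow> a \<in> D' \<Longrightarrow> T * \<alpha> a = \<beta> a * T"
  shows "intertwines T (based_rel D \<alpha>) (based_rel D' \<beta>)"
  unfolding intertwines_def based_rel_def
proof (intro allI impI, elim conjE, hypsubst)
  fix x :: "'a \<Rightarrow>\<^sub>0 'k" assume "keys x \<subseteq> D" "keys x \<subseteq> D'"
  then show "T * Lin \<alpha> x = Lin \<beta> x * T"
    unfolding Lin_mult_left Lin_mult_right by (intro Lin_cong) (use assms in auto)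
qed

lemma intertwines_tensor:
  assumes "operator_rep U M acts1" "operator_rep U' M acts1'" "operator_rep U N acts2" "operator_rep U' N acts2'"
    and "intertwines T acts1 acts2" "intertwines T acts1' acts2'"
  shows "intertwines T (tensor_rel acts1 acts1') (tensor_rel acts2 acts2')"
  unfolding tensor_rel_def
proof (intro intertwines_quot intertwines_based)
  interpret A1: operator_rep U M acts1 by fact
  interpret B1: operator_rep U' M acts1' by fact
  interpret A2: operator_rep U N acts2 by fact
  interpret B2: operator_rep U' N acts2' by fact
  fix a assume "a \<in> {x. \<exists>f. acts1 x f} \<times> {y. \<exists>g. acts1' y g}" "a \<in> {x. \<exists>f. acts2 x f} \<times> {y. \<exists>g. acts2' y g}"
  then obtain x y f1 g1 f2 g2 where a: "a = (x, y)" "acts1 x f1" "acts1' y g1" "acts2 x f2" "acts2' y g2"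
    by auto
  have "T * f1 = f2 * T" "T * g1 = g2 * T"
    using a assms(5,6) by (auto simp: intertwines_def)
  then have "T * (f1 * g1) = f2 * g2 * T" by (metis mult.assoc)
  then show "T * (case a of (x, y) \<Rightarrow> the_op acts1 x * the_op acts1' y) =
      (case a of (x, y) \<Rightarrow> the_op acts2 x * the_op acts2' y) * T"
    using a by (simp add: A1.the_op B1.the_op A2.the_op B2.the_op)
qed

section \<open>Representations of presented supercategories\<close>

definition path_op :: "(weight \<Rightarrow> ('b, 'k) endo) \<Rightarrow> ('g \<Rightarrow> ('b, 'k::field) endo) \<Rightarrow> 'g path \<Rightarrow> ('b, 'k) endo" where
  "path_op P Q = (\<lambda>(w, \<mu>). prod_list (map Q w) * P \<mu>)"

definition presented_rel where
  "presented_rel X G P Q = quot_rel (based_rel (lists G \<times> X) (path_op P Q))"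

text \<open>The relations at the object \<open>\<mu>\<close> only have to hold on the image of \<open>P \<mu>\<close>. As generators shift
  weights, the projections inside a path can all be moved to its source.\<close>

locale presented_rep =
  fixes X :: "weight set" and G :: "'g set" and wt :: "'g \<Rightarrow> weight" and par :: "'g \<Rightarrow> bit"
    and R :: "weight \<Rightarrow> ('g list \<Rightarrow>\<^sub>0 'k::field_char_0) set"
    and M :: "'b sspace" and P :: "weight \<Rightarrow> ('b, 'k) endo" and Q :: "'g \<Rightarrow> ('b, 'k) endo"
  assumes Q_restr: "g \<in> G \<Longrightarrow> restr M * Q g = Q g * restr M"
    and Q_homog: "g \<in> G \<Longrightarrow> homog M (par g) (Q g)"
    and P_restr: "restr M * P \<mu> = P \<mu> * restr M"
    and P_homog: "homog M 0 (P \<mu>)"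
    and P_mult: "P \<mu> * P \<nu> = (if \<mu> = \<nu> then P \<mu> else 0)"
    and Q_P: "g \<in> G \<Longrightarrow> Q g * P \<mu> = P (\<mu> + wt g) * Q g"
    and P_sum: "v \<in> vecs M \<Longrightarrow> \<exists>S. finite S \<and> S \<subseteq> X \<and> (\<Sum>\<mu>\<in>S. app (P \<mu>) v) = v"
    and R_words: "\<mu> \<in> X \<Longrightarrow> r \<in> R \<mu> \<Longrightarrow> keys r \<subseteq> lists G"
    and R_zero: "\<mu> \<in> X \<Longrightarrow> r \<in> R \<mu> \<Longrightarrow> Lin (\<lambda>w. prod_list (map Q w)) r * P \<mu> = 0"
begin

lemma word_restr: "w \<in> lists G \<Longrightarrow> restr M * prod_list (map Q w) = prod_list (map Q w) * restr M"
proof (induction w rule: lists.induct)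
  case (Cons g w)
  have "restr M * prod_list (map Q (g # w)) = Q g * (restr M * prod_list (map Q w))"
    by (simp add: Q_restr[OF Cons(1)] mult.assoc[symmetric])
  then show ?case by (simp add: Cons(3) mult.assoc)
qed simp

lemma homog_one: "homog M 0 1"
  by (simp add: homog_def ksign_def)

lemma word_homog: "w \<in> lists G \<Longrightarrow> homog M (sum_list (map par w)) (prod_list (map Q w))"
proof (induction w rule: lists.induct)
  case Nil
  show ?case using homog_one by simp
next
  case (Cons g w)
  from homog_mult[OF Q_homog[OF Cons(1)] Cons(3)] show ?case
    unfolding list.map sum_list.Cons prod_list.Cons .
qed

lemma word_P: "w \<in> lists G \<Longrightarrow>
    prod_list (map Q w) * P \<mu> = P (\<mu> + sum_list (map wt w)) * prod_list (map Q w)"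
proof (induction w arbitrary: \<mu> rule: lists.induct)
  case (Cons g w)
  have "prod_list (map Q (g # w)) * P \<mu> = Q g * P (\<mu> + sum_list (map wt w)) * prod_list (map Q w)"
    by (simp add: mult.assoc Cons(3))
  also have "\<dots> = P (\<mu> + sum_list (map wt w) + wt g) * (Q g * prod_list (map Q w))"
    by (simp add: Q_P[OF Cons(1)] mult.assoc)
  finally show ?case by (simp add: add.commute add.left_commute)
qed simp

lemma path_op_restr: "w \<in> lists G \<Longrightarrow> restr M * path_op P Q (w, \<mu>) = path_op P Q (w, \<mu>) * restr M"
proof -
  assume w: "w \<in> lists G"
  have "restr M * path_op P Q (w, \<mu>) = prod_list (map Q w) * (restr M * P \<mu>)"
    by (simp add: path_op_def word_restr[OF w] mult.assoc[symmetric])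
  then show ?thesis by (simp add: path_op_def P_restr mult.assoc)
qed

lemma path_op_homog: "w \<in> lists G \<Longrightarrow> homog M (sum_list (map par w)) (path_op P Q (w, \<mu>))"
  using homog_mult[OF word_homog P_homog, of w \<mu>] by (simp only: path_op_def prod.case add_0_right)

lemma path_op_mult:
  assumes "w' \<in> lists G"
  shows "path_op P Q (w, \<nu>) * path_op P Q (w', \<mu>) =
    (if \<nu> = \<mu> + sum_list (map wt w') then path_op P Q (w @ w', \<mu>) else 0)"
proof -
  have "path_op P Q (w, \<nu>) * path_op P Q (w', \<mu>) =
      prod_list (map Q w) * (P \<nu> * P (\<mu> + sum_list (map wt w')) * prod_list (map Q w'))"
    unfolding path_op_def prod.case by (simp only: mult.assoc word_P[OF assms])
  also have "\<dots> = (if \<nu> = \<mu> + sum_list (map wt w') then path_op P Q (w @ w', \<mu>) else 0)"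
    by (simp add: P_mult path_op_def word_P[OF assms, symmetric] mult.assoc)
  finally show ?thesis .
qed

lemma path_alg_rep: "operator_rep (path_alg X G wt par) M (based_rel (lists G \<times> X) (path_op P Q))"
proof -
  define bm where "bm = (\<lambda>(w, \<nu>) (w', \<mu>). if \<nu> = \<mu> + sum_list (map wt w')
      then basvec (w @ w', \<mu>) else (0 :: 'g path \<Rightarrow>\<^sub>0 'k))"
  define bp where "bp = (\<lambda>p (w, \<mu> :: weight). if sum_list (map par w) = p
      then basvec (w, \<mu>) else (0 :: 'g path \<Rightarrow>\<^sub>0 'k))"
  show ?thesis
  unfolding path_alg_def bm_def[symmetric] bp_def[symmetric]
proof (rule operator_rep_based)
  fix a b assume "a \<in> lists G \<times> X" "b \<in> lists G \<times> X"
  then obtain w \<nu> w' \<mu> where ab: "a = (w, \<nu>)" "b = (w', \<mu>)" "w \<in> lists G" "w' \<in> lists G" "\<mu> \<in> X"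
    by auto
  show "keys (bm a b) \<subseteq> lists G \<times> X \<and> Lin (path_op P Q) (bm a b) = path_op P Q a * path_op P Q b"
    unfolding ab(1,2) bm_def prod.case path_op_mult[OF ab(4)] using ab by (auto simp: Lin_single)
next
  fix p a assume "a \<in> lists G \<times> X"
  then obtain w \<mu> where a: "a = (w, \<mu>)" "w \<in> lists G" "\<mu> \<in> X" by auto
  show "keys (bp p a) \<subseteq> lists G \<times> X \<and> Lin (path_op P Q) (bp p a) = component M p (path_op P Q a)"
    unfolding a(1) bp_def prod.case component_homog[OF path_op_homog[OF a(2)]]
    using a by (auto simp: Lin_single)
next
  fix a assume "a \<in> lists G \<times> X"
  then show "restr M * path_op P Q a = path_op P Q a * restr M"
    using path_op_restr by auto
next
  fix v :: "'b \<Rightarrow>\<^sub>0 'k" assume "v \<in> vecs M"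
  from P_sum[OF this] show "\<exists>S. finite S \<and> S \<subseteq> X \<and> Pair [] ` S \<subseteq> lists G \<times> X \<and>
      (\<Sum>\<mu>\<in>S. app (path_op P Q ([], \<mu>)) v) = v"
    by (auto simp: path_op_def)
qed simp
qed

text \<open>An element \<open>x (r 1\<^sub>\<mu>) y\<close> of the ideal acts as \<open>f \<cdot> 0 \<cdot> g\<close>.\<close>

lemma presented_alg_rep: "operator_rep (presented_alg X G wt par R) M (presented_rel X G P Q)"
  unfolding presented_alg_def presented_rel_def
proof (rule operator_rep_quot[OF path_alg_rep])
  let ?A = "path_alg X G wt par :: ('k, weight, 'g path \<Rightarrow>\<^sub>0 'k) lusalg"
  let ?S = "{at_obj \<mu> r |\<mu> r. \<mu> \<in> X \<and> r \<in> R \<mu>}"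
  interpret operator_rep ?A M "based_rel (lists G \<times> X) (path_op P Q)" by (rule path_alg_rep)
  show "add ?A = (+)" by (simp add: path_alg_def based_alg_def)
  show "ideal_gen ?A ?S \<noteq> {}"
    unfolding ideal_gen_def span_def using scl.span_zero by blast
  fix i assume "i \<in> ideal_gen ?A ?S"
  then show "based_rel (lists G \<times> X) (path_op P Q) i 0"
    unfolding ideal_gen_def
  proof (rule span_acts_zero[rotated])
    fix t assume "t \<in> {mult ?A (mult ?A x r) y |x r y. x \<in> carr ?A \<and> r \<in> ?S \<and> y \<in> carr ?A}"
    then obtain x \<mu> r y where t: "t = mult ?A (mult ?A x (at_obj \<mu> r)) y" "x \<in> carr ?A" "y \<in> carr ?A"
      and r: "\<mu> \<in> X" "r \<in> R \<mu>" by blast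
    obtain f g where fg: "based_rel (lists G \<times> X) (path_op P Q) x f" "based_rel (lists G \<times> X) (path_op P Q) y g"
      using total t by metis
    have "keys (at_obj \<mu> r) \<subseteq> lists G \<times> X"
      using keys_lin[of "\<lambda>w. basvec (w, \<mu>)" r] R_words[OF r] r(1) unfolding at_obj_def by auto
    moreover have "Lin (path_op P Q) (at_obj \<mu> r) = 0"
      using R_zero[OF r] unfolding at_obj_def Lin_lin Lin_mult_right
      by (simp add: Lin_single path_op_def)
    ultimately have "based_rel (lists G \<times> X) (path_op P Q) (at_obj \<mu> r) 0" by (simp add: based_rel_def)
    from acts_mult[OF acts_mult[OF fg(1) this] fg(2)]
    show "keys t \<subseteq> lists G \<times> X \<and> Lin (path_op P Q) t = 0"
      by (simp add: t(1) based_rel_def)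
  qed
qed

lemma path_act_eq:
  assumes "\<And>\<mu> v. v \<in> vecs M \<Longrightarrow> P' \<mu> v = app (P \<mu>) v"
    and "\<And>g v. g \<in> G \<Longrightarrow> v \<in> vecs M \<Longrightarrow> Q' g v = app (Q g) v"
    and "w \<in> lists G" and "v \<in> vecs M"
  shows "path_act wt P' Q' (w, \<mu>) v = app (path_op P Q (w, \<mu>)) v"
  using assms(3)
proof (induction w rule: lists.induct)
  case Nil
  then show ?case using assms(1,4) by (simp add: path_op_def)
next
  case (Cons g w)
  let ?\<nu> = "\<mu> + sum_list (map wt w)"
  have closed: "app f u \<in> vecs M" if "restr M * f = f * restr M" "u \<in> vecs M" for f u
    using that by (metis app_times vecs_iff)
  have 1: "app (path_op P Q (w, \<mu>)) v \<in> vecs M"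
    by (rule closed[OF path_op_restr[OF Cons(2)] assms(4)])
  have 2: "app (P ?\<nu>) (app (path_op P Q (w, \<mu>)) v) \<in> vecs M"
    by (rule closed[OF P_restr 1])
  have "path_act wt P' Q' (g # w, \<mu>) v = app (Q g * (P ?\<nu> * path_op P Q (w, \<mu>))) v"
    using Cons(3) assms(1)[OF 1] assms(2)[OF Cons(1) 2] by (simp add: app_times)
  also have "P ?\<nu> * path_op P Q (w, \<mu>) = path_op P Q (w, \<mu>)"
    by (simp add: path_op_def word_P[OF Cons(2)] mult.assoc[symmetric] P_mult)
  finally show ?case by (simp add: path_op_def mult.assoc)
qed

lemma presented_act_eq:
  assumes "\<And>\<mu> v. v \<in> vecs M \<Longrightarrow> P' \<mu> v = app (P \<mu>) v"
    and "\<And>g v. g \<in> G \<Longrightarrow> v \<in> vecs M \<Longrightarrow> Q' g v = app (Q g) v"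
    and "presented_rel X G P Q Y f" and "v \<in> vecs M"
  shows "presented_act wt P' Q' Y v = app f v"
  unfolding presented_act_def
proof (rule quot_act_eq[OF assms(3)[unfolded presented_rel_def]])
  fix x assume "based_rel (lists G \<times> X) (path_op P Q) x f"
  then have x: "keys x \<subseteq> lists G \<times> X" and f: "f = Lin (path_op P Q) x" by (auto simp: based_rel_def)
  show "lin (\<lambda>b. path_act wt P' Q' b v) x = app f v"
    unfolding f app_Lin
  proof (rule lin_cong)
    fix b assume "b \<in> keys x"
    then obtain w \<mu> where "b = (w, \<mu>)" "w \<in> lists G" using x by (cases b) auto
    then show "path_act wt P' Q' b v = app (path_op P Q b) v"
      using path_act_eq[OF assms(1,2)] assms(4) by simp
  qed
qed

end

definition sign_commute :: "bit \<Rightarrow> bit \<Rightarrow> ('b, 'k::field) endo \<Rightarrow> ('b, 'k) endo \<Rightarrow> bool" where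
  "sign_commute p q f g \<longleftrightarrow> f * g = scalar (ksign (p * q)) * (g * f)"

lemma sign_commute_sym:
  assumes "sign_commute p q f g" shows "sign_commute q p g f"
proof -
  have "scalar (ksign (q * p)) * (f * g) = scalar (ksign (p * q) * ksign (p * q)) * (g * f)"
    using assms by (simp only: sign_commute_def scalar_mult mult.assoc mult.commute[of q])
  then show ?thesis by (simp add: sign_commute_def)
qed

lemma sign_commute_mult:
  assumes "sign_commute p q f h" "sign_commute p' q g h"
  shows "sign_commute (p + p') q (f * g) h"
proof -
  have "f * g * h = scalar (ksign (p' * q)) * (f * h * g)"
    using assms(2) by (simp add: sign_commute_def mult.assoc scalar_left_commute[of f])
  also have "\<dots> = scalar (ksign (p' * q)) * (scalar (ksign (p * q)) * (h * f * g))"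
    using assms(1) by (simp add: sign_commute_def mult.assoc)
  also have "\<dots> = scalar (ksign (p' * q) * ksign (p * q)) * (h * (f * g))"
    by (simp only: scalar_mult mult.assoc)
  also have "ksign (p' * q) * ksign (p * q) = (ksign ((p + p') * q) :: 'b)"
    by (simp only: distrib_right ksign_add mult.commute[of "ksign (p * q)"])
  finally show ?thesis by (simp add: sign_commute_def)
qed

lemma sign_commute_word:
  assumes "\<And>g. g \<in> G \<Longrightarrow> sign_commute (par g) q (Q g) h" "w \<in> lists G"
  shows "sign_commute (sum_list (map par w)) q (prod_list (map Q w)) h"
  using assms(2)
proof (induction w rule: lists.induct)
  case Nil
  show ?case by (simp add: sign_commute_def ksign_def)
next
  case (Cons g w)
  from sign_commute_mult[OF assms(1)[OF Cons(1)] Cons(3)] show ?case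
    unfolding list.map sum_list.Cons prod_list.Cons .
qed

text \<open>The sign rule passes from generators and weight projections to paths, where the parities add
  up, and from paths to their linear combinations.\<close>

lemma supercommute_presented:
  fixes M :: "'b sspace" and P P' :: "weight \<Rightarrow> ('b, 'k::field_char_0) endo"
  assumes "presented_rep X G wt par R M P Q" and "presented_rep X' G' wt' par' R' M P' Q'"
    and QQ: "\<And>g h. g \<in> G \<Longrightarrow> h \<in> G' \<Longrightarrow> sign_commute (par g) (par' h) (Q g) (Q' h)"
    and QP: "\<And>g \<mu>. g \<in> G \<Longrightarrow> Q g * P' \<mu> = P' \<mu> * Q g"
    and PQ: "\<And>h \<mu>. h \<in> G' \<Longrightarrow> P \<mu> * Q' h = Q' h * P \<mu>"
    and PP: "\<And>\<mu> \<nu>. P \<mu> * P' \<nu> = P' \<nu> * P \<mu>"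
    and f: "presented_rel X G P Q Y f" and f': "presented_rel X' G' P' Q' Y' f'"
  shows "supercommute M f f'"
proof -
  interpret A: presented_rep X G wt par R M P Q by fact
  interpret B: presented_rep X' G' wt' par' R' M P' Q' by fact
  obtain x where x: "keys x \<subseteq> lists G \<times> X" "f = Lin (path_op P Q) x"
    using f by (auto simp: presented_rel_def quot_rel_def based_rel_def)
  obtain x' where x': "keys x' \<subseteq> lists G' \<times> X'" "f' = Lin (path_op P' Q') x'"
    using f' by (auto simp: presented_rel_def quot_rel_def based_rel_def)
  have even: "sign_commute p 0 f g \<longleftrightarrow> f * g = g * f" for p and f g :: "('b, 'k) endo"
    by (simp add: sign_commute_def ksign_def)
  have paths: "sign_commute (sum_list (map par w)) (sum_list (map par' w'))
      (path_op P Q (w, \<mu>)) (path_op P' Q' (w', \<mu>'))"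
    if w: "w \<in> lists G" and w': "w' \<in> lists G'" for w w' \<mu> \<mu>'
  proof -
    have mult_even: "sign_commute p q (f * g) h" if "sign_commute p q f h" "sign_commute 0 q g h"
      for p q f g and h :: "('b, 'k) endo"
      using sign_commute_mult[OF that] by (simp only: add_0_right)
    have 1: "sign_commute (sum_list (map par w)) (par' h) (path_op P Q (w, \<mu>)) (Q' h)" if "h \<in> G'" for h
      unfolding path_op_def prod.case
      by (intro mult_even sign_commute_word[OF _ w] QQ that)
        (use PQ[OF that] in \<open>auto intro: sign_commute_sym simp: sign_commute_def ksign_def\<close>)
    have 2: "sign_commute (sum_list (map par w)) 0 (path_op P Q (w, \<mu>)) (P' \<mu>')"
      unfolding path_op_def prod.case
      by (intro mult_even sign_commute_word[OF _ w]) (use QP PP in \<open>auto simp: even\<close>)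
    show ?thesis
      by (subst (2) path_op_def, unfold prod.case)
        (intro sign_commute_sym[OF mult_even] sign_commute_word[OF _ w'] sign_commute_sym[OF 1]
          sign_commute_sym[OF 2])
  qed
  show ?thesis
    unfolding supercommute_def
  proof (intro allI)
    fix p q
    define F where "F = (\<lambda>a. component M p (path_op P Q a))"
    define F' where "F' = (\<lambda>a. component M q (path_op P' Q' a))"
    have FF: "F a * F' a' = scalar (ksign (p * q)) * (F' a' * F a)" if "a \<in> keys x" "a' \<in> keys x'" for a a'
    proof -
      have "a \<in> lists G \<times> X" "a' \<in> lists G' \<times> X'" using that x(1) x'(1) by blast+
      then obtain w \<mu> w' \<mu>' where a: "a = (w, \<mu>)" "w \<in> lists G" "a' = (w', \<mu>')" "w' \<in> lists G'"
        by auto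
      show ?thesis
        unfolding F_def F'_def a(1,3) component_homog[OF A.path_op_homog[OF a(2)]]
          component_homog[OF B.path_op_homog[OF a(4)]]
        using paths[OF a(2,4)] by (auto simp: sign_commute_def)
    qed
    have "Lin F x * Lin F' x' = Lin (\<lambda>a. Lin (\<lambda>a'. F a * F' a') x') x"
      unfolding Lin_mult_right by (simp only: Lin_mult_left)
    also have "\<dots> = Lin (\<lambda>a. Lin (\<lambda>a'. scalar (ksign (p * q)) * (F' a' * F a)) x') x"
      by (intro Lin_cong FF)
    also have "\<dots> = scalar (ksign (p * q)) * (Lin F' x' * Lin F x)"
      by (simp only: Lin_mult_left[symmetric] Lin_mult_right[symmetric])
    finally show "component M p f * component M q f' =
        scalar (ksign (p * q)) * (component M q f' * component M p f)"
      unfolding x(2) x'(2) component_Lin F_def F'_def .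
  qed
qed

lemma intertwines_presented:
  assumes "\<And>g. g \<in> G \<Longrightarrow> T * Q g = Q' g * T" and "\<And>\<mu>. T * P \<mu> = P' \<mu> * T"
  shows "intertwines T (presented_rel X G P Q) (presented_rel X G P' Q')"
  unfolding presented_rel_def
proof (intro intertwines_quot intertwines_based)
  fix a assume "a \<in> lists G \<times> X"
  then obtain w \<mu> where a: "a = (w, \<mu>)" and w: "w \<in> lists G" by auto
  from w have "T * prod_list (map Q w) = prod_list (map Q' w) * T"
  proof (induction w rule: lists.induct)
    case (Cons g w)
    have "T * prod_list (map Q (g # w)) = Q' g * (T * prod_list (map Q w))"
      by (simp add: assms(1)[OF Cons(1)] mult.assoc[symmetric])
    then show ?case by (simp add: Cons(3) mult.assoc)
  qed simp
  then have "T * path_op P Q a = prod_list (map Q' w) * (T * P \<mu>)"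
    unfolding a path_op_def prod.case by (simp add: mult.assoc[symmetric])
  then show "T * path_op P Q a = path_op P' Q' a * T"
    unfolding a path_op_def prod.case by (simp add: assms(2) mult.assoc)
qed

section \<open>The relations of the periplectic superalgebras\<close>

abbreviation word_op :: "('g \<Rightarrow> ('b, 'k) endo) \<Rightarrow> ('g list \<Rightarrow>\<^sub>0 'k::field) \<Rightarrow> ('b, 'k) endo" where
  "word_op Q \<equiv> Lin (\<lambda>w. prod_list (map Q w))"

definition whomog :: "bit \<Rightarrow> (gen list \<Rightarrow>\<^sub>0 'k::field) \<Rightarrow> bool" where
  "whomog p x \<longleftrightarrow> (\<forall>w\<in>keys x. sum_list (map gpar w) = p)"

definition sbr :: "bit \<Rightarrow> bit \<Rightarrow> ('b, 'k::field) endo \<Rightarrow> ('b, 'k) endo \<Rightarrow> ('b, 'k) endo" where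
  "sbr p q f g = f * g - scalar (ksign (p * q)) * (g * f)"

lemma sbr_simps [simp]:
  "sbr 0 q f g = f * g - g * f" "sbr p 0 f g = f * g - g * f" "sbr 1 1 f g = f * g + g * f"
  by (simp_all add: sbr_def ksign_def scalar_uminus)

lemma word_op_wmult: "word_op Q (wmult x y) = word_op Q x * word_op Q y"
  unfolding wmult_def by (rule Lin_bilin) (simp add: Lin_single)

lemma word_op_wbr:
  assumes "whomog p x" "whomog q y"
  shows "word_op Q \<lbrace>x, y\<rbrace> = sbr p q (word_op Q x) (word_op Q y)"
proof -
  have "word_op Q \<lbrace>x, y\<rbrace> = Lin (\<lambda>w. Lin (\<lambda>w'. prod_list (map Q w) * prod_list (map Q w') -
      scalar (ksign (p * q)) * (prod_list (map Q w') * prod_list (map Q w))) y) x"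
    unfolding wbr_def bilin_def Lin_lin
    by (intro Lin_cong) (use assms in \<open>simp add: Lin_minus Lin_scl Lin_single whomog_def\<close>)
  also have "\<dots> = Lin (\<lambda>w. prod_list (map Q w) * word_op Q y) x -
      Lin (\<lambda>w. scalar (ksign (p * q)) * (word_op Q y * prod_list (map Q w))) x"
  proof -
    have dist: "Lin (\<lambda>a. F a - G a) v = Lin F v - Lin G v" for F G :: "'c \<Rightarrow> ('b, 'a) endo" and v
      by (simp add: Lin_def right_diff_distrib sum_subtractf)
    show ?thesis
      by (simp only: dist Lin_mult_left[of _ _ y] Lin_mult_right[of _ y])
  qed
  also have "\<dots> = sbr p q (word_op Q x) (word_op Q y)"
    unfolding sbr_def by (simp only: Lin_mult_right[of _ x] Lin_mult_left[of _ _ x])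
  finally show ?thesis .
qed

lemma keys_bilin: "keys (bilin f x y) \<subseteq> (\<Union>a\<in>keys x. \<Union>b\<in>keys y. keys (f a b))"
  unfolding bilin_def by (rule order_trans[OF keys_lin UN_mono[OF order_refl keys_lin]])

lemma whomog_wbr:
  assumes "whomog p x" "whomog q y"
  shows "whomog (p + q) \<lbrace>x, y\<rbrace>"
  unfolding whomog_def
proof
  fix w assume "w \<in> keys \<lbrace>x, y\<rbrace>"
  then have "w \<in> (\<Union>v\<in>keys x. \<Union>v'\<in>keys y. keys (basvec (v @ v') -
      scl (ksign (sum_list (map gpar v) * sum_list (map gpar v'))) (basvec (v' @ v)) :: _ \<Rightarrow>\<^sub>0 'a))"
    unfolding wbr_def by (rule subsetD[OF keys_bilin])
  then obtain v v' where v: "v \<in> keys x" "v' \<in> keys y" and "w \<in> keys (basvec (v @ v') -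
      scl (ksign (sum_list (map gpar v) * sum_list (map gpar v'))) (basvec (v' @ v)) :: _ \<Rightarrow>\<^sub>0 'a)"
    by blast
  then have "w = v @ v' \<or> w = v' @ v"
    using keys_minus' keys_scl by (fastforce simp: scl_single split: if_splits)
  then show "sum_list (map gpar w) = p + q"
    using v assms by (elim disjE) (simp_all only: whomog_def map_append sum_list_append add.commute)
qed

lemma whomog_gen: "whomog (gpar g) (basvec [g])"
  by (simp add: whomog_def)

lemma word_op_gen: "word_op Q (basvec [g]) = Q g"
  by (simp add: Lin_single)

lemma word_op_wbr_gen:
  "word_op Q \<lbrace>basvec [g], basvec [h]\<rbrace> = sbr (gpar g) (gpar h) (Q g) (Q h)"
  "word_op Q \<lbrace>basvec [k], \<lbrace>basvec [g], basvec [h]\<rbrace>\<rbrace> =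
     sbr (gpar k) (gpar g + gpar h) (Q k) (sbr (gpar g) (gpar h) (Q g) (Q h))"
  "word_op Q \<lbrace>\<lbrace>basvec [g], basvec [h]\<rbrace>, basvec [k]\<rbrace> =
     sbr (gpar g + gpar h) (gpar k) (sbr (gpar g) (gpar h) (Q g) (Q h)) (Q k)"
  by (simp_all only: word_op_wbr[OF whomog_gen whomog_gen] word_op_gen
      word_op_wbr[OF whomog_gen whomog_wbr[OF whomog_gen whomog_gen]]
      word_op_wbr[OF whomog_wbr[OF whomog_gen whomog_gen] whomog_gen])

text \<open>The assumption is the supercommutator of matrix units
  \<open>[T\<^bsub>i,j\<^esub>, T\<^bsub>k,l\<^esub>] = \<delta>\<^bsub>j,k\<^esub> T\<^bsub>i,l\<^esub> - (-1)\<^bsup>(|i|+|j|)(|k|+|l|)\<^esup> \<delta>\<^bsub>l,i\<^esub> T\<^bsub>k,j\<^esub>\<close>, solved for \<open>T\<^bsub>i,j\<^esub> T\<^bsub>k,l\<^esub>\<close>.\<close>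

locale gl_rep =
  fixes n :: nat and T :: "int \<Rightarrow> int \<Rightarrow> ('b, 'k::field_char_0) endo"
  assumes TT: "i \<in> Ind n \<Longrightarrow> j \<in> Ind n \<Longrightarrow> k \<in> Ind n \<Longrightarrow> l \<in> Ind n \<Longrightarrow>
    T i j * T k l =
      (if (i < 0) \<noteq> (j < 0) \<and> (k < 0) \<noteq> (l < 0) then - (T k l * T i j) else T k l * T i j) +
      (if j = k then T i l else 0) -
      (if l = i then (if (i < 0) \<noteq> (j < 0) \<and> (k < 0) \<noteq> (l < 0) then - T k j else T k j) else 0)"
begin

text \<open>The elements \<open>a\<^bsub>i,j\<^esub>\<close>, \<open>b\<^bsub>i,j\<^esub>\<close> and \<open>c\<^bsub>i,j\<^esub>\<close> of \<open>\<pp>(n)\<close>, except that \<open>elB i i\<close> is \<open>2b\<^bsub>i,i\<^esub>\<close>: without the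
  factor \<open>1/2\<close> the brackets have the same form for \<open>i = j\<close> and \<open>i \<noteq> j\<close>.\<close>

definition "elA i j = T (int i) (int j) - T (- int j) (- int i)"
definition "elB i j = T (int i) (- int j) + T (int j) (- int i)"
definition "elC i j = T (- int i) (int j) - T (- int j) (int i)"

lemma Ind_int: "i \<in> {1..n} \<Longrightarrow> int i \<in> Ind n" "i \<in> {1..n} \<Longrightarrow> - int i \<in> Ind n"
  by (auto simp: Ind_def)

lemma elB_sym: "elB i j = elB j i"
  by (simp add: elB_def add.commute)

lemma elC_diag: "elC i i = 0"
  by (simp add: elC_def)

context
  fixes i j k l :: nat
  assumes ij: "i \<in> {1..n}" "j \<in> {1..n}" and kl: "k \<in> {1..n}" "l \<in> {1..n}"
begin

lemmas TT_int = TT[OF Ind_int(1)[OF ij(1)] Ind_int(1)[OF ij(2)]] TT[OF Ind_int(1)[OF ij(1)] Ind_int(2)[OF ij(2)]]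
  TT[OF Ind_int(2)[OF ij(1)] Ind_int(1)[OF ij(2)]] TT[OF Ind_int(2)[OF ij(1)] Ind_int(2)[OF ij(2)]]
  TT[OF Ind_int(1)[OF ij(2)] Ind_int(1)[OF ij(1)]] TT[OF Ind_int(1)[OF ij(2)] Ind_int(2)[OF ij(1)]]
  TT[OF Ind_int(2)[OF ij(2)] Ind_int(1)[OF ij(1)]] TT[OF Ind_int(2)[OF ij(2)] Ind_int(2)[OF ij(1)]]

lemmas Ind_kl = Ind_int(1)[OF kl(1)] Ind_int(1)[OF kl(2)] Ind_int(2)[OF kl(1)] Ind_int(2)[OF kl(2)]

lemma pos: "int i > 0" "int j > 0" "int k > 0" "int l > 0"
  using ij kl by auto

lemma bracket_AA: "elA i j * elA k l - elA k l * elA i j =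
    (if j = k then elA i l else 0) - (if l = i then elA k j else 0)"
  unfolding elA_def left_diff_distrib right_diff_distrib TT_int[OF Ind_kl(1) Ind_kl(2)] TT_int[OF Ind_kl(4) Ind_kl(3)]
  using pos by (auto simp: algebra_simps)

lemma bracket_AB: "elA i j * elB k l - elB k l * elA i j =
    (if j = k then elB i l else 0) + (if j = l then elB k i else 0)"
  unfolding elA_def elB_def left_diff_distrib right_diff_distrib distrib_left distrib_right
    TT_int[OF Ind_kl(1) Ind_kl(4)] TT_int[OF Ind_kl(2) Ind_kl(3)]
  using pos by (auto simp: algebra_simps)

lemma bracket_AC: "elA i j * elC k l - elC k l * elA i j =
    - (if i = k then elC j l else 0) - (if i = l then elC k j else 0)"
  unfolding elA_def elC_def left_diff_distrib right_diff_distrib distrib_left distrib_right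
    TT_int[OF Ind_kl(3) Ind_kl(2)] TT_int[OF Ind_kl(4) Ind_kl(1)]
  using pos by (auto simp: algebra_simps)

lemma bracket_BA: "elB k l * elA i j - elA i j * elB k l =
    - (if j = k then elB i l else 0) - (if j = l then elB k i else 0)"
  using bracket_AB by (simp add: algebra_simps split: if_splits)

lemma bracket_CA: "elC k l * elA i j - elA i j * elC k l =
    (if i = k then elC j l else 0) + (if i = l then elC k j else 0)"
  using bracket_AC by (simp add: algebra_simps split: if_splits)

lemma bracket_BB: "elB i j * elB k l + elB k l * elB i j = 0"
  unfolding elB_def left_diff_distrib right_diff_distrib distrib_left distrib_right
    TT_int[OF Ind_kl(1) Ind_kl(4)] TT_int[OF Ind_kl(2) Ind_kl(3)]
  using pos by (auto simp: algebra_simps)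

lemma bracket_CC: "elC i j * elC k l + elC k l * elC i j = 0"
  unfolding elC_def left_diff_distrib right_diff_distrib distrib_left distrib_right
    TT_int[OF Ind_kl(3) Ind_kl(2)] TT_int[OF Ind_kl(4) Ind_kl(1)]
  using pos by (auto simp: algebra_simps)

lemma bracket_BC: "elB i j * elC k l + elC k l * elB i j =
    (if j = k then elA i l else 0) - (if j = l then elA i k else 0) +
    (if i = k then elA j l else 0) - (if i = l then elA j k else 0)"
  unfolding elB_def elC_def elA_def left_diff_distrib right_diff_distrib distrib_left distrib_right
    TT_int[OF Ind_kl(3) Ind_kl(2)] TT_int[OF Ind_kl(4) Ind_kl(1)]
  using pos by (auto simp: algebra_simps)

end

definition periplectic_gen :: "gen \<Rightarrow> ('b, 'k) endo" where
  "periplectic_gen g = (case g of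
     GE i \<Rightarrow> elA i (i + 1) | GF i \<Rightarrow> elA (i + 1) i | GB11 \<Rightarrow> T 1 (- 1)
   | GB i \<Rightarrow> elB i (i + 1) | GC i \<Rightarrow> elC i (i + 1))"

lemma elB_11: "elB 1 1 = scalar 2 * T 1 (- 1)"
  by (simp add: elB_def scalar_numeral mult_2)

text \<open>An odd operator that supercommutes with itself squares to zero.\<close>

lemma B11_square:
  assumes "1 \<le> n"
  shows "T 1 (- 1) * T 1 (- 1) = 0"
proof -
  have I: "1 \<in> Ind n" "- 1 \<in> Ind n" using assms by (auto simp: Ind_def)
  have "T 1 (- 1) * T 1 (- 1) = - (T 1 (- 1) * T 1 (- 1))"
    using TT[OF I I] by simp
  then have "scalar 2 * (T 1 (- 1) * T 1 (- 1)) = 0"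
    by (metis (no_types, opaque_lifting) add.right_inverse mult_2 scalar_numeral)
  then have "scalar (1/2) * (scalar 2 * (T 1 (- 1) * T 1 (- 1))) = 0" by simp
  then show ?thesis by (simp add: mult.assoc[symmetric] scalar_mult[symmetric])
qed

text \<open>Each relation is an instance of the bracket formulas above. Only \<open>EF\<close> and \<open>BC\<close> refer to the weight
  \<open>\<mu>\<close>; there the bracket is \<open>a\<^bsub>i,i\<^esub> - a\<^bsub>i+1,i+1\<^esub>\<close> up to sign, which is a number after composition with \<open>p\<close>.\<close>

lemma relations_vanish:
  assumes cartan: "\<And>i j. i \<in> {1..n} \<Longrightarrow> j \<in> {1..n} \<Longrightarrow>
      (elA i i - elA j j) * p = scalar (of_int (lookup \<mu> i - lookup \<mu> j)) * p"
    and "1 \<le> n" and "r \<in> rels_p n \<mu>"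
  shows "word_op periplectic_gen r * p = 0"
proof -
  have w: "wform (alpha i) \<mu> = lookup \<mu> i - lookup \<mu> (i + 1)" for i
  proof -
    have "keys (alpha i) = {i, i + 1}"
      by (auto simp: alpha_def eps_def in_keys_iff lookup_minus lookup_single when_def split: if_splits)
    then show ?thesis
      by (simp add: wform_def alpha_def eps_def lookup_minus lookup_single)
  qed
  note rel_simps = Lin_minus word_op_wbr_gen periplectic_gen_def Lin_scl word_op_gen
  from assms(3) show ?thesis
proof cases
  case (EF i j)
  have "elA i (i + 1) * elA (j + 1) j - elA (j + 1) j * elA i (i + 1) =
      (if i = j then elA i i - elA (i + 1) (i + 1) else 0)"
    using bracket_AA[of i "i + 1" "j + 1" j] EF by auto
  then show ?thesis
    using cartan[of i "i + 1"] EF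
    by (auto simp: EF Lin_minus word_op_wbr_gen periplectic_gen_def Lin_scl Lin_single w[unfolded Suc_eq_plus1[symmetric]] left_diff_distrib)
next
  case (EE i j)
  show ?thesis unfolding EE(1)
    using EE assms(2) bracket_AA[of i "i + 1" j "j + 1"] elC_diag
    by (auto simp: rel_simps)
next
  case (FF i j)
  show ?thesis unfolding FF(1)
    using FF assms(2) bracket_AA[of "i + 1" i "j + 1" j] elC_diag
    by (auto simp: rel_simps)
next
  case (EEE i j)
  show ?thesis unfolding EEE(1)
    using EEE assms(2) bracket_AA[of i "i + 1" j "j + 1"] bracket_AA[of i "i + 1" i "j + 1"]
      bracket_AA[of i "i + 1" j "i + 1"] elC_diag
    by (auto simp: rel_simps)
next
  case (FFF i j)
  show ?thesis unfolding FFF(1)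
    using FFF assms(2) bracket_AA[of "i + 1" i "j + 1" j] bracket_AA[of "i + 1" i "i + 1" j]
      bracket_AA[of "i + 1" i "j + 1" i] elC_diag
    by (auto simp: rel_simps)
next
  case (BB i j)
  show ?thesis unfolding BB(1)
    using BB assms(2) bracket_BB[of i "i + 1" j "j + 1"] elC_diag
    by (auto simp: rel_simps)
next
  case (CC i j)
  show ?thesis unfolding CC(1)
    using CC assms(2) bracket_CC[of i "i + 1" j "j + 1"] elC_diag
    by (auto simp: rel_simps)
next
  case (BC i j)
  have "word_op periplectic_gen r = (if j = i
      then elA (i + 1) (i + 1) - elA i i + scalar (of_int (wform (alpha i) \<mu>)) else 0)"
    unfolding BC(1)
    using BC(2-) bracket_BC[of i "i + 1" j "j + 1"] bracket_AA[of i j "i + 1" i]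
      bracket_AA[of i "i + 1" j "j + 1"]
    by (auto simp: Lin_minus word_op_wbr_gen periplectic_gen_def Lin_scl Lin_uminus Lin_single)
  moreover have "(elA (i + 1) (i + 1) - elA i i + scalar (of_int (wform (alpha i) \<mu>))) * p = 0"
    unfolding distrib_right w using cartan[of "i + 1" i] BC(2-)
    by (simp add: distrib_right[symmetric] scalar_add[symmetric])
  ultimately show ?thesis by simp
next
  case (BF i j)
  show ?thesis unfolding BF(1)
    using BF assms(2) bracket_AB[of "j + 1" j i "i + 1"] elC_diag
    by (auto simp: rel_simps)
next
  case (BE i j)
  show ?thesis unfolding BE(1)
    using BE assms(2) bracket_AB[of j "j + 1" i "i + 1"] elC_diag
    by (auto simp: rel_simps)
next
  case (BF_BE i)
  show ?thesis unfolding BF_BE(1)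
    using BF_BE assms(2) bracket_AB[of "i + 1" i i "i + 1"] bracket_BA[of "i + 1" i i "i + 1"]
      bracket_AB[of "i + 1" "i + 2" "i + 1" "i + 2"]
      bracket_BA[of "i + 1" "i + 2" "i + 1" "i + 2"] elC_diag
    by (auto simp: rel_simps)
next
  case (BF_BE' i)
  show ?thesis unfolding BF_BE'(1)
    using BF_BE' assms(2) bracket_AB[of "i + 2" "i + 1" i "i + 1"]
      bracket_BA[of "i + 2" "i + 1" i "i + 1"] bracket_AB[of i "i + 1" "i + 1" "i + 2"]
      bracket_BA[of i "i + 1" "i + 1" "i + 2"] elC_diag
    by (auto simp: rel_simps)
next
  case (FC i j)
  show ?thesis unfolding FC(1)
    using FC assms(2) bracket_AC[of "j + 1" j i "i + 1"] bracket_CA[of "j + 1" j i "i + 1"] elC_diag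
    by (auto simp: rel_simps)
next
  case (EC i j)
  show ?thesis unfolding EC(1)
    using EC assms(2) bracket_AC[of j "j + 1" i "i + 1"] bracket_CA[of j "j + 1" i "i + 1"] elC_diag
    by (auto simp: rel_simps)
next
  case (FC_EC i)
  show ?thesis unfolding FC_EC(1)
    using FC_EC assms(2) bracket_AC[of "i + 1" i "i + 1" "i + 2"]
      bracket_CA[of "i + 1" i "i + 1" "i + 2"] bracket_AC[of "i + 1" "i + 2" i "i + 1"]
      bracket_CA[of "i + 1" "i + 2" i "i + 1"] elC_diag
    by (auto simp: rel_simps)
next
  case (BFF i j)
  show ?thesis unfolding BFF(1)
    using BFF assms(2) bracket_AB[of "i + 1" i i "i + 1"] bracket_BA[of "i + 1" i i "i + 1"]
      bracket_AB[of "j + 1" j "i + 1" "i + 1"]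
      bracket_BA[of "j + 1" j "i + 1" "i + 1"] elB_sym[of "i + 1" "i + 2"] elC_diag
    by (auto simp: rel_simps scalar_numeral mult_2 numeral_2_eq_2)
next
  case BFE
  show ?thesis unfolding BFE(1)
    using BFE assms(2) bracket_AB[of 2 1 1 2] bracket_BA[of 2 1 1 2] bracket_AB[of 1 2 2 2]
      bracket_BA[of 1 2 2 2] elB_sym[of 1 2] elC_diag
    by (auto simp: rel_simps scalar_numeral mult_2 numeral_2_eq_2)
next
  case (BEE j)
  show ?thesis unfolding BEE(1)
    using BEE assms(2) bracket_AB[of 1 2 1 2] bracket_BA[of 1 2 1 2]
      bracket_AB[of j "j + 1" 1 1] bracket_BA[of j "j + 1" 1 1] elC_diag
    by (auto simp: rel_simps scalar_numeral mult_2 numeral_2_eq_2)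
next
  case (CFF i)
  show ?thesis unfolding CFF(1)
    using CFF assms(2) bracket_AC[of "i + 1" i "i + 1" "i + 2"]
      bracket_CA[of "i + 1" i "i + 1" "i + 2"] bracket_AC[of "i + 2" "i + 1" i "i + 2"]
      bracket_CA[of "i + 2" "i + 1" i "i + 2"] elC_diag
    by (auto simp: rel_simps scalar_numeral mult_2 numeral_2_eq_2)
next
  case (CFF0 i j)
  show ?thesis unfolding CFF0(1)
    using CFF0 assms(2) bracket_AC[of "i + 1" i "i + 1" "i + 2"]
      bracket_CA[of "i + 1" i "i + 1" "i + 2"] bracket_AC[of "j + 1" j i "i + 2"]
      bracket_CA[of "j + 1" j i "i + 2"] elC_diag
    by (auto simp: rel_simps scalar_numeral mult_2 numeral_2_eq_2)
next
  case EB
  show ?thesis unfolding EB(1)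
    using EB assms(2) bracket_AB[of 1 2 1 2] bracket_BA[of 1 2 1 2] elB_11 elC_diag
    by (auto simp: rel_simps scalar_numeral mult_2 numeral_2_eq_2)
next
  case B11
  show ?thesis unfolding B11(1) word_op_wmult word_op_gen
    using B11_square[OF assms(2)] by (simp add: periplectic_gen_def)
qed
qed

definition tilde_periplectic_gen :: "gen \<Rightarrow> ('b, 'k) endo" where
  "tilde_periplectic_gen g = (case g of
     GE i \<Rightarrow> elA i (i + 1) | GF i \<Rightarrow> elA (i + 1) i | GB11 \<Rightarrow> T (- 1) 1
   | GB i \<Rightarrow> T (- int i) (int (i + 1)) + T (- int (i + 1)) (int i)
   | GC i \<Rightarrow> T (int i) (- int (i + 1)) - T (int (i + 1)) (- int i))"

end

lemma Ind_uminus: "- i \<in> Ind n \<longleftrightarrow> i \<in> Ind n"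
  by (auto simp: Ind_def)

lemma zero_notin_Ind: "0 \<notin> Ind n"
  by (simp add: Ind_def)

text \<open>The sign in the commutation rules depends only on whether \<open>i\<close>, \<open>j\<close> and whether \<open>k\<close>, \<open>l\<close> have
  different parities, so it survives the exchange of the even and the odd half of the index
  set. This exchange interchanges the two families of periplectic superalgebras.\<close>

lemma gl_rep_flip:
  assumes "gl_rep n T"
  shows "gl_rep n (\<lambda>i j. T (- i) (- j))"
proof
  interpret gl_rep n T by fact
  fix i j k l assume I: "i \<in> Ind n" "j \<in> Ind n" "k \<in> Ind n" "l \<in> Ind n"
  have neg: "(0 < x) = (\<not> x < 0)" if "x \<in> Ind n" for x
    using that zero_notin_Ind[of n] by (cases "x = 0") auto
  show "T (- i) (- j) * T (- k) (- l) =
      (if (i < 0) \<noteq> (j < 0) \<and> (k < 0) \<noteq> (l < 0) then - (T (- k) (- l) * T (- i) (- j))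
       else T (- k) (- l) * T (- i) (- j)) +
      (if j = k then T (- i) (- l) else 0) -
      (if l = i then (if (i < 0) \<noteq> (j < 0) \<and> (k < 0) \<noteq> (l < 0) then - T (- k) (- j)
        else T (- k) (- j)) else 0)"
    using TT[of "- i" "- j" "- k" "- l"] I by (simp add: Ind_uminus neg)
qed

lemma word_op_tilde_subst:
  "word_op Q (tilde_subst r) = word_op (\<lambda>g. word_op Q (tilde_gen g)) r"
proof -
  have "word_op Q (foldr (\<lambda>g. wmult (tilde_gen g)) w wone) = prod_list (map (\<lambda>g. word_op Q (tilde_gen g)) w)" for w
    by (induction w) (simp_all add: Lin_single word_op_wmult)
  then show ?thesis by (simp add: tilde_subst_def Lin_lin)
qed

text \<open>For the flipped operators \<open>a\<^bsub>i,j\<^esub>\<close> becomes \<open>-a\<^bsub>j,i\<^esub>\<close>. This accounts for the substitution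
  \<open>E\<^sub>i \<mapsto> -F\<^sub>i\<close>, \<open>F\<^sub>i \<mapsto> -E\<^sub>i\<close> and for the negated weight in the relations.\<close>

lemma (in gl_rep) tilde_relations_vanish:
  assumes cartan: "\<And>i j. i \<in> {1..n} \<Longrightarrow> j \<in> {1..n} \<Longrightarrow>
      (elA i i - elA j j) * p = scalar (of_int (lookup \<mu> i - lookup \<mu> j)) * p"
    and "1 \<le> n" and "r \<in> rels_pt n \<mu>"
  shows "word_op tilde_periplectic_gen r * p = 0"
proof -
  interpret flip: gl_rep n "\<lambda>i j. T (- i) (- j)" by (rule gl_rep_flip) (rule gl_rep_axioms)
  obtain r' where r': "r = tilde_subst r'" "r' \<in> rels_p n (- \<mu>)" using assms(3) by (auto simp: rels_pt_def)
  have A: "flip.elA i j = - elA j i" for i j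
    by (simp add: flip.elA_def elA_def)
  have "word_op tilde_periplectic_gen (tilde_gen g) = flip.periplectic_gen g" for g
    by (cases g) (simp_all add: Lin_single Lin_uminus tilde_periplectic_gen_def flip.periplectic_gen_def
        A flip.elB_def flip.elC_def add.commute)
  then have "word_op tilde_periplectic_gen r = word_op flip.periplectic_gen r'"
    unfolding r' word_op_tilde_subst by simp
  moreover have "word_op flip.periplectic_gen r' * p = 0"
  proof (rule flip.relations_vanish[OF _ assms(2) r'(2)])
    fix i j assume "i \<in> {1..n}" "j \<in> {1..n}"
    from cartan[OF this(2,1)]
    show "(flip.elA i i - flip.elA j j) * p = scalar (of_int (lookup (- \<mu>) i - lookup (- \<mu>) j)) * p"
      by (simp add: A algebra_simps)
  qed
  ultimately show ?thesis by simp
qed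

text \<open>Relations lie in the path algebra on \<open>gens n\<close>: they do not mention generators whose index is
  out of range.\<close>

definition words_in :: "'g set \<Rightarrow> ('g list \<Rightarrow>\<^sub>0 'k::field) \<Rightarrow> bool" where
  "words_in S x \<longleftrightarrow> keys x \<subseteq> lists S"

lemma words_wbr:
  fixes x y :: "gen list \<Rightarrow>\<^sub>0 'k::field"
  assumes "words_in S x" "words_in S y"
  shows "words_in S \<lbrace>x, y\<rbrace>"
  unfolding wbr_def words_in_def
proof (rule order_trans[OF keys_bilin], intro UN_least)
  fix v w assume "v \<in> keys x" "w \<in> keys y"
  then have "v \<in> lists S" "w \<in> lists S" using assms unfolding words_in_def by blast+
  then have "{v @ w, w @ v} \<subseteq> lists S" by auto
  moreover have "keys (basvec (v @ w) - scl c (basvec (w @ v))) \<subseteq> {v @ w, w @ v}" for c :: 'k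
    by (rule order_trans[OF keys_minus']) (use keys_scl[of c "basvec (w @ v)"] in auto)
  ultimately show "keys (basvec (v @ w) - scl (ksign (sum_list (map gpar v) * sum_list (map gpar w)))
      (basvec (w @ v)) :: gen list \<Rightarrow>\<^sub>0 'k) \<subseteq> lists S" by blast
qed

lemma words_wmult:
  fixes x y :: "gen list \<Rightarrow>\<^sub>0 'k::field"
  assumes "words_in S x" "words_in S y"
  shows "words_in S (wmult x y)"
  unfolding wmult_def words_in_def
proof (rule order_trans[OF keys_bilin], intro UN_least)
  fix v w assume "v \<in> keys x" "w \<in> keys y"
  then have "v \<in> lists S" "w \<in> lists S" using assms unfolding words_in_def by blast+
  then show "keys (basvec (v @ w) :: _ \<Rightarrow>\<^sub>0 'k) \<subseteq> lists S" by auto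
qed

lemma words_minus: "words_in S x \<Longrightarrow> words_in S y \<Longrightarrow> words_in S (x - y)"
  unfolding words_in_def using keys_minus'[of x y] by blast

lemma words_scl: "words_in S x \<Longrightarrow> words_in S (scl c x)"
  unfolding words_in_def using keys_scl[of c x] by blast

lemma words_add: "words_in S x \<Longrightarrow> words_in S y \<Longrightarrow> words_in S (x + y)"
  unfolding words_in_def using Poly_Mapping.keys_add[of x y] by blast

lemma words_uminus: "words_in S x \<Longrightarrow> words_in S (- x)"
  unfolding words_in_def by (simp add: keys_uminus')

lemma words_basvec: "set w \<subseteq> S \<Longrightarrow> words_in S (basvec w)"
  unfolding words_in_def by auto

lemma rels_p_words:
  assumes "r \<in> rels_p n \<mu>"
  shows "words_in (gens n) r"
  using assms
  by cases (auto intro!: words_minus words_wbr words_wmult words_scl words_add words_uminus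
      words_basvec simp: gens_def)

lemma rels_pt_words:
  assumes "r \<in> rels_pt n \<mu>"
  shows "words_in (gens n) r"
proof -
  obtain r' where r': "r = tilde_subst r'" "r' \<in> rels_p n (- \<mu>)" using assms by (auto simp: rels_pt_def)
  have gen: "words_in (gens n) (tilde_gen g :: _ \<Rightarrow>\<^sub>0 'a)" if "g \<in> gens n" for g
    using that by (cases g) (auto intro!: words_uminus words_basvec simp: gens_def)
  have "words_in (gens n) (foldr (\<lambda>g. wmult (tilde_gen g :: _ \<Rightarrow>\<^sub>0 'a)) w wone)" if "w \<in> lists (gens n)" for w
    using that by (induction w rule: lists.induct) (auto intro!: words_wmult words_basvec gen)
  then show ?thesis
    unfolding r' tilde_subst_def using rels_p_words[OF r'(2)] unfolding words_in_def
    by (intro order_trans[OF keys_lin] UN_least) blast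
qed

section \<open>The Weyl-Clifford superalgebra\<close>

text \<open>These are \<open>(-1)\<^bsup>|i||j|\<^esup>\<close> and \<open>(-1)\<^bsup>(|i|+|j|)|r|\<^esup>\<close>, the signs for moving \<open>z\<^bsub>k,i\<^esub>\<close> past \<open>z\<^bsub>k',j\<^esub>\<close> and \<open>T\<^bsub>i,j\<^esub>\<close> past
  \<open>z\<^bsub>k,r\<^esub>\<close>.\<close>

definition isign :: "int \<Rightarrow> int \<Rightarrow> ('b, 'k::field) endo" where
  "isign i j = (if i < 0 \<and> j < 0 then - 1 else 1)"

definition jsign :: "int \<Rightarrow> int \<Rightarrow> int \<Rightarrow> ('b, 'k::field) endo" where
  "jsign i j r = (if (i < 0) \<noteq> (j < 0) \<and> r < 0 then - 1 else 1)"

lemma Ind_cases: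
  assumes "i \<in> Ind n"
  obtains (pos) l where "l \<in> {1..n}" "i = int l" | (neg) l where "l \<in> {1..n}" "i = - int l"
proof (cases "0 < i")
  case True
  then show ?thesis using assms pos[of "nat i"] by (auto simp: Ind_def)
next
  case False
  then show ?thesis using assms neg[of "nat (- i)"] by (auto simp: Ind_def)
qed

lemma sum_Ind: "(\<Sum>r\<in>Ind n. f r) = (\<Sum>l = 1..n. f (int l) + f (- int l))"
proof -
  have "Ind n = int ` {1..n} \<union> (\<lambda>l. - int l) ` {1..n}"
  proof (intro set_eqI iffI)
    fix i assume "i \<in> Ind n"
    then show "i \<in> int ` {1..n} \<union> (\<lambda>l. - int l) ` {1..n}"
      by (cases rule: Ind_cases) blast+
  qed (auto simp: Ind_def)
  moreover have "(\<Sum>r\<in>int ` {1..n} \<union> (\<lambda>l. - int l) ` {1..n}. f r) =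
      (\<Sum>r\<in>int ` {1..n}. f r) + (\<Sum>r\<in>(\<lambda>l. - int l) ` {1..n}. f r)"
    by (rule sum.union_disjoint) auto
  ultimately show ?thesis
    by (simp add: sum.reindex inj_on_def sum.distrib)
qed

text \<open>The unit is a parameter \<open>u\<close>: the operators act on an ambient space, and the identity of the
  module is only a projection there.\<close>

locale super_weyl =
  fixes m n :: nat and u :: "('b, 'k::field_char_0) endo" and z d :: "nat \<Rightarrow> int \<Rightarrow> ('b, 'k) endo"
  assumes zz: "k \<in> {1..m} \<Longrightarrow> k' \<in> {1..m} \<Longrightarrow> i \<in> Ind n \<Longrightarrow> j \<in> Ind n \<Longrightarrow>
      z k i * z k' j = isign i j * (z k' j * z k i)"
    and dd: "k \<in> {1..m} \<Longrightarrow> k' \<in> {1..m} \<Longrightarrow> i \<in> Ind n \<Longrightarrow> j \<in> Ind n \<Longrightarrow>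
      d k i * d k' j = isign i j * (d k' j * d k i)"
    and dz: "k \<in> {1..m} \<Longrightarrow> k' \<in> {1..m} \<Longrightarrow> i \<in> Ind n \<Longrightarrow> j \<in> Ind n \<Longrightarrow>
      d k i * z k' j = isign i j * (z k' j * d k i) + (if k = k' \<and> i = j then u else 0)"
    and uz: "k \<in> {1..m} \<Longrightarrow> i \<in> Ind n \<Longrightarrow> u * z k i = z k i"
    and zu: "k \<in> {1..m} \<Longrightarrow> i \<in> Ind n \<Longrightarrow> z k i * u = z k i"
    and ud: "k \<in> {1..m} \<Longrightarrow> i \<in> Ind n \<Longrightarrow> u * d k i = d k i"
    and du: "k \<in> {1..m} \<Longrightarrow> i \<in> Ind n \<Longrightarrow> d k i * u = d k i"
begin

definition T :: "int \<Rightarrow> int \<Rightarrow> ('b, 'k) endo" where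
  "T i j = (\<Sum>k = 1..m. z k i * d k j)"

text \<open>\<open>T\<^bsub>i,j\<^esub>\<close> is the superderivation that replaces the second index \<open>j\<close> of a variable by \<open>i\<close>.\<close>

lemma T_z:
  assumes "k \<in> {1..m}" "i \<in> Ind n" "j \<in> Ind n" "r \<in> Ind n"
  shows "T i j * z k r = jsign i j r * (z k r * T i j) + (if j = r then z k i else 0)"
proof -
  have "z a i * d a j * z k r = jsign i j r * (z k r * (z a i * d a j)) +
      (if k = a then if j = r then z a i else 0 else 0)" if a: "a \<in> {1..m}" for a
  proof -
    have "z a i * d a j * z k r = z a i * (isign j r * (z k r * d a j)) +
        (if k = a then if j = r then z a i else 0 else 0)"
      using dz[OF a assms(1,3,4)] zu[OF a assms(2)] by (auto simp: mult.assoc distrib_left)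
    also have "z a i * (isign j r * (z k r * d a j)) = isign j r * (z a i * z k r * d a j)"
      by (simp add: isign_def mult.assoc)
    also have "\<dots> = isign j r * (isign i r * (z k r * (z a i * d a j)))"
      using zz[OF a assms(1,2,4)] by (simp add: mult.assoc)
    also have "\<dots> = jsign i j r * (z k r * (z a i * d a j))"
      by (simp add: isign_def jsign_def)
    finally show ?thesis .
  qed
  then show ?thesis
    unfolding T_def sum_distrib_right sum_distrib_left
    using assms(1) by (simp add: sum.distrib)
qed

lemma T_d:
  assumes "k \<in> {1..m}" "i \<in> Ind n" "j \<in> Ind n" "r \<in> Ind n"
  shows "T i j * d k r = jsign i j r * (d k r * T i j) - (if i = r then jsign i j r * d k j else 0)"
proof -
  have "z a i * d a j * d k r = jsign i j r * (d k r * (z a i * d a j)) -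
      (if k = a then if i = r then jsign i j r * d a j else 0 else 0)" if a: "a \<in> {1..m}" for a
  proof -
    have "z a i * d k r = isign i r * (d k r * z a i - (if k = a \<and> i = r then u else 0))"
      using dz[OF assms(1) a assms(4,2)] by (auto simp: isign_def)
    then have "z a i * d k r * d a j = isign i r * (d k r * (z a i * d a j) -
        (if k = a \<and> i = r then d a j else 0))"
      using ud[OF a assms(3)] by (auto simp: mult.assoc left_diff_distrib)
    moreover have "z a i * d a j * d k r = isign j r * (z a i * d k r * d a j)"
      using dd[OF a assms(1,3,4)] by (simp add: isign_def mult.assoc)
    ultimately show ?thesis
      by (simp add: isign_def jsign_def)
  qed
  then show ?thesis
    unfolding T_def sum_distrib_right sum_distrib_left
    using assms(1) by (simp add: sum_subtractf)
qed

text \<open>\<open>T\<^bsub>i,j\<^esub>\<close> acts on both factors of each summand of \<open>T\<^bsub>k,l\<^esub>\<close>; the two correction terms of \<open>T_z\<close> and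
  \<open>T_d\<close> are the two terms of the supercommutator.\<close>

lemma T_gl_rep: "gl_rep n T"
proof
  fix i j k l assume I: "i \<in> Ind n" "j \<in> Ind n" "k \<in> Ind n" "l \<in> Ind n"
  have "T i j * (z a k * d a l) = jsign i j k * (jsign i j l * (z a k * d a l * T i j)) -
      (if l = i then jsign i j k * (jsign i j l * (z a k * d a j)) else 0) +
      (if j = k then z a i * d a l else 0)" if a: "a \<in> {1..m}" for a
  proof -
    have "T i j * (z a k * d a l) = jsign i j k * (z a k * (T i j * d a l)) +
        (if j = k then z a i * d a l else 0)"
      using T_z[OF a I(1,2,3)] by (simp add: mult.assoc[symmetric] distrib_right)
    also have "z a k * (T i j * d a l) = jsign i j l * (z a k * d a l * T i j) -
        (if l = i then jsign i j l * (z a k * d a j) else 0)"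
      unfolding T_d[OF a I(1,2,4)] by (auto simp: jsign_def mult.assoc right_diff_distrib)
    finally show ?thesis by (auto simp: right_diff_distrib)
  qed
  then have "T i j * T k l = (\<Sum>a = 1..m. jsign i j k * (jsign i j l * (z a k * d a l * T i j)) -
      (if l = i then jsign i j k * (jsign i j l * (z a k * d a j)) else 0) +
      (if j = k then z a i * d a l else 0))"
    unfolding T_def[of k l] sum_distrib_left by (intro sum.cong refl)
  also have "\<dots> = jsign i j k * (jsign i j l * (T k l * T i j)) -
      (if l = i then jsign i j k * (jsign i j l * T k j) else 0) + (if j = k then T i l else 0)"
    unfolding T_def[of k l] T_def[of k j] T_def[of i l]
    by (auto simp: sum.distrib sum_subtractf sum_distrib_left sum_distrib_right)
  finally show "T i j * T k l =
      (if (i < 0) \<noteq> (j < 0) \<and> (k < 0) \<noteq> (l < 0) then - (T k l * T i j) else T k l * T i j) +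
      (if j = k then T i l else 0) -
      (if l = i then (if (i < 0) \<noteq> (j < 0) \<and> (k < 0) \<noteq> (l < 0) then - T k j else T k j) else 0)"
    by (auto simp: jsign_def)
qed

sublocale gl_rep n T by (rule T_gl_rep)

text \<open>Contractions over the index in \<open>I\<^bsub>n|n\<^esub>\<close>. The first is invariant under \<open>\<gg>\<ll>(n|n)\<close>; the other two
  contract with the odd bilinear form that pairs \<open>r\<close> with \<open>-r\<close>, and are invariant under \<open>\<pp>(n)\<close>
  only. For a single \<open>T\<^bsub>a,b\<^esub>\<close> there remain two correction terms, which cancel in the
  combinations \<open>elA\<close>, \<open>elB\<close> and \<open>elC\<close>.\<close>

definition Euler :: "nat \<Rightarrow> nat \<Rightarrow> ('b, 'k) endo" where
  "Euler i j = (\<Sum>r\<in>Ind n. z i r * d j r)"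
definition Laplace :: "nat \<Rightarrow> nat \<Rightarrow> ('b, 'k) endo" where
  "Laplace i j = (\<Sum>r\<in>Ind n. d i r * d j (- r))"
definition Form :: "nat \<Rightarrow> nat \<Rightarrow> ('b, 'k) endo" where
  "Form i j = (\<Sum>r\<in>Ind n. (if r < 0 then - 1 else 1) * (z i r * z j (- r)))"

definition esign :: "int \<Rightarrow> int \<Rightarrow> ('b, 'k) endo" where
  "esign a b = (if (a < 0) \<noteq> (b < 0) then - 1 else 1)"

context
  fixes i j :: nat and a b :: int
  assumes ij: "i \<in> {1..m}" "j \<in> {1..m}" and ab: "a \<in> Ind n" "b \<in> Ind n"
begin

lemma ab_uminus: "- a \<in> Ind n" "- b \<in> Ind n"
  using ab by (simp_all add: Ind_uminus)

lemma ab_zero: "a \<noteq> 0" "b \<noteq> 0"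
  using ab zero_notin_Ind by metis+

lemma T_Euler: "T a b * Euler i j = Euler i j * T a b"
proof -
  have "T a b * (z i r * d j r) = z i r * d j r * T a b -
      (if a = r then z i a * d j b else 0) + (if b = r then z i a * d j b else 0)"
    if r: "r \<in> Ind n" for r
  proof -
    have "T a b * (z i r * d j r) = jsign a b r * (z i r * (T a b * d j r)) +
        (if b = r then z i a * d j r else 0)"
      using T_z[OF ij(1) ab r] by (simp add: mult.assoc[symmetric] distrib_right)
    also have "z i r * (T a b * d j r) = jsign a b r * (z i r * d j r * T a b) -
        (if a = r then jsign a b r * (z i r * d j b) else 0)"
      unfolding T_d[OF ij(2) ab r] by (auto simp: jsign_def mult.assoc right_diff_distrib)
    finally have *: "T a b * (z i r * d j r) = jsign a b r * (jsign a b r * (z i r * d j r * T a b) -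
        (if a = r then jsign a b r * (z i r * d j b) else 0)) + (if b = r then z i a * d j r else 0)" .
    have sq: "jsign p q r * (jsign p q r * x) = x" for p q r and x :: "('b, 'k) endo"
      by (simp add: jsign_def)
    show ?thesis unfolding * by (cases "a = r"; cases "b = r") (simp_all add: right_diff_distrib sq)
  qed
  then have "T a b * Euler i j = (\<Sum>r\<in>Ind n. z i r * d j r * T a b -
      (if a = r then z i a * d j b else 0) + (if b = r then z i a * d j b else 0))"
    unfolding Euler_def sum_distrib_left by (intro sum.cong refl)
  also have "\<dots> = Euler i j * T a b"
    using ab by (simp add: Euler_def sum.distrib sum_subtractf sum_distrib_right finite_Ind)
  finally show ?thesis .
qed

lemma T_Laplace: "T a b * Laplace i j = esign a b * (Laplace i j * T a b) -
    esign a b * (d i (- a) * d j b) - jsign a b a * (d i b * d j (- a))"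
proof -
  have "T a b * (d i r * d j (- r)) = esign a b * (d i r * d j (- r) * T a b) -
      (if r = - a then esign a b * (d i (- a) * d j b) else 0) -
      (if r = a then jsign a b a * (d i b * d j (- a)) else 0)"
    if r: "r \<in> Ind n" for r
  proof -
    have r0: "r \<noteq> 0" using r zero_notin_Ind by metis
    have r': "- r \<in> Ind n" using r by (simp add: Ind_uminus)
    have "T a b * (d i r * d j (- r)) = jsign a b r * (d i r * (T a b * d j (- r))) -
        (if a = r then jsign a b r * (d i b * d j (- r)) else 0)"
      using T_d[OF ij(1) ab r] by (simp add: mult.assoc[symmetric] left_diff_distrib)
    also have "d i r * (T a b * d j (- r)) = jsign a b (- r) * (d i r * d j (- r) * T a b) -
        (if a = - r then jsign a b (- r) * (d i r * d j b) else 0)"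
      unfolding T_d[OF ij(2) ab r'] by (auto simp: jsign_def mult.assoc right_diff_distrib)
    finally have *: "T a b * (d i r * d j (- r)) =
        jsign a b r * (jsign a b (- r) * (d i r * d j (- r) * T a b) -
          (if a = - r then jsign a b (- r) * (d i r * d j b) else 0)) -
        (if a = r then jsign a b r * (d i b * d j (- r)) else 0)" .
    show ?thesis unfolding * using r0 by (auto simp: jsign_def esign_def)
  qed
  then have "T a b * Laplace i j = (\<Sum>r\<in>Ind n. esign a b * (d i r * d j (- r) * T a b) -
      (if r = - a then esign a b * (d i (- a) * d j b) else 0) -
      (if r = a then jsign a b a * (d i b * d j (- a)) else 0))"
    unfolding Laplace_def sum_distrib_left by (intro sum.cong refl)
  also have "\<dots> = esign a b * (Laplace i j * T a b) -
      esign a b * (d i (- a) * d j b) - jsign a b a * (d i b * d j (- a))"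
    using ab ab_uminus by (simp add: Laplace_def sum_subtractf sum_distrib_right sum_distrib_left finite_Ind)
  finally show ?thesis .
qed

lemma T_Form: "T a b * Form i j = esign a b * (Form i j * T a b) +
    (if b < 0 then - 1 else 1) * (z i a * z j (- b)) +
    (if b < 0 then 1 else - 1) * (jsign a b (- b) * (z i (- b) * z j a))"
proof -
  let ?s = "\<lambda>r :: int. if r < 0 then - 1 else 1 :: ('b, 'k) endo"
  have "T a b * (?s r * (z i r * z j (- r))) = esign a b * (?s r * (z i r * z j (- r)) * T a b) +
      (if r = b then ?s b * (z i a * z j (- b)) else 0) +
      (if r = - b then (if b < 0 then 1 else - 1) * (jsign a b (- b) * (z i (- b) * z j a)) else 0)"
    if r: "r \<in> Ind n" for r
  proof -
    have r0: "r \<noteq> 0" using r zero_notin_Ind by metis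
    have r': "- r \<in> Ind n" using r by (simp add: Ind_uminus)
    have "T a b * (z i r * z j (- r)) = jsign a b r * (z i r * (T a b * z j (- r))) +
        (if b = r then z i a * z j (- r) else 0)"
      using T_z[OF ij(1) ab r] by (simp add: mult.assoc[symmetric] distrib_right)
    also have "z i r * (T a b * z j (- r)) = jsign a b (- r) * (z i r * z j (- r) * T a b) +
        (if b = - r then z i r * z j a else 0)"
      unfolding T_z[OF ij(2) ab r'] by (auto simp: jsign_def mult.assoc distrib_left)
    finally have "T a b * (z i r * z j (- r)) =
        jsign a b r * (jsign a b (- r) * (z i r * z j (- r) * T a b) +
          (if b = - r then z i r * z j a else 0)) +
        (if b = r then z i a * z j (- r) else 0)" .
    then have *: "T a b * (?s r * (z i r * z j (- r))) =
        ?s r * (jsign a b r * (jsign a b (- r) * (z i r * z j (- r) * T a b) +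
          (if b = - r then z i r * z j a else 0)) +
        (if b = r then z i a * z j (- r) else 0))"
      by (cases "r < 0") simp_all
    show ?thesis unfolding * using r0 ab_zero by (auto simp: jsign_def esign_def)
  qed
  then have "T a b * Form i j = (\<Sum>r\<in>Ind n. esign a b * (?s r * (z i r * z j (- r)) * T a b) +
      (if r = b then ?s b * (z i a * z j (- b)) else 0) +
      (if r = - b then (if b < 0 then 1 else - 1) * (jsign a b (- b) * (z i (- b) * z j a)) else 0))"
    unfolding Form_def sum_distrib_left by (intro sum.cong refl)
  also have "\<dots> = esign a b * (Form i j * T a b) + ?s b * (z i a * z j (- b)) +
      (if b < 0 then 1 else - 1) * (jsign a b (- b) * (z i (- b) * z j a))"
    using ab ab_uminus by (simp add: Form_def sum.distrib sum_distrib_right sum_distrib_left finite_Ind mult.assoc)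
  finally show ?thesis .
qed

end

context
  fixes i j :: nat and k l :: nat
  assumes ij: "i \<in> {1..m}" "j \<in> {1..m}" and kl: "k \<in> {1..n}" "l \<in> {1..n}"
begin

lemmas kl_Ind = Ind_int(1)[OF kl(1)] Ind_int(1)[OF kl(2)] Ind_int(2)[OF kl(1)] Ind_int(2)[OF kl(2)]

lemma kl_pos: "0 < k" "0 < l" using kl by auto

lemma invariants_elA:
  "elA k l * Euler i j = Euler i j * elA k l"
  "elA k l * Laplace i j = Laplace i j * elA k l"
  "elA k l * Form i j = Form i j * elA k l"
  unfolding elA_def left_diff_distrib right_diff_distrib T_Euler[OF ij kl_Ind(1,2)] T_Euler[OF ij kl_Ind(4,3)]
    T_Laplace[OF ij kl_Ind(1,2)] T_Laplace[OF ij kl_Ind(4,3)] T_Form[OF ij kl_Ind(1,2)] T_Form[OF ij kl_Ind(4,3)]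
  using kl_pos by (simp_all add: esign_def jsign_def)

lemma invariants_elB:
  "elB k l * Euler i j = Euler i j * elB k l"
  "elB k l * Laplace i j = - (Laplace i j * elB k l)"
  "elB k l * Form i j = - (Form i j * elB k l)"
  unfolding elB_def distrib_right distrib_left T_Euler[OF ij kl_Ind(1,4)] T_Euler[OF ij kl_Ind(2,3)]
    T_Laplace[OF ij kl_Ind(1,4)] T_Laplace[OF ij kl_Ind(2,3)] T_Form[OF ij kl_Ind(1,4)] T_Form[OF ij kl_Ind(2,3)]
  using kl_pos by (simp_all add: esign_def jsign_def)

lemma invariants_elC:
  "elC k l * Euler i j = Euler i j * elC k l"
  "elC k l * Laplace i j = - (Laplace i j * elC k l)"
  "elC k l * Form i j = - (Form i j * elC k l)"
  unfolding elC_def left_diff_distrib right_diff_distrib T_Euler[OF ij kl_Ind(3,2)] T_Euler[OF ij kl_Ind(4,1)]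
    T_Laplace[OF ij kl_Ind(3,2)] T_Laplace[OF ij kl_Ind(4,1)] T_Form[OF ij kl_Ind(3,2)] T_Form[OF ij kl_Ind(4,1)]
  using kl_pos by (simp_all add: esign_def jsign_def)

end

end

text \<open>The exchange of odd variables and odd derivations. The indices are rearranged so that the
  second index \<open>l > 0\<close> of the old generators becomes the first index of the new ones; the
  parity is kept.\<close>

definition dual_z :: "(nat \<Rightarrow> int \<Rightarrow> 'r) \<Rightarrow> (nat \<Rightarrow> int \<Rightarrow> 'r) \<Rightarrow> nat \<Rightarrow> int \<Rightarrow> 'r" where
  "dual_z z d l k = (if 0 < k then z (nat k) (int l) else d (nat (- k)) (- int l))"

definition dual_d :: "(nat \<Rightarrow> int \<Rightarrow> 'r) \<Rightarrow> (nat \<Rightarrow> int \<Rightarrow> 'r) \<Rightarrow> nat \<Rightarrow> int \<Rightarrow> 'r" where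
  "dual_d z d l k = (if 0 < k then d (nat k) (int l) else z (nat (- k)) (- int l))"

lemma dual_simps:
  "0 < k \<Longrightarrow> dual_z z d l (int k) = z k (int l)"
  "0 < k \<Longrightarrow> dual_z z d l (- int k) = d k (- int l)"
  "0 < k \<Longrightarrow> dual_d z d l (int k) = d k (int l)"
  "0 < k \<Longrightarrow> dual_d z d l (- int k) = z k (- int l)"
  by (simp_all add: dual_z_def dual_d_def)

lemma dual_dual:
  assumes "k \<in> {1..m}" "j \<in> Ind n"
  shows "dual_z (dual_z z d) (dual_d z d) k j = z k j" "dual_d (dual_z z d) (dual_d z d) k j = d k j"
proof -
  have "dual_z (dual_z z d) (dual_d z d) k j = z k j \<and> dual_d (dual_z z d) (dual_d z d) k j = d k j"
    using assms(2,1) by (cases rule: Ind_cases) (simp_all add: dual_simps)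
  then show "dual_z (dual_z z d) (dual_d z d) k j = z k j" "dual_d (dual_z z d) (dual_d z d) k j = d k j"
    by auto
qed

context super_weyl
begin

text \<open>The relation \<open>\<partial> z + z \<partial> = u\<close> between an odd variable and its derivation is symmetric, and
  generators with different labels supercommute, so the rules are preserved.\<close>

lemma dual: "super_weyl n m u (dual_z z d) (dual_d z d)"
proof -
  have zd: "z k' j * d k i = isign i j * (d k i * z k' j) - (if k = k' \<and> i = j then isign i j * u else 0)"
    if "k \<in> {1..m}" "k' \<in> {1..m}" "i \<in> Ind n" "j \<in> Ind n" for k k' i j
    using dz[OF that] by (auto simp: isign_def)
  have rel: "dual_z z d k i * dual_z z d k' j = isign i j * (dual_z z d k' j * dual_z z d k i) \<and>
      dual_d z d k i * dual_d z d k' j = isign i j * (dual_d z d k' j * dual_d z d k i) \<and>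
      dual_d z d k i * dual_z z d k' j = isign i j * (dual_z z d k' j * dual_d z d k i) +
        (if k = k' \<and> i = j then u else 0) \<and>
      u * dual_z z d k i = dual_z z d k i \<and> dual_z z d k i * u = dual_z z d k i \<and>
      u * dual_d z d k i = dual_d z d k i \<and> dual_d z d k i * u = dual_d z d k i"
    if k: "k \<in> {1..n}" "k' \<in> {1..n}" and ij: "i \<in> Ind m" "j \<in> Ind m" for k k' i j
  proof -
    note Ik = Ind_int(1)[OF k(1)] Ind_int(2)[OF k(1)] Ind_int(1)[OF k(2)] Ind_int(2)[OF k(2)]
    have kpos: "0 < k" "0 < k'" using k by auto
    obtain l where l: "l \<in> {1..m}" "i = int l \<or> i = - int l" using ij(1) by (cases rule: Ind_cases) auto
    obtain l' where l': "l' \<in> {1..m}" "j = int l' \<or> j = - int l'" using ij(2) by (cases rule: Ind_cases) auto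
    have lpos: "0 < l" "0 < l'" using l l' by auto
    from l(2) l'(2) kpos lpos show ?thesis
      using uz[OF l(1) Ik(1)] zu[OF l(1) Ik(1)] ud[OF l(1) Ik(1)] du[OF l(1) Ik(1)]
        uz[OF l(1) Ik(2)] zu[OF l(1) Ik(2)] ud[OF l(1) Ik(2)] du[OF l(1) Ik(2)]
      by (elim disjE; simp add: dual_simps isign_def
          zz[OF l(1) l'(1) Ik(1,3)] dd[OF l(1) l'(1) Ik(1,3)] dz[OF l(1) l'(1) Ik(1,3)]
          zz[OF l(1) l'(1) Ik(2,4)] dd[OF l(1) l'(1) Ik(2,4)] zd[OF l'(1) l(1) Ik(4,2)]
          dz[OF l(1) l'(1) Ik(1,4)] dz[OF l(1) l'(1) Ik(2,3)]
          dz[OF l'(1) l(1) Ik(3,2)] dz[OF l'(1) l(1) Ik(4,1)]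
          zz[OF l(1) l'(1) Ik(1,4)] zz[OF l(1) l'(1) Ik(2,3)]
          dd[OF l(1) l'(1) Ik(1,4)] dd[OF l(1) l'(1) Ik(2,3)]; auto)
  qed
  show ?thesis
    by unfold_locales (use rel in blast)+
qed

end

definition op_p :: "nat \<Rightarrow> (nat \<Rightarrow> int \<Rightarrow> ('b, 'k) endo) \<Rightarrow> (nat \<Rightarrow> int \<Rightarrow> ('b, 'k) endo) \<Rightarrow>
    gen \<Rightarrow> ('b, 'k::field_char_0) endo" where
  "op_p m z d = gl_rep.periplectic_gen (super_weyl.T m z d)"

definition op_pt :: "nat \<Rightarrow> (nat \<Rightarrow> int \<Rightarrow> ('b, 'k) endo) \<Rightarrow> (nat \<Rightarrow> int \<Rightarrow> ('b, 'k) endo) \<Rightarrow>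
    gen \<Rightarrow> ('b, 'k::field_char_0) endo" where
  "op_pt m z d = gl_rep.tilde_periplectic_gen (super_weyl.T m z d)"

lemma sign_commute_scalar:
  fixes f g :: "('b, 'k::field) endo"
  assumes "sign_commute p q (scalar c * f) g" "c \<noteq> 0"
  shows "sign_commute p q f g"
proof -
  have s: "scalar (1/c) * (scalar c * h) = h" for h :: "('b, 'k) endo"
    using assms(2) by (simp add: mult.assoc[symmetric] scalar_mult[symmetric])
  have "scalar c * (f * g) = scalar (ksign (p * q)) * (scalar c * (g * f))"
    using assms(1) by (simp add: sign_commute_def mult.assoc scalar_left_commute[of g])
  then have "scalar (1/c) * (scalar c * (f * g)) = scalar (1/c) * (scalar (ksign (p * q)) * (scalar c * (g * f)))"
    by (rule arg_cong)
  then show ?thesis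
    unfolding sign_commute_def scalar_left_commute[of "scalar c" "ksign (p * q)", symmetric] s .
qed

context super_weyl
begin

text \<open>In the dual operators \<open>T\<close> the sum runs over the former second index \<open>l > 0\<close>. Two of these sums
  combine to a contraction over \<open>I\<^bsub>n|n\<^esub>\<close>, once the factors are put into the right order; for this
  one uses that \<open>z\<^bsub>i,-l\<^esub>\<close> and \<open>\<partial>\<^bsub>j,-l\<^esub>\<close> anticommute for \<open>i \<noteq> j\<close>. In \<open>Laplace 1 1\<close> every term occurs
  twice.\<close>

lemma dual_gens:
  assumes "h \<in> gens m" "1 \<le> m"
  shows "op_pt n (dual_z z d) (dual_d z d) h = (case h of
     GE i \<Rightarrow> Euler i (i + 1) | GF i \<Rightarrow> Euler (i + 1) i | GB11 \<Rightarrow> scalar (1/2) * Laplace 1 1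
   | GB i \<Rightarrow> Laplace i (i + 1) | GC i \<Rightarrow> Form i (i + 1))"
proof -
  interpret dual: super_weyl n m u "dual_z z d" "dual_d z d" by (rule dual)
  have E: "dual.elA i j = Euler i j" if "i \<in> {1..m}" "j \<in> {1..m}" "i \<noteq> j" for i j
  proof -
    have "d j (- int l) * z i (- int l) = - (z i (- int l) * d j (- int l))" if "l \<in> {1..n}" for l
      using dz[OF \<open>j \<in> _\<close> \<open>i \<in> _\<close> Ind_int(2)[OF that] Ind_int(2)[OF that]] that \<open>i \<noteq> j\<close>
      by (simp add: isign_def)
    then show ?thesis
      using that by (simp add: dual.elA_def dual.T_def Euler_def sum_Ind dual_simps sum.distrib sum_negf)
  qed
  have L: "dual.T (- int i) (int j) + dual.T (- int j) (int i) = Laplace i j"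
    if "i \<in> {1..m}" "j \<in> {1..m}" for i j
  proof -
    have "d j (- int l) * d i (int l) = d i (int l) * d j (- int l)" if "l \<in> {1..n}" for l
      using dd[OF \<open>j \<in> _\<close> \<open>i \<in> _\<close> Ind_int(2)[OF that] Ind_int(1)[OF that]]
      by (simp add: isign_def)
    then show ?thesis
      using that by (simp add: dual.T_def Laplace_def sum_Ind dual_simps sum.distrib)
  qed
  have F: "dual.T (int i) (- int j) - dual.T (int j) (- int i) = Form i j"
    if "i \<in> {1..m}" "j \<in> {1..m}" for i j
  proof -
    have "z j (int l) * z i (- int l) = z i (- int l) * z j (int l)" if "l \<in> {1..n}" for l
      using zz[OF \<open>j \<in> _\<close> \<open>i \<in> _\<close> Ind_int(1)[OF that] Ind_int(2)[OF that]]
      by (simp add: isign_def)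
    then show ?thesis
      using that by (simp add: dual.T_def Form_def sum_Ind dual_simps sum_subtractf)
  qed
  have half: "scalar (1/2) * (f + f) = f" for f :: "('b, 'k) endo"
    by (simp add: distrib_left distrib_right[symmetric] scalar_add[symmetric])
  show ?thesis
  proof (cases h)
    case GB11
    have "dual.T (- 1) 1 = scalar (1/2) * Laplace 1 1"
      using L[of 1 1] assms(2) half[of "dual.T (- 1) 1"] by simp
    then show ?thesis using GB11 by (simp add: op_pt_def dual.tilde_periplectic_gen_def)
  next
    case (GE i)
    show ?thesis unfolding op_pt_def dual.tilde_periplectic_gen_def GE gen.case
      by (intro E) (use assms GE in \<open>auto simp: gens_def\<close>)
  next
    case (GF i)
    show ?thesis unfolding op_pt_def dual.tilde_periplectic_gen_def GF gen.case
      by (intro E) (use assms GF in \<open>auto simp: gens_def\<close>)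
  next
    case (GB i)
    show ?thesis unfolding op_pt_def dual.tilde_periplectic_gen_def GB gen.case
      by (intro L) (use assms GB in \<open>auto simp: gens_def\<close>)
  next
    case (GC i)
    show ?thesis unfolding op_pt_def dual.tilde_periplectic_gen_def GC gen.case
      by (intro F) (use assms GC in \<open>auto simp: gens_def\<close>)
  qed
qed

lemma op_p_gens: "scalar 2 * op_p m z d GB11 = elB 1 1" "op_p m z d = periplectic_gen"
  by (simp_all only: op_p_def periplectic_gen_def elB_11 gen.case)

text \<open>Supercommutation is first obtained for \<open>elB 1 1\<close> and \<open>Laplace 1 1\<close>, which are twice the
  generators \<open>B\<^bsub>1,1\<^esub>\<close> of the two algebras; the factor \<open>2\<close> is then cancelled.\<close>

lemma supercommute_gens:
  assumes "g \<in> gens n" "h \<in> gens m" "1 \<le> m" "1 \<le> n"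
  shows "sign_commute (gpar g) (gpar h) (op_p m z d g) (op_pt n (dual_z z d) (dual_d z d) h)"
proof -
  have L11: "scalar 2 * op_pt n (dual_z z d) (dual_d z d) GB11 = Laplace 1 1"
    using dual_gens[of GB11] assms(3) by (simp add: gens_def mult.assoc[symmetric] scalar_mult[symmetric])
  have main: "sign_commute (gpar g) (gpar h) f f'"
    if "f = op_p m z d g \<or> g = GB11 \<and> f = elB 1 1"
       "f' = op_pt n (dual_z z d) (dual_d z d) h \<and> h \<noteq> GB11 \<or> h = GB11 \<and> f' = Laplace 1 1" "g = GB11 \<longrightarrow> f = elB 1 1" for f f'
    using that assms dual_gens[OF assms(2,3)]
    by (cases g; cases h) (auto simp: sign_commute_def ksign_def scalar_uminus gens_def op_p_gens periplectic_gen_def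
        invariants_elA invariants_elB invariants_elC)
  have "sign_commute (gpar g) (gpar h) (op_p m z d g) f'"
    if "f' = op_pt n (dual_z z d) (dual_d z d) h \<and> h \<noteq> GB11 \<or> h = GB11 \<and> f' = Laplace 1 1" for f'
    using main[of "op_p m z d g" f'] main[of "elB 1 1" f'] that
      sign_commute_scalar[of "gpar g" "gpar h" 2 "op_p m z d g" f'] op_p_gens(1)
    by (cases "g = GB11") auto
  then have *: "sign_commute (gpar h) (gpar g) f' (op_p m z d g)"
    if "f' = op_pt n (dual_z z d) (dual_d z d) h \<and> h \<noteq> GB11 \<or> h = GB11 \<and> f' = Laplace 1 1" for f'
    using that sign_commute_sym by blast
  show ?thesis
    using *[of "op_pt n (dual_z z d) (dual_d z d) h"] *[of "Laplace 1 1"] L11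
      sign_commute_scalar[of "gpar h" "gpar g" 2 "op_pt n (dual_z z d) (dual_d z d) h" "op_p m z d g"]
    by (cases "h = GB11") (auto intro: sign_commute_sym)
qed

end

section \<open>Weight spaces\<close>

definition var_weight :: "int \<Rightarrow> weight" where
  "var_weight j = Poly_Mapping.single (nat \<bar>j\<bar>) (sgn j)"

text \<open>The eigenvalues of the diagonal elements enter only through differences. This is why weights may
  be shifted by multiples of \<open>\<delta>\<close>.\<close>

locale periplectic_weights = super_weyl m n u z d
  for m n :: nat and u :: "('b, 'k::field_char_0) endo" and z d :: "nat \<Rightarrow> int \<Rightarrow> ('b, 'k) endo" +
  fixes M :: "'b sspace" and P :: "weight \<Rightarrow> ('b, 'k) endo"
  assumes u: "u = restr M"
    and z_homog: "k \<in> {1..m} \<Longrightarrow> j \<in> Ind n \<Longrightarrow> homog M (ipar j) (z k j)"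
    and d_homog: "k \<in> {1..m} \<Longrightarrow> j \<in> Ind n \<Longrightarrow> homog M (ipar j) (d k j)"
    and z_weight: "k \<in> {1..m} \<Longrightarrow> j \<in> Ind n \<Longrightarrow> z k j * P \<mu> = P (\<mu> + var_weight j) * z k j"
    and d_weight: "k \<in> {1..m} \<Longrightarrow> j \<in> Ind n \<Longrightarrow> d k j * P \<mu> = P (\<mu> - var_weight j) * d k j"
    and P_restr: "restr M * P \<mu> = P \<mu> * restr M"
    and P_homog: "homog M 0 (P \<mu>)"
    and P_mult: "P \<mu> * P \<nu> = (if \<mu> = \<nu> then P \<mu> else 0)"
    and P_sum: "v \<in> vecs M \<Longrightarrow> \<exists>S. finite S \<and> S \<subseteq> Xwt n \<and> (\<Sum>\<mu>\<in>S. app (P \<mu>) v) = v"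
    and cartan: "k \<in> {1..n} \<Longrightarrow> l \<in> {1..n} \<Longrightarrow>
      (elA k k - elA l l) * P \<mu> = scalar (of_int (lookup \<mu> k - lookup \<mu> l)) * P \<mu>"
    and n_pos: "1 \<le> n"
begin

lemma homog_add: "homog M p f \<Longrightarrow> homog M p g \<Longrightarrow> homog M p (f + g)"
  by (simp add: homog_def distrib_left distrib_right)

lemma homog_diff: "homog M p f \<Longrightarrow> homog M p g \<Longrightarrow> homog M p (f - g)"
  by (simp add: homog_def right_diff_distrib left_diff_distrib)

lemma homog_sum: "(\<And>a. a \<in> A \<Longrightarrow> homog M p (f a)) \<Longrightarrow> homog M p (sum f A)"
  by (simp add: homog_def sum_distrib_left sum_distrib_right)

lemma T_homog:
  assumes "i \<in> Ind n" "j \<in> Ind n"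
  shows "homog M (ipar i + ipar j) (T i j)"
  unfolding T_def by (intro homog_sum homog_mult z_homog d_homog assms)

lemma T_restr:
  assumes "i \<in> Ind n" "j \<in> Ind n"
  shows "restr M * T i j = T i j" "T i j * restr M = T i j"
  using assms uz du
  by (simp_all add: T_def sum_distrib_left sum_distrib_right u[symmetric] mult.assoc mult.assoc[symmetric, of u])

lemma T_weight:
  assumes "i \<in> Ind n" "j \<in> Ind n"
  shows "T i j * P \<mu> = P (\<mu> + (var_weight i - var_weight j)) * T i j"
proof -
  have "z k i * d k j * P \<mu> = P (\<mu> + (var_weight i - var_weight j)) * (z k i * d k j)" if k: "k \<in> {1..m}" for k
  proof -
    have "z k i * d k j * P \<mu> = z k i * P (\<mu> - var_weight j) * d k j"
      by (simp add: mult.assoc d_weight[OF k assms(2)])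
    also have "\<dots> = P (\<mu> - var_weight j + var_weight i) * (z k i * d k j)"
      by (simp add: mult.assoc z_weight[OF k assms(1)])
    also have "\<mu> - var_weight j + var_weight i = \<mu> + (var_weight i - var_weight j)" by simp
    finally show ?thesis .
  qed
  then show ?thesis by (simp add: T_def sum_distrib_left sum_distrib_right)
qed

lemma var_weight_int:
  "0 < k \<Longrightarrow> var_weight (int k) = eps k" "0 < k \<Longrightarrow> var_weight (- int k) = - eps k"
  "0 < k \<Longrightarrow> ipar (int k) = 0" "0 < k \<Longrightarrow> ipar (- int k) = 1"
  by (simp_all add: var_weight_def eps_def ipar_def single_uminus)

text \<open>All generators act as combinations of operators \<open>T i j\<close> of the same parity and weight.\<close>

definition "bihomog p \<nu> f \<longleftrightarrow> homog M p f \<and> restr M * f = f * restr M \<and> (\<forall>\<mu>. f * P \<mu> = P (\<mu> + \<nu>) * f)"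

lemma bihomog_T:
  assumes "i \<in> Ind n" "j \<in> Ind n" "p = ipar i + ipar j" "\<nu> = var_weight i - var_weight j"
  shows "bihomog p \<nu> (T i j)"
  unfolding bihomog_def assms(3,4) using T_homog T_restr T_weight assms(1,2) by metis

lemma bihomog_add: "bihomog p \<nu> f \<Longrightarrow> bihomog p \<nu> g \<Longrightarrow> bihomog p \<nu> (f + g)"
  unfolding bihomog_def by (simp add: homog_add distrib_left distrib_right)

lemma bihomog_diff: "bihomog p \<nu> f \<Longrightarrow> bihomog p \<nu> g \<Longrightarrow> bihomog p \<nu> (f - g)"
  unfolding bihomog_def by (simp add: homog_diff left_diff_distrib right_diff_distrib)

lemma bihomog_elements:
  assumes k: "k \<in> {1..n}" and l: "l \<in> {1..n}"
  shows "bihomog 0 (eps k - eps l) (elA k l)"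
    and "bihomog 1 (eps k + eps l) (elB k l)"
    and "bihomog 1 (- (eps k + eps l)) (elC k l)"
    and "bihomog 1 (- (eps k + eps l)) (T (- int k) (int l) + T (- int l) (int k))"
    and "bihomog 1 (eps k + eps l) (T (int k) (- int l) - T (int l) (- int k))"
proof -
  note I = Ind_int(1)[OF k] Ind_int(1)[OF l] Ind_int(2)[OF k] Ind_int(2)[OF l]
  have kl: "0 < k" "0 < l" using k l by auto
  note w = var_weight_int[OF kl(1)] var_weight_int[OF kl(2)]
  show "bihomog 0 (eps k - eps l) (elA k l)" "bihomog 1 (eps k + eps l) (elB k l)"
    "bihomog 1 (- (eps k + eps l)) (elC k l)"
    unfolding elA_def elB_def elC_def
    by (intro bihomog_add bihomog_diff bihomog_T I; simp add: w)+
  show "bihomog 1 (- (eps k + eps l)) (T (- int k) (int l) + T (- int l) (int k))"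
    "bihomog 1 (eps k + eps l) (T (int k) (- int l) - T (int l) (- int k))"
    by (intro bihomog_add bihomog_diff bihomog_T I; simp add: w)+
qed

lemma bihomog_B11: "bihomog 1 (eps 1 + eps 1) (T 1 (- 1))" "bihomog 1 (- (eps 1 + eps 1)) (T (- 1) 1)"
  using n_pos var_weight_int[of 1] by (auto intro!: bihomog_T simp: Ind_def)

lemma bihomog_periplectic_gen:
  assumes "g \<in> gens n"
  shows "bihomog (gpar g) (wt_p g) (periplectic_gen g)"
proof -
  have range: "i \<in> {1..<n} \<Longrightarrow> i \<in> {1..n} \<and> i + 1 \<in> {1..n}" for i by auto
  have neg: "- (eps i - eps j) = eps j - eps i" for i j by simp
  show ?thesis
    using assms range unfolding gens_def
    by (auto simp only: periplectic_gen_def gen.case wt_p.simps gpar.simps alpha_def beta_def neg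
        intro!: bihomog_elements bihomog_B11)
qed

lemma bihomog_tilde_periplectic_gen:
  assumes "g \<in> gens n"
  shows "bihomog (gpar g) (wt_pt g) (tilde_periplectic_gen g)"
proof -
  have range: "i \<in> {1..<n} \<Longrightarrow> i \<in> {1..n} \<and> i + 1 \<in> {1..n}" for i by auto
  have neg: "- (eps i - eps j) = eps j - eps i" for i j by simp
  show ?thesis
    using assms range unfolding gens_def
    by (auto simp only: tilde_periplectic_gen_def gen.case wt_pt.simps gpar.simps alpha_def beta_def neg
        intro!: bihomog_elements bihomog_B11)
qed

lemma presented_rep_p: "presented_rep (Xwt n) (gens n) wt_p gpar (rels_p n) M P (op_p m z d)"
  unfolding op_p_def
proof
  fix g assume "g \<in> gens n"
  from bihomog_periplectic_gen[OF this]
  show "restr M * periplectic_gen g = periplectic_gen g * restr M"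
    "homog M (gpar g) (periplectic_gen g)" "periplectic_gen g * P \<mu> = P (\<mu> + wt_p g) * periplectic_gen g" for \<mu>
    unfolding bihomog_def by blast+
next
  fix r :: "gen list \<Rightarrow>\<^sub>0 'k" and \<mu> assume r: "r \<in> rels_p n \<mu>"
  show "keys r \<subseteq> lists (gens n)" using rels_p_words[OF r] by (simp add: words_in_def)
  show "word_op periplectic_gen r * P \<mu> = 0"
    by (rule relations_vanish[OF cartan n_pos r])
qed (rule P_restr P_homog P_mult P_sum; assumption)+

lemma presented_rep_pt: "presented_rep (Xwt n) (gens n) wt_pt gpar (rels_pt n) M P (op_pt m z d)"
  unfolding op_pt_def
proof
  fix g assume "g \<in> gens n"
  from bihomog_tilde_periplectic_gen[OF this]
  show "restr M * tilde_periplectic_gen g = tilde_periplectic_gen g * restr M"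
    "homog M (gpar g) (tilde_periplectic_gen g)"
    "tilde_periplectic_gen g * P \<mu> = P (\<mu> + wt_pt g) * tilde_periplectic_gen g" for \<mu>
    unfolding bihomog_def by blast+
next
  fix r :: "gen list \<Rightarrow>\<^sub>0 'k" and \<mu> assume r: "r \<in> rels_pt n \<mu>"
  show "keys r \<subseteq> lists (gens n)" using rels_pt_words[OF r] by (simp add: words_in_def)
  show "word_op tilde_periplectic_gen r * P \<mu> = 0"
    by (rule tilde_relations_vanish[OF cartan n_pos r])
qed (rule P_restr P_homog P_mult P_sum; assumption)+

end

section \<open>Variables and derivations on monomials\<close>

definition var_mono :: "var \<Rightarrow> mono" where "var_mono a = Poly_Mapping.single a 1"

lemma lookup_var_mono: "lookup (var_mono a) b = (if a = b then 1 else 0)"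
  by (simp add: var_mono_def lookup_single)

text \<open>\<open>osign a e\<close> is the sign for moving an odd variable \<open>a\<close> to its place in the monomial \<open>e\<close>, and \<open>vsign b a\<close>
  is the factor by which it changes if \<open>b\<close> is inserted into \<open>e\<close> or removed from it.\<close>

definition osign :: "var \<Rightarrow> mono \<Rightarrow> 'k::field" where
  "osign a e = (if snd a < 0 then (- 1) ^ cbelow a (oddvars e) else 1)"

definition vsign :: "var \<Rightarrow> var \<Rightarrow> 'k::field" where
  "vsign b a = (if snd a < 0 \<and> snd b < 0 \<and> vless b a then - 1 else 1)"

lemma osign_square: "osign a e * osign a e = (1 :: 'k::field)"
  by (simp add: osign_def power_add[symmetric] flip: mult_2)

lemma vsign_self: "vsign a a = 1"
  by (simp add: vsign_def vless_def)

lemma vsign_swap: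
  assumes "a \<noteq> b"
  shows "vsign a b = (if snd a < 0 \<and> snd b < 0 then - 1 else 1) * (vsign b a :: 'k::field)"
  using assms by (auto simp: vsign_def vless_def prod_eq_iff)

lemma zz_single:
  "zz a (Poly_Mapping.single e c) = (if snd a < 0 \<and> a \<in> oddvars e then 0
     else Poly_Mapping.single (e + var_mono a) (c * osign a e))"
proof -
  have odd: "oddvars (var_mono a) = (if snd a < 0 then {a} else {})" by (auto simp: oddvars_def in_keys_iff lookup_var_mono)
  have "{(x, y). x = a \<and> y \<in> S \<and> vless y x} = Pair a ` {y \<in> S. vless y a}" for S by auto
  then have inv: "cinv {a} S = cbelow a S" for S
    by (simp add: cinv_def cbelow_def card_image inj_on_def)
  show ?thesis
    unfolding zz_def var_mono_def[symmetric] sym_mult_single mono_mult_alt scl_single odd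
    by (auto simp: csgn_def osign_def inv add.commute) (simp add: cinv_def)
qed

lemma dd_single': "dd a (Poly_Mapping.single e c) =
    Poly_Mapping.single (e - var_mono a) (c * of_nat (lookup e a) * osign a e)"
  by (simp add: dd_single osign_def var_mono_def)

lemma sym_basis_odd:
  assumes "e \<in> sym_basis N r" "snd a < 0"
  shows "lookup e a = (if a \<in> oddvars e then 1 else 0)"
  using assms by (cases a) (auto simp: sym_basis_def oddvars_def in_keys_iff)

lemma oddvars_plus: "oddvars (e + var_mono a) = (if snd a < 0 then insert a (oddvars e) else oddvars e)"
  by (auto simp: oddvars_def in_keys_iff lookup_add lookup_var_mono split: if_splits)

lemma oddvars_minus:
  assumes "e \<in> sym_basis N r"
  shows "oddvars (e - var_mono a) = (if snd a < 0 then oddvars e - {a} else oddvars e)"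
  using sym_basis_odd[OF assms, of a]
  by (auto simp: oddvars_def in_keys_iff lookup_minus lookup_var_mono split: if_splits)

lemma cbelow_insert:
  assumes "finite S" "a \<notin> S"
  shows "cbelow b (insert a S) = cbelow b S + (if vless a b then 1 else 0)"
proof -
  have "{x \<in> insert a S. vless x b} = (if vless a b then insert a {x \<in> S. vless x b} else {x \<in> S. vless x b})"
    by auto
  then show ?thesis using assms by (simp add: cbelow_def)
qed

lemma osign_plus:
  assumes "snd b < 0 \<longrightarrow> b \<notin> oddvars e"
  shows "osign a (e + var_mono b) = osign a e * (vsign b a :: 'k::field)"
  using assms by (simp add: osign_def oddvars_plus vsign_def cbelow_insert finite_oddvars)

lemma osign_minus:
  assumes "e \<in> sym_basis N r" "lookup e b \<noteq> 0"
  shows "osign a (e - var_mono b) = osign a e * (vsign b a :: 'k::field)"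
proof (cases "snd b < 0")
  case True
  then have "b \<in> oddvars e" using assms sym_basis_odd[OF assms(1) True] by (metis)
  then have "oddvars e = insert b (oddvars e - {b})" by auto
  then have "cbelow a (oddvars e) = cbelow a (oddvars e - {b}) + (if vless b a then 1 else 0)"
    using cbelow_insert[of "oddvars e - {b}" b a] finite_oddvars[of e] by simp
  then show ?thesis using True by (simp add: osign_def oddvars_minus[OF assms(1)] vsign_def)
next
  case False
  then show ?thesis by (simp add: osign_def oddvars_minus[OF assms(1)] vsign_def)
qed

lemma sym_basis_plus:
  assumes "e \<in> sym_basis N r" "a \<in> {1..N} \<times> Ind r" "snd a < 0 \<longrightarrow> a \<notin> oddvars e"
  shows "e + var_mono a \<in> sym_basis N r"
  unfolding sym_basis_def
proof (intro CollectI conjI ballI)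
  show "keys (e + var_mono a) \<subseteq> {1..N} \<times> Ind r"
  proof -
    have "keys e \<subseteq> {1..N} \<times> Ind r" using assms(1) by (simp add: sym_basis_def)
    moreover have "keys (e + var_mono a) \<subseteq> insert a (keys e)"
      by (auto simp: in_keys_iff lookup_add lookup_var_mono split: if_splits)
    ultimately show ?thesis using assms(2) by blast
  qed
  fix x assume x: "x \<in> keys (e + var_mono a)"
  show "case x of (t, j) \<Rightarrow> j < 0 \<longrightarrow> lookup (e + var_mono a) (t, j) = 1"
  proof (cases x)
    case (Pair t j)
    have "lookup (e + var_mono a) x = 1" if "j < 0"
      using x that Pair assms(3) sym_basis_odd[OF assms(1), of x]
      by (auto simp: lookup_add lookup_var_mono in_keys_iff oddvars_def split: if_splits)
    then show ?thesis using Pair by simp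
  qed
qed

lemma sym_basis_minus:
  assumes "e \<in> sym_basis N r"
  shows "e - var_mono a \<in> sym_basis N r"
  unfolding sym_basis_def
proof (intro CollectI conjI ballI)
  have "keys (e - var_mono a) \<subseteq> keys e" by (auto simp: in_keys_iff lookup_minus)
  then show "keys (e - var_mono a) \<subseteq> {1..N} \<times> Ind r"
    using assms by (auto simp: sym_basis_def)
  fix x assume x: "x \<in> keys (e - var_mono a)"
  show "case x of (t, j) \<Rightarrow> j < 0 \<longrightarrow> lookup (e - var_mono a) (t, j) = 1"
  proof (cases x)
    case (Pair t j)
    have "lookup (e - var_mono a) x = 1" if "j < 0"
      using x that Pair sym_basis_odd[OF assms, of x]
      by (auto simp: lookup_minus lookup_var_mono in_keys_iff oddvars_def split: if_splits)
    then show ?thesis using Pair by simp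
  qed
qed

text \<open>The operators are made zero outside of the module. The rules then hold as identities of
  operators on the ambient space, with the projection onto the module as unit.\<close>

definition mult_op :: "nat \<Rightarrow> nat \<Rightarrow> var \<Rightarrow> (mono, 'k::field) endo" where
  "mult_op N r a = elin (\<lambda>e. if e \<in> sym_basis N r then zz a (basvec e) else 0)"

definition deriv_op :: "nat \<Rightarrow> nat \<Rightarrow> var \<Rightarrow> (mono, 'k::field) endo" where
  "deriv_op N r a = elin (\<lambda>e. if e \<in> sym_basis N r then dd a (basvec e) else 0)"

lemma app_mult_op: "app (mult_op N r a) (Poly_Mapping.single e c) =
    (if e \<in> sym_basis N r \<and> \<not> (snd a < 0 \<and> a \<in> oddvars e)
     then Poly_Mapping.single (e + var_mono a) (c * osign a e) else 0)"
  by (simp add: mult_op_def app_elin lin_single zz_single scl_single scl_zero)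

lemma app_deriv_op: "app (deriv_op N r a) (Poly_Mapping.single e c) =
    (if e \<in> sym_basis N r \<and> lookup e a \<noteq> 0
     then Poly_Mapping.single (e - var_mono a) (c * of_nat (lookup e a) * osign a e) else 0)"
  by (simp add: deriv_op_def app_elin lin_single dd_single' scl_single scl_zero mult.assoc)

lemma zz_lin: "zz a v = lin (\<lambda>e. zz a (basvec e)) v"
  unfolding zz_def sym_mult_def bilin_def by (simp add: lin_single scl_single)

lemma dd_lin: "dd a v = lin (\<lambda>e. dd a (basvec e)) v"
  unfolding dd_def by (simp add: lin_single)

lemma mult_op_eq: "v \<in> vecs (Sym N r) \<Longrightarrow> app (mult_op N r a) v = zz a v"
  unfolding mult_op_def app_elin by (subst (2) zz_lin) (auto simp: vecs_def Sym_def intro!: lin_cong)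

lemma deriv_op_eq: "v \<in> vecs (Sym N r) \<Longrightarrow> app (deriv_op N r a) v = dd a v"
  unfolding deriv_op_def app_elin by (subst (2) dd_lin) (auto simp: vecs_def Sym_def intro!: lin_cong)

lemma app_restr_Sym: "app (restr (Sym N r)) (Poly_Mapping.single e c) =
    (if e \<in> sym_basis N r then Poly_Mapping.single e c else 0)"
  by (simp add: restr_def app_diag_single Sym_def)

lemma minus_plus_mono: "e - var_mono a + var_mono a = e" if "lookup e a \<noteq> 0"
  using that by (intro poly_mapping_eqI) (auto simp: lookup_add lookup_minus lookup_var_mono)

lemma minus_commute_mono: "e - var_mono a - var_mono b = e - var_mono b - var_mono a"
  by (intro poly_mapping_eqI) (auto simp: lookup_minus lookup_var_mono)

lemma plus_minus_mono: "e + var_mono b - var_mono a = e - var_mono a + var_mono b" if "a \<noteq> b"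
  using that by (intro poly_mapping_eqI) (auto simp: lookup_add lookup_minus lookup_var_mono)

lemma app_mult_op_twice:
  assumes "a \<in> {1..N} \<times> Ind r"
  shows "app (mult_op N r b) (app (mult_op N r a) (basvec e)) =
    (if e \<in> sym_basis N r \<and> \<not> (snd a < 0 \<and> a \<in> oddvars e) \<and> \<not> (snd b < 0 \<and> b \<in> oddvars e) \<and>
        \<not> (snd a < 0 \<and> a = b)
     then Poly_Mapping.single (e + var_mono a + var_mono b) (osign a e * (osign b e * vsign a b)) else 0)"
  using sym_basis_plus[OF _ assms, of e]
  by (auto simp: app_mult_op oddvars_plus osign_plus)

lemma app_deriv_op_twice:
  "app (deriv_op N r b) (app (deriv_op N r a) (basvec e)) =
    (if e \<in> sym_basis N r \<and> lookup e a \<noteq> 0 \<and> lookup (e - var_mono a) b \<noteq> 0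
     then Poly_Mapping.single (e - var_mono a - var_mono b)
       (of_nat (lookup e a * lookup (e - var_mono a) b) * (osign a e * (osign b e * vsign a b))) else 0)"
proof (cases "e \<in> sym_basis N r \<and> lookup e a \<noteq> 0")
  case True
  then have "osign b (e - var_mono a) = osign b e * (vsign a b :: 'a)" by (intro osign_minus) auto
  then show ?thesis using True by (simp add: app_deriv_op sym_basis_minus mult_ac)
qed (auto simp: app_deriv_op)

lemma app_deriv_op_mult_op:
  assumes "b \<in> {1..N} \<times> Ind r"
  shows "app (deriv_op N r a) (app (mult_op N r b) (basvec e)) =
    (if e \<in> sym_basis N r \<and> \<not> (snd b < 0 \<and> b \<in> oddvars e) \<and> lookup (e + var_mono b) a \<noteq> 0
     then Poly_Mapping.single (e + var_mono b - var_mono a)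
       (of_nat (lookup (e + var_mono b) a) * (osign b e * (osign a e * vsign b a))) else 0)"
proof (cases "e \<in> sym_basis N r \<and> \<not> (snd b < 0 \<and> b \<in> oddvars e)")
  case True
  then have "osign a (e + var_mono b) = osign a e * (vsign b a :: 'a)" by (intro osign_plus) auto
  then show ?thesis using True sym_basis_plus[OF _ assms, of e] by (simp add: app_deriv_op app_mult_op mult_ac)
qed (auto simp: app_mult_op)

lemma app_mult_op_deriv_op:
  "app (mult_op N r b) (app (deriv_op N r a) (basvec e)) =
    (if e \<in> sym_basis N r \<and> lookup e a \<noteq> 0 \<and> \<not> (snd b < 0 \<and> b \<in> oddvars e \<and> a \<noteq> b)
     then Poly_Mapping.single (e - var_mono a + var_mono b)
       (of_nat (lookup e a) * (osign a e * (osign b e * vsign a b))) else 0)"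
proof (cases "e \<in> sym_basis N r \<and> lookup e a \<noteq> 0")
  case True
  then have "osign b (e - var_mono a) = osign b e * (vsign a b :: 'a)" by (intro osign_minus) auto
  then show ?thesis using True
    by (auto simp: app_deriv_op app_mult_op sym_basis_minus oddvars_minus mult_ac split: if_splits)
qed (auto simp: app_deriv_op)

text \<open>On a monomial both sides are multiples of one monomial. For distinct variables the two orders
  differ by \<open>vsign_swap\<close>; an odd variable and its derivation satisfy \<open>\<partial> z + z \<partial> = u\<close> as exactly
  one of the two terms is nonzero.\<close>

lemma super_weyl_Sym:
  "super_weyl N r (restr (Sym N r) :: (mono, 'k::field_char_0) endo)
     (\<lambda>k j. mult_op N r (k, j)) (\<lambda>k j. deriv_op N r (k, j))"
proof
  let ?z = "\<lambda>k j. mult_op N r (k, j) :: (mono, 'k) endo"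
  let ?d = "\<lambda>k j. deriv_op N r (k, j) :: (mono, 'k) endo"
  fix k k' i j assume "k \<in> {1..N}" "k' \<in> {1..N}" "i \<in> Ind r" "j \<in> Ind r"
  then have a: "(k, i) \<in> {1..N} \<times> Ind r" and b: "(k', j) \<in> {1..N} \<times> Ind r" by auto
  have isign: "app (isign i j) v = scl (if i < 0 \<and> j < 0 then - 1 else 1) v" for v :: "mono \<Rightarrow>\<^sub>0 'k"
    by (simp add: isign_def app_uminus)
  let ?a = "(k, i)" and ?b = "(k', j)"
  have vs: "?a \<noteq> ?b \<Longrightarrow> vsign ?a ?b = (if snd ?a < 0 \<and> snd ?b < 0 then - 1 else 1) * (vsign ?b ?a :: 'k)"
    by (rule vsign_swap)
  have vself: "vsign ?a ?a = (1 :: 'k)" by (rule vsign_self)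
  have osq: "osign ?a e * osign ?a e = (1 :: 'k)" for e by (rule osign_square)
  show "?z k i * ?z k' j = isign i j * (?z k' j * ?z k i)"
  proof (rule endo_eqI)
    fix e
    have comm: "e + var_mono ?b + var_mono ?a = e + var_mono ?a + var_mono ?b" by (simp add: ac_simps)
    show "app (?z k i * ?z k' j) (basvec e) = app (isign i j * (?z k' j * ?z k i)) (basvec e)"
      unfolding app_times isign app_mult_op_twice[OF a] app_mult_op_twice[OF b] comm
      using vs by (cases "?a = ?b") (auto simp: scl_single scl_zero mult.left_commute)
  qed
  show "?d k i * ?d k' j = isign i j * (?d k' j * ?d k i)"
  proof (rule endo_eqI)
    fix e
    show "app (?d k i * ?d k' j) (basvec e) = app (isign i j * (?d k' j * ?d k i)) (basvec e)"
      unfolding app_times isign app_deriv_op_twice minus_commute_mono[of e ?b ?a]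
      using vs sym_basis_odd[of e N r ?a]
      by (cases "?a = ?b") (auto simp: scl_single scl_zero mult_ac lookup_minus lookup_var_mono)
  qed
  show "?d k i * ?z k' j = isign i j * (?z k' j * ?d k i) + (if k = k' \<and> i = j then restr (Sym N r) else 0)"
  proof (rule endo_eqI)
    fix e
    show "app (?d k i * ?z k' j) (basvec e) = app (isign i j * (?z k' j * ?d k i) +
        (if k = k' \<and> i = j then restr (Sym N r) else 0)) (basvec e)"
    proof (cases "?a = ?b")
      case False
      then show ?thesis
        unfolding app_times isign app_plus app_deriv_op_mult_op[OF b] app_mult_op_deriv_op
        using vs by (auto simp: scl_single scl_zero mult_ac lookup_add lookup_var_mono plus_minus_mono)
    next
      case True
      show ?thesis
      proof (cases "e \<in> sym_basis N r")
        case e: True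
        have "k = k' \<and> i = j" using True by simp
        then show ?thesis
          unfolding app_times isign app_plus app_deriv_op_mult_op[OF b] app_mult_op_deriv_op
          using e True sym_basis_odd[OF e, of ?a] vself osq[of e] minus_plus_mono[of e ?a]
          by (cases "i < 0"; cases "lookup e ?a = 0")
            (auto simp: scl_single scl_zero lookup_add lookup_minus lookup_var_mono app_restr_Sym
              single_add[symmetric] osign_def mult.assoc algebra_simps)
      next
        case False
        then show ?thesis
          unfolding app_times isign app_plus app_deriv_op_mult_op[OF b] app_mult_op_deriv_op
          by (simp add: app_restr_Sym scl_zero)
      qed
    qed
  qed
next
  fix k i assume "k \<in> {1..N}" "i \<in> Ind r"
  then have a: "(k, i) \<in> {1..N} \<times> Ind r" by auto
  show "restr (Sym N r) * mult_op N r (k, i) = (mult_op N r (k, i) :: (mono, 'k) endo)"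
    "mult_op N r (k, i) * restr (Sym N r) = (mult_op N r (k, i) :: (mono, 'k) endo)"
    "restr (Sym N r) * deriv_op N r (k, i) = (deriv_op N r (k, i) :: (mono, 'k) endo)"
    "deriv_op N r (k, i) * restr (Sym N r) = (deriv_op N r (k, i) :: (mono, 'k) endo)"
    using a by (auto intro!: endo_eqI simp: app_times app_mult_op app_deriv_op app_restr_Sym
        sym_basis_plus sym_basis_minus)
qed

lemma diag_mult_op:
  assumes "\<And>e. e \<in> sym_basis N r \<Longrightarrow> \<not> (snd a < 0 \<and> a \<in> oddvars e) \<Longrightarrow> h' (e + var_mono a) = c * h e"
  shows "diag h' * mult_op N r a = scalar c * (mult_op N r a * diag h)"
  by (rule endo_eqI) (auto simp: app_times app_mult_op app_diag_single app_scalar scl_single assms mult.assoc)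

lemma diag_deriv_op:
  assumes "\<And>e. e \<in> sym_basis N r \<Longrightarrow> lookup e a \<noteq> 0 \<Longrightarrow> h' (e - var_mono a) = c * h e"
  shows "diag h' * deriv_op N r a = scalar c * (deriv_op N r a * diag h)"
  by (rule endo_eqI) (auto simp: app_times app_deriv_op app_diag_single app_scalar scl_single assms mult.assoc)

lemma mpar_plus:
  assumes "snd a < 0 \<longrightarrow> a \<notin> oddvars e"
  shows "mpar (e + var_mono a) = mpar e + ipar (snd a)"
  using assms by (auto simp: mpar_def oddvars_plus finite_oddvars ipar_def add.commute)

lemma grade_mult_op: "homog (Sym N r) (ipar (snd a)) (mult_op N r a :: (mono, 'k::field_char_0) endo)"
  unfolding homog_def grade_def Sym_def sspace.simps
proof (rule endo_eqI)
  fix e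
  show "app (diag (\<lambda>b. ksign (mpar b)) * mult_op N r a) (basvec e) =
      app (scalar (ksign (ipar (snd a))) * (mult_op N r a * diag (\<lambda>b. ksign (mpar b)))) (basvec e :: mono \<Rightarrow>\<^sub>0 'k)"
  proof (cases "e \<in> sym_basis N r \<and> \<not> (snd a < 0 \<and> a \<in> oddvars e)")
    case True
    then have "ksign (mpar (e + var_mono a)) = ksign (ipar (snd a)) * (ksign (mpar e) :: 'k)"
      by (subst mpar_plus) (simp_all only: ksign_add mult.commute, auto)
    then show ?thesis
      by (auto simp: app_times app_mult_op app_diag_single app_scalar scl_single mult_ac scl_zero)
  qed (auto simp: app_times app_mult_op app_diag_single app_scalar scl_zero)
qed

lemma grade_deriv_op: "homog (Sym N r) (ipar (snd a)) (deriv_op N r a :: (mono, 'k::field_char_0) endo)"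
  unfolding homog_def grade_def Sym_def sspace.simps
proof (rule diag_deriv_op)
  fix e assume e: "e \<in> sym_basis N r" "lookup e a \<noteq> 0"
  have "mpar e = mpar (e - var_mono a) + ipar (snd a)"
    using mpar_plus[of a "e - var_mono a"] minus_plus_mono[OF e(2)] oddvars_minus[OF e(1), of a]
    by simp
  then have "ksign (mpar e) = ksign (mpar (e - var_mono a)) * (ksign (ipar (snd a)) :: 'k)"
    by (simp only: ksign_add)
  then show "ksign (mpar (e - var_mono a)) = ksign (ipar (snd a)) * (ksign (mpar e) :: 'k)"
    by (simp add: mult_ac)
qed

text \<open>This makes the diagonal elements of the Lie superalgebras diagonal on monomials.\<close>

lemma number_op: "mult_op N r a * deriv_op N r a =
    diag (\<lambda>e. if e \<in> sym_basis N r then of_nat (lookup e a) else (0 :: 'k::field_char_0))"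
proof (rule endo_eqI)
  fix e
  have osq: "osign a e * osign a e = (1 :: 'k)" by (rule osign_square)
  have "app (mult_op N r a) (app (deriv_op N r a) (basvec e)) =
      (if e \<in> sym_basis N r then Poly_Mapping.single e (of_nat (lookup e a) :: 'k) else 0)"
    unfolding app_mult_op_deriv_op
    using minus_plus_mono[of e a] osq
    by (auto simp: vsign_self)
  then show "app (mult_op N r a * deriv_op N r a) (basvec e) = app (diag (\<lambda>e. if e \<in> sym_basis N r
      then of_nat (lookup e a) else 0)) (basvec e :: mono \<Rightarrow>\<^sub>0 'k)"
    by (simp add: app_times app_diag_single)
qed

section \<open>Weights and degrees of monomials\<close>

lemma mweight_superset:
  assumes "finite S" "keys e \<subseteq> S"
  shows "mweight e = (\<Sum>(t, j)\<in>S. Poly_Mapping.single (nat \<bar>j\<bar>) (sgn j * int (lookup e (t, j))))"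
  unfolding mweight_def
  by (rule sum.mono_neutral_left) (use assms in \<open>auto simp: in_keys_iff\<close>)

lemma mdegree_superset:
  assumes "finite S" "keys e \<subseteq> S"
  shows "mdegree e = (\<Sum>(t, j)\<in>S. Poly_Mapping.single t (int (lookup e (t, j))))"
  unfolding mdegree_def
  by (rule sum.mono_neutral_left) (use assms in \<open>auto simp: in_keys_iff\<close>)

lemma mweight_plus: "mweight (e + var_mono a) = mweight e + var_weight (snd a)"
proof -
  let ?S = "insert a (keys e)"
  have k: "keys (e + var_mono a) \<subseteq> ?S"
    by (auto simp: in_keys_iff lookup_add lookup_var_mono split: if_splits)
  have "mweight (e + var_mono a) = (\<Sum>x\<in>?S. (case x of (t, j) \<Rightarrow>
      Poly_Mapping.single (nat \<bar>j\<bar>) (sgn j * int (lookup e (t, j)))) + (if x = a then var_weight (snd a) else 0))"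
    unfolding mweight_superset[of ?S, OF _ k, simplified]
    by (rule sum.cong) (auto simp: lookup_add lookup_var_mono var_weight_def single_add[symmetric] algebra_simps)
  also have "\<dots> = mweight e + var_weight (snd a)"
    by (simp add: sum.distrib mweight_superset[OF _ subset_insertI, symmetric])
  finally show ?thesis .
qed

lemma mdegree_plus: "mdegree (e + var_mono a) = mdegree e + eps (fst a)"
proof -
  let ?S = "insert a (keys e)"
  have k: "keys (e + var_mono a) \<subseteq> ?S"
    by (auto simp: in_keys_iff lookup_add lookup_var_mono split: if_splits)
  have "mdegree (e + var_mono a) = (\<Sum>x\<in>?S. (case x of (t, j) \<Rightarrow>
      Poly_Mapping.single t (int (lookup e (t, j)))) + (if x = a then eps (fst a) else 0))"
    unfolding mdegree_superset[of ?S, OF _ k, simplified]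
    by (rule sum.cong) (auto simp: lookup_add lookup_var_mono eps_def single_add[symmetric] algebra_simps)
  also have "\<dots> = mdegree e + eps (fst a)"
    by (simp add: sum.distrib mdegree_superset[OF _ subset_insertI, symmetric])
  finally show ?thesis .
qed

lemma lookup_mweight:
  assumes "e \<in> sym_basis N r" "k \<in> {1..r}"
  shows "lookup (mweight e) k = (\<Sum>t = 1..N. int (lookup e (t, int k)) - int (lookup e (t, - int k)))"
proof -
  have "keys e \<subseteq> {1..N} \<times> Ind r" using assms(1) by (simp add: sym_basis_def)
  then have "lookup (mweight e) k = (\<Sum>t = 1..N. \<Sum>j\<in>Ind r.
      if nat \<bar>j\<bar> = k then sgn j * int (lookup e (t, j)) else 0)"
    by (subst mweight_superset[of "{1..N} \<times> Ind r"])
      (auto simp: finite_Ind lookup_sum sum.cartesian_product case_prod_beta lookup_single when_def intro!: sum.cong)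
  also have "\<dots> = (\<Sum>t = 1..N. \<Sum>l = 1..r. if l = k then int (lookup e (t, int k)) - int (lookup e (t, - int k)) else 0)"
    unfolding sum_Ind by (intro sum.cong refl) auto
  also have "\<dots> = (\<Sum>t = 1..N. int (lookup e (t, int k)) - int (lookup e (t, - int k)))"
    using assms(2) by simp
  finally show ?thesis .
qed

lemma lookup_mdegree:
  assumes "e \<in> sym_basis N r" "k \<in> {1..N}"
  shows "lookup (mdegree e) k = (\<Sum>j\<in>Ind r. int (lookup e (k, j)))"
proof -
  have "keys e \<subseteq> {1..N} \<times> Ind r" using assms(1) by (simp add: sym_basis_def)
  then have "lookup (mdegree e) k = (\<Sum>t = 1..N. \<Sum>j\<in>Ind r. if t = k then int (lookup e (k, j)) else 0)"
    by (subst mdegree_superset[of "{1..N} \<times> Ind r"])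
      (auto simp: finite_Ind lookup_sum sum.cartesian_product case_prod_beta lookup_single when_def intro!: sum.cong)
  also have "\<dots> = (\<Sum>t = 1..N. if t = k then \<Sum>j\<in>Ind r. int (lookup e (k, j)) else 0)"
    by (intro sum.cong refl) auto
  also have "\<dots> = (\<Sum>j\<in>Ind r. int (lookup e (k, j)))" using assms(2) by simp
  finally show ?thesis .
qed

lemma mweight_Xwt:
  assumes "e \<in> sym_basis N r"
  shows "mweight e \<in> Xwt r"
proof -
  have "keys (mweight e) \<subseteq> (\<Union>x\<in>keys e. {nat \<bar>snd x\<bar>})"
    unfolding mweight_def by (rule order_trans[OF keys_sum]) (auto split: if_splits)
  also have "\<dots> \<subseteq> {1..r}"
  proof (intro UN_least)
    fix x assume "x \<in> keys e"
    then have "snd x \<in> Ind r" using assms by (auto simp: sym_basis_def)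
    then show "{nat \<bar>snd x\<bar>} \<subseteq> {1..r}" by (cases rule: Ind_cases) auto
  qed
  finally show ?thesis by (simp add: Xwt_def)
qed

lemma mdegree_Xwt:
  assumes "e \<in> sym_basis N r"
  shows "mdegree e \<in> Xwt N"
proof -
  have "keys (mdegree e) \<subseteq> (\<Union>x\<in>keys e. {fst x})"
    unfolding mdegree_def by (rule order_trans[OF keys_sum]) (auto split: if_splits)
  also have "\<dots> \<subseteq> {1..N}" using assms by (auto simp: sym_basis_def subset_eq)
  finally show ?thesis by (simp add: Xwt_def)
qed

lemma lookup_adelta: "lookup (adelta a n) i = (if i \<in> {1..n} then int a else 0)"
  by (simp add: adelta_def lookup_sum lookup_single when_def)

lemma adelta_Xwt: "adelta a n \<in> Xwt n"
  by (auto simp: Xwt_def in_keys_iff lookup_adelta split: if_splits)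

lemma Xwt_add: "\<mu> \<in> Xwt n \<Longrightarrow> \<nu> \<in> Xwt n \<Longrightarrow> \<mu> + \<nu> \<in> Xwt n"
  using Poly_Mapping.keys_add[of \<mu> \<nu>] by (auto simp: Xwt_def)

section \<open>Tensoring with a line\<close>

text \<open>\<open>lift v\<close> is \<open>v\<close> tensored with the generator of the line, and \<open>Lift f\<close> is \<open>f \<otimes> id\<close>.\<close>

definition lift :: "('b \<Rightarrow>\<^sub>0 'k::field) \<Rightarrow> ('b \<times> unit \<Rightarrow>\<^sub>0 'k)" where
  "lift = lin (\<lambda>e. basvec (e, ()))"

definition Lift :: "('b, 'k::field) endo \<Rightarrow> ('b \<times> unit, 'k) endo" where
  "Lift f = elin (\<lambda>b. lift (app f (basvec (fst b))))"

lemma lin_sum: "lin f (sum g A) = (\<Sum>a\<in>A. lin f (g a))"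
  by (induction A rule: infinite_finite_induct) (simp_all add: lin_add)

lemma lin_lin: "lin f (lin g x) = lin (\<lambda>a. lin f (g a)) x"
  by (simp add: lin_def[of g] lin_def[of "\<lambda>a. lin f (g a)"] lin_sum lin_scl)

lemma lift_basvec: "lift (basvec e) = basvec (e, ())"
  by (simp add: lift_def)

lemma app_Lift: "app (Lift f) (lift x) = lift (app f x)"
proof -
  have "app (Lift f) (lift x) = lin (\<lambda>e. lift (app f (basvec e))) x"
    unfolding lift_def app_lin by (simp add: Lift_def app_elin lift_def)
  also have "\<dots> = lift (app f x)"
    unfolding lift_def lin_lin[symmetric] by (subst (2) app_expand) simp
  finally show ?thesis .
qed

lemma Lift_eqI: "(\<And>e. app f (lift (basvec e)) = app g (lift (basvec e))) \<Longrightarrow> f = g"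
  by (rule endo_eqI) (auto simp: lift_basvec)

lemma lift_add: "lift (x + y) = lift x + lift y" by (simp add: lift_def lin_add)
lemma lift_scl: "lift (scl c x) = scl c (lift x)" by (simp add: lift_def lin_scl)
lemma lift_zero [simp]: "lift 0 = 0" by (simp add: lift_def)
lemma lift_uminus: "lift (- x) = - lift x"
  by (metis add.right_inverse add_eq_0_iff lift_add lift_zero)
lemma lift_minus: "lift (x - y) = lift x - lift y"
  by (metis add_diff_cancel_right' diff_add_cancel lift_add)

lemma Lift_one [simp]: "Lift 1 = 1" by (rule Lift_eqI) (simp only: app_Lift app_one)
lemma Lift_zero [simp]: "Lift 0 = 0" by (rule Lift_eqI) (simp add: app_Lift)
lemma Lift_mult: "Lift (f * g) = Lift f * Lift g" by (rule Lift_eqI) (simp only: app_Lift app_times)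
lemma Lift_plus: "Lift (f + g) = Lift f + Lift g" by (rule Lift_eqI) (simp only: app_Lift app_plus lift_add)
lemma Lift_minus: "Lift (f - g) = Lift f - Lift g" by (rule Lift_eqI) (simp only: app_Lift app_minus lift_minus)
lemma Lift_uminus: "Lift (- f) = - Lift f" by (rule Lift_eqI) (simp only: app_Lift app_uminus lift_uminus)
lemma Lift_scalar: "Lift (scalar c) = scalar c" by (rule Lift_eqI) (simp only: app_Lift app_scalar lift_scl)
lemma Lift_sum: "Lift (sum f A) = (\<Sum>a\<in>A. Lift (f a))"
  by (induction A rule: infinite_finite_induct) (simp_all add: Lift_plus)

lemma Lift_diag: "Lift (diag h) = diag (\<lambda>b. h (fst b))"
  by (rule endo_eqI) (auto simp: Lift_def app_elin lift_def app_diag_single lin_single scl_single)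

lemma restr_Lift: "restr (tensor_space M line) = Lift (restr M)"
  unfolding restr_def Lift_diag by (rule arg_cong[where f = diag]) (auto simp: tensor_space_def line_def)

lemma grade_Lift: "grade (tensor_space M line) = Lift (grade M)"
  unfolding grade_def Lift_diag by (rule arg_cong[where f = diag]) (auto simp: tensor_space_def line_def)

lemma homog_Lift: "homog M p f \<Longrightarrow> homog (tensor_space M line) p (Lift f)"
  unfolding homog_def grade_Lift by (simp add: Lift_mult[symmetric] Lift_scalar[symmetric])

lemma tensor_map_eq_Lift:
  fixes f :: "('b \<Rightarrow>\<^sub>0 'k::field) \<Rightarrow> ('b \<Rightarrow>\<^sub>0 'k)"
  assumes "\<And>e. e \<in> basis M \<Longrightarrow> f (basvec e) = app F (basvec e)" "v \<in> vecs (tensor_space M line)"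
    and "\<And>b. g (basvec b) = basvec b"
  shows "tensor_map f g v = app (Lift F) v"
  unfolding tensor_map_def Lift_def app_elin
proof (rule lin_cong)
  fix b assume "b \<in> keys v"
  then obtain e where b: "b = (e, ())" "e \<in> basis M"
    using assms(2) by (cases b) (auto simp: vecs_def tensor_space_def)
  have "tensor_vec x (basvec ()) = lift x" for x :: "'b \<Rightarrow>\<^sub>0 'k"
    by (simp add: tensor_vec_def bilin_def lift_def)
  then show "(case b of (a, b) \<Rightarrow> tensor_vec (f (basvec a)) (g (basvec b))) = lift (app F (basvec (fst b)))"
    using b assms(1,3) by simp
qed

lemma super_weyl_Lift:
  assumes "super_weyl m n u z d"
  shows "super_weyl m n (Lift u) (\<lambda>k j. Lift (z k j)) (\<lambda>k j. Lift (d k j))"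
proof -
  interpret super_weyl m n u z d by fact
  have s: "Lift (isign i j) = isign i j" for i j by (simp add: isign_def Lift_uminus)
  have c: "(if b then Lift u else 0) = Lift (if b then u else 0)" for b by simp
  show ?thesis
    by unfold_locales
      (simp_all only: Lift_mult[symmetric] s[symmetric] Lift_plus[symmetric] c zz[symmetric] dd[symmetric]
        dz[symmetric] uz zu ud du)
qed

section \<open>Projections onto weight spaces\<close>

definition weight_proj :: "'b sspace \<Rightarrow> ('b \<Rightarrow> weight) \<Rightarrow> weight \<Rightarrow> ('b, 'k::field) endo" where
  "weight_proj M w \<mu> = diag (\<lambda>b. if b \<in> basis M \<and> w b = \<mu> then 1 else 0)"

lemma diag_sum: "(\<Sum>t\<in>A. diag (h t)) = diag (\<lambda>b. \<Sum>t\<in>A. h t b)"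
  by (intro app_eqI poly_mapping_eqI) (simp add: app_sum_endo lookup_sum lookup_app_diag sum_distrib_right)

lemma diag_minus: "diag h - diag h' = diag (\<lambda>b. h b - h' b)"
  by (rule endo_eqI) (simp add: app_minus app_diag_single single_diff)

text \<open>The constant \<open>c\<close> is the multiple of \<open>\<delta>\<close> by which the weight is shifted against the eigenvalues of
  the diagonal elements.\<close>

lemma periplectic_weights_I:
  fixes M :: "'b sspace" and z d :: "nat \<Rightarrow> int \<Rightarrow> ('b, 'k::field_char_0) endo"
  assumes "super_weyl m n (restr M) z d" and "1 \<le> n"
    and "\<And>k j. k \<in> {1..m} \<Longrightarrow> j \<in> Ind n \<Longrightarrow> homog M (ipar j) (z k j)"
    and "\<And>k j. k \<in> {1..m} \<Longrightarrow> j \<in> Ind n \<Longrightarrow> homog M (ipar j) (d k j)"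
    and "\<And>k j \<mu>. k \<in> {1..m} \<Longrightarrow> j \<in> Ind n \<Longrightarrow>
      z k j * weight_proj M w \<mu> = weight_proj M w (\<mu> + var_weight j) * z k j"
    and "\<And>k j \<mu>. k \<in> {1..m} \<Longrightarrow> j \<in> Ind n \<Longrightarrow>
      d k j * weight_proj M w \<mu> = weight_proj M w (\<mu> - var_weight j) * d k j"
    and X: "\<And>b. b \<in> basis M \<Longrightarrow> w b \<in> Xwt n"
    and cartan: "\<And>k. k \<in> {1..n} \<Longrightarrow> gl_rep.elA (super_weyl.T m z d) k k =
      diag (\<lambda>b. if b \<in> basis M then of_int (lookup (w b) k - c) else 0)"
  shows "periplectic_weights m n (restr M) z d M (weight_proj M w)"
proof -
  interpret super_weyl m n "restr M" z d by fact
  show ?thesis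
  proof unfold_locales
    fix \<mu> \<nu> :: weight
    show "restr M * weight_proj M w \<mu> = weight_proj M w \<mu> * restr M"
      unfolding restr_def weight_proj_def by (rule diag_commute)
    show "homog M 0 (weight_proj M w \<mu> :: ('b, 'k) endo)"
      by (simp add: homog_def grade_def weight_proj_def diag_commute ksign_def)
    show "weight_proj M w \<mu> * weight_proj M w \<nu> = (if \<mu> = \<nu> then weight_proj M w \<mu> else (0 :: ('b, 'k) endo))"
      by (rule endo_eqI) (auto simp: weight_proj_def app_times app_diag_single)
  next
    fix v :: "'b \<Rightarrow>\<^sub>0 'k" assume v: "v \<in> vecs M"
    then have kv: "keys v \<subseteq> basis M" by (simp add: vecs_def)
    have "(\<Sum>\<mu>\<in>w ` keys v. app (weight_proj M w \<mu>) v) = v"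
    proof (rule poly_mapping_eqI)
      fix b
      have "lookup (\<Sum>\<mu>\<in>w ` keys v. app (weight_proj M w \<mu>) v) b =
          (\<Sum>\<mu>\<in>w ` keys v. if w b = \<mu> then if b \<in> basis M then lookup v b else 0 else 0)"
        unfolding lookup_sum weight_proj_def lookup_app_diag by (intro sum.cong) auto
      also have "\<dots> = lookup v b"
        using kv by (auto simp: in_keys_iff subset_eq image_iff)
      finally show "lookup (\<Sum>\<mu>\<in>w ` keys v. app (weight_proj M w \<mu>) v) b = lookup v b" .
    qed
    then show "\<exists>S. finite S \<and> S \<subseteq> Xwt n \<and> (\<Sum>\<mu>\<in>S. app (weight_proj M w \<mu>) v) = v"
      using kv X by (intro exI[of _ "w ` keys v"]) auto
  next
    fix k l \<mu> assume kl: "k \<in> {1..n}" "l \<in> {1..n}"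
    show "(elA k k - elA l l) * weight_proj M w \<mu> =
        scalar (of_int (lookup \<mu> k - lookup \<mu> l)) * weight_proj M w \<mu>"
      unfolding cartan[OF kl(1)] cartan[OF kl(2)] diag_minus weight_proj_def diag_mult
      by (rule endo_eqI) (auto simp: app_times app_diag_single app_scalar scl_single)
  qed (use assms in auto)
qed

section \<open>The two modules\<close>

definition lz :: "nat \<Rightarrow> nat \<Rightarrow> nat \<Rightarrow> int \<Rightarrow> (mono \<times> unit, 'k::field_char_0) endo" where
  "lz N r k j = Lift (mult_op N r (k, j))"
definition ld :: "nat \<Rightarrow> nat \<Rightarrow> nat \<Rightarrow> int \<Rightarrow> (mono \<times> unit, 'k::field_char_0) endo" where
  "ld N r k j = Lift (deriv_op N r (k, j))"

abbreviation "lz_dual N r \<equiv> dual_z (lz N r) (ld N r)"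
abbreviation "ld_dual N r \<equiv> dual_d (lz N r) (ld N r)"

abbreviation "SymL N r \<equiv> tensor_space (Sym N r) line"

lemma super_weyl_SymL: "super_weyl N r (restr (SymL N r)) (lz N r) (ld N r)"
  using super_weyl_Lift[OF super_weyl_Sym] unfolding lz_def ld_def restr_Lift .

lemma lz_ld_homog:
  "homog (SymL N r) (ipar j) (lz N r k j)" "homog (SymL N r) (ipar j) (ld N r k j)"
  unfolding lz_def ld_def using grade_mult_op[of N r "(k, j)"] grade_deriv_op[of N r "(k, j)"]
  by (auto intro: homog_Lift)

lemma weight_proj_SymL:
  "weight_proj (SymL N r) (\<lambda>b. w (fst b)) \<mu> = Lift (diag (\<lambda>e. if e \<in> sym_basis N r \<and> w e = \<mu> then 1 else 0))"
  unfolding weight_proj_def Lift_diag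
  by (rule arg_cong[where f = diag]) (auto simp: tensor_space_def line_def Sym_def)

lemma lz_weight:
  assumes "(k, j) \<in> {1..N} \<times> Ind r" "\<And>e. w (e + var_mono (k, j)) = w e + \<nu>"
  shows "lz N r k j * weight_proj (SymL N r) (\<lambda>b. w (fst b)) \<mu> =
    weight_proj (SymL N r) (\<lambda>b. w (fst b)) (\<mu> + \<nu>) * lz N r k j"
proof -
  have "diag (\<lambda>e. if e \<in> sym_basis N r \<and> w e = \<mu> + \<nu> then 1 else (0 :: 'a)) * mult_op N r (k, j) =
      scalar 1 * (mult_op N r (k, j) * diag (\<lambda>e. if e \<in> sym_basis N r \<and> w e = \<mu> then 1 else 0))"
    by (rule diag_mult_op) (use assms sym_basis_plus[OF _ assms(1)] in auto)
  then show ?thesis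
    unfolding weight_proj_SymL lz_def Lift_mult[symmetric] by simp
qed

lemma ld_weight:
  assumes "\<And>e. w (e + var_mono (k, j)) = w e + \<nu>"
  shows "ld N r k j * weight_proj (SymL N r) (\<lambda>b. w (fst b)) \<mu> =
    weight_proj (SymL N r) (\<lambda>b. w (fst b)) (\<mu> - \<nu>) * ld N r k j"
proof -
  have "w (e - var_mono (k, j)) = w e - \<nu>" if "lookup e (k, j) \<noteq> 0" for e
    using assms[of "e - var_mono (k, j)"] minus_plus_mono[OF that] by simp
  then have "diag (\<lambda>e. if e \<in> sym_basis N r \<and> w e = \<mu> - \<nu> then 1 else (0 :: 'a)) * deriv_op N r (k, j) =
      scalar 1 * (deriv_op N r (k, j) * diag (\<lambda>e. if e \<in> sym_basis N r \<and> w e = \<mu> then 1 else 0))"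
    by (intro diag_deriv_op) (auto simp: sym_basis_minus)
  then show ?thesis
    unfolding weight_proj_SymL ld_def Lift_mult[symmetric] by simp
qed

lemma number_SymL: "lz N r k j * ld N r k j =
    diag (\<lambda>b. if fst b \<in> sym_basis N r then of_nat (lookup (fst b) (k, j)) else 0)"
  unfolding lz_def ld_def Lift_mult[symmetric] number_op Lift_diag ..

lemma basis_SymL: "b \<in> basis (SymL N r) \<longleftrightarrow> fst b \<in> sym_basis N r"
  by (cases b) (simp add: tensor_space_def line_def Sym_def)

abbreviation "nat_weight N r \<equiv> \<lambda>b :: mono \<times> unit. mweight (fst b) + adelta N r"
abbreviation "deg_weight \<equiv> \<lambda>b :: mono \<times> unit. mdegree (fst b)"

abbreviation "nat_proj N r \<equiv> weight_proj (SymL N r) (nat_weight N r)"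
abbreviation "deg_proj N r \<equiv> weight_proj (SymL N r) deg_weight"

text \<open>The eigenvalue of \<open>a\<^bsub>k,k\<^esub>\<close> is the \<open>k\<close>-th coordinate of the weight of the monomial, and tensoring with
  the line shifts it by \<open>N\<close>.\<close>

lemma periplectic_weights_natural:
  assumes "1 \<le> r"
  shows "periplectic_weights N r (restr (SymL N r)) (lz N r) (ld N r :: _ \<Rightarrow> _ \<Rightarrow> (_, 'k::field_char_0) endo)
    (SymL N r) (nat_proj N r)"
proof (rule periplectic_weights_I[where c = "int N", OF super_weyl_SymL assms lz_ld_homog lz_weight ld_weight])
  interpret super_weyl N r "restr (SymL N r)" "lz N r" "ld N r :: _ \<Rightarrow> _ \<Rightarrow> (_, 'k) endo"
    by (rule super_weyl_SymL)
  fix k assume k: "k \<in> {1..r}"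
  have "elA k k = diag (\<lambda>b. \<Sum>t = 1..N. (if fst b \<in> sym_basis N r then of_nat (lookup (fst b) (t, int k)) else 0) -
      (if fst b \<in> sym_basis N r then of_nat (lookup (fst b) (t, - int k)) else 0))"
    unfolding elA_def T_def number_SymL diag_sum diag_minus sum_subtractf ..
  also have "\<dots> = diag (\<lambda>b. if b \<in> basis (SymL N r) then of_int (lookup (nat_weight N r b) k - int N) else 0)"
    by (rule arg_cong[where f = diag])
      (use k in \<open>auto simp: basis_SymL fun_eq_iff lookup_add lookup_adelta lookup_mweight[OF _ k] of_int_sum\<close>)
  finally show "elA k k = diag (\<lambda>b. if b \<in> basis (SymL N r) then of_int (lookup (nat_weight N r b) k - int N) else 0)" .
qed (auto simp: mweight_plus basis_SymL intro: Xwt_add mweight_Xwt adelta_Xwt)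

text \<open>In the dual diagonal elements \<open>z \<partial>\<close> is replaced by \<open>\<partial> z = u - z \<partial>\<close> for each of the \<open>r\<close> odd variables, so
  the eigenvalue of \<open>a\<^bsub>k,k\<^esub>\<close> is the \<open>k\<close>-th degree minus \<open>r\<close>.\<close>

lemma periplectic_weights_degree:
  assumes "1 \<le> N"
  shows "periplectic_weights r N (restr (SymL N r)) (lz_dual N r)
    (ld_dual N r :: _ \<Rightarrow> _ \<Rightarrow> (_, 'k::field_char_0) endo)
    (SymL N r) (deg_proj N r)"
proof -
  interpret B: super_weyl N r "restr (SymL N r)" "lz N r" "ld N r :: _ \<Rightarrow> _ \<Rightarrow> (_, 'k) endo"
    by (rule super_weyl_SymL)
  interpret super_weyl r N "restr (SymL N r)" "lz_dual N r"
      "ld_dual N r :: _ \<Rightarrow> _ \<Rightarrow> (_, 'k) endo"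
    by (rule B.dual)
  show ?thesis
  proof (rule periplectic_weights_I[where c = "int r", OF super_weyl_axioms assms])
    fix k j \<mu> assume k: "k \<in> {1..r}" and "j \<in> Ind N"
    from \<open>j \<in> Ind N\<close> have
      "homog (SymL N r) (ipar j) (lz_dual N r k j :: (_, 'k) endo) \<and>
       homog (SymL N r) (ipar j) (ld_dual N r k j :: (_, 'k) endo) \<and>
       lz_dual N r k j * deg_proj N r \<mu> =
         deg_proj N r (\<mu> + var_weight j) * (lz_dual N r k j :: (_, 'k) endo) \<and>
       ld_dual N r k j * deg_proj N r \<mu> =
         deg_proj N r (\<mu> - var_weight j) * (ld_dual N r k j :: (_, 'k) endo)"
    proof (cases rule: Ind_cases)
      case (pos l)
      then have "0 < l" by auto
      then show ?thesis
        using pos lz_ld_homog[of N r "int k" l] k lz_weight[of l "int k" N r mdegree "eps l" \<mu>]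
          ld_weight[of mdegree l "int k" "eps l" N r \<mu>]
        by (simp add: dual_simps ipar_def var_weight_def eps_def mdegree_plus Ind_def)
    next
      case (neg l)
      then have "0 < l" by auto
      then show ?thesis
        using neg lz_ld_homog[of N r "- int k" l] k lz_weight[of l "- int k" N r mdegree "eps l" \<mu>]
          ld_weight[of mdegree l "- int k" "eps l" N r \<mu>]
        by (simp add: dual_simps ipar_def var_weight_def eps_def mdegree_plus Ind_def single_uminus)
    qed
    then show "homog (SymL N r) (ipar j) (lz_dual N r k j :: (_, 'k) endo)"
       "homog (SymL N r) (ipar j) (ld_dual N r k j :: (_, 'k) endo)"
       "lz_dual N r k j * deg_proj N r \<mu> =
         deg_proj N r (\<mu> + var_weight j) * (lz_dual N r k j :: (_, 'k) endo)"
       "ld_dual N r k j * deg_proj N r \<mu> =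
         deg_proj N r (\<mu> - var_weight j) * (ld_dual N r k j :: (_, 'k) endo)"
      by blast+
  next
    fix k assume k: "k \<in> {1..N}"
    have "ld N r k (- int l) * lz N r k (- int l) =
        restr (SymL N r) - lz N r k (- int l) * (ld N r k (- int l) :: (_, 'k) endo)" if "l \<in> {1..r}" for l
      using B.dz[OF k k B.Ind_int(2)[OF that] B.Ind_int(2)[OF that]] that by (simp add: isign_def)
    then have "elA k k = (\<Sum>l = 1..r. lz N r k (int l) * ld N r k (int l) -
        (restr (SymL N r) - lz N r k (- int l) * ld N r k (- int l)))"
      using k by (simp add: elA_def T_def dual_simps sum_subtractf)
    also have "\<dots> = diag (\<lambda>b. \<Sum>l = 1..r. (if fst b \<in> sym_basis N r then of_nat (lookup (fst b) (k, int l)) else 0) -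
      ((if b \<in> basis (SymL N r) then 1 else 0) -
       (if fst b \<in> sym_basis N r then of_nat (lookup (fst b) (k, - int l)) else 0)))"
      unfolding number_SymL restr_def diag_minus diag_sum ..
    also have "\<dots> = diag (\<lambda>b. if b \<in> basis (SymL N r) then of_int (lookup (deg_weight b) k - int r) else 0)"
      by (rule arg_cong[where f = diag])
        (auto simp: basis_SymL fun_eq_iff lookup_mdegree[OF _ k] sum_Ind sum_subtractf sum.distrib)
    finally show "elA k k = diag (\<lambda>b. if b \<in> basis (SymL N r) then of_int (lookup (deg_weight b) k - int r) else 0)" .
  qed (auto simp: basis_SymL intro: mdegree_Xwt)
qed

section \<open>The generators as differential operators\<close>

lemma op_Lift:
  assumes "super_weyl m n u z d"
  shows "op_p m (\<lambda>k j. Lift (z k j)) (\<lambda>k j. Lift (d k j)) g = Lift (op_p m z d g)"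
    and "op_pt m (\<lambda>k j. Lift (z k j)) (\<lambda>k j. Lift (d k j)) g = Lift (op_pt m z d g)"
proof -
  interpret A: super_weyl m n u z d by fact
  interpret B: super_weyl m n "Lift u" "\<lambda>k j. Lift (z k j)" "\<lambda>k j. Lift (d k j)"
    by (rule super_weyl_Lift) fact
  have T: "B.T i j = Lift (A.T i j)" for i j by (simp add: A.T_def B.T_def Lift_sum Lift_mult)
  show "op_p m (\<lambda>k j. Lift (z k j)) (\<lambda>k j. Lift (d k j)) g = Lift (op_p m z d g)"
    unfolding op_p_def A.periplectic_gen_def B.periplectic_gen_def A.elA_def B.elA_def A.elB_def B.elB_def
      A.elC_def B.elC_def T by (simp add: Lift_plus Lift_minus split: gen.split)
  show "op_pt m (\<lambda>k j. Lift (z k j)) (\<lambda>k j. Lift (d k j)) g = Lift (op_pt m z d g)"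
    unfolding op_pt_def A.tilde_periplectic_gen_def B.tilde_periplectic_gen_def A.elA_def B.elA_def T
    by (simp add: Lift_plus Lift_minus split: gen.split)
qed

lemma dual_Lift:
  "dual_z (\<lambda>k j. Lift (z k j)) (\<lambda>k j. Lift (d k j)) = (\<lambda>k j. Lift (dual_z z d k j))"
  "dual_d (\<lambda>k j. Lift (z k j)) (\<lambda>k j. Lift (d k j)) = (\<lambda>k j. Lift (dual_d z d k j))"
  by (simp_all add: dual_z_def dual_d_def fun_eq_iff)

lemma lz_ld_eq: "lz N r = (\<lambda>k j. Lift (mult_op N r (k, j)))" "ld N r = (\<lambda>k j. Lift (deriv_op N r (k, j)))"
  by (simp_all add: lz_def ld_def fun_eq_iff)

context
  fixes N r :: nat and v :: "mono \<Rightarrow>\<^sub>0 'k::field_char_0"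
  assumes v: "v \<in> vecs (Sym N r)"
begin

interpretation super_weyl N r "restr (Sym N r) :: (mono, 'k) endo"
    "\<lambda>k j. mult_op N r (k, j)" "\<lambda>k j. deriv_op N r (k, j)"
  by (rule super_weyl_Sym)

abbreviation "Z a \<equiv> mult_op N r a :: (mono, 'k) endo"
abbreviation "\<Delta> a \<equiv> deriv_op N r a :: (mono, 'k) endo"

lemma app_vars:
  assumes "a \<in> {1..N} \<times> Ind r" "b \<in> {1..N} \<times> Ind r"
  shows "app (Z a * Z b) v = zz a (zz b v)" "app (Z a * \<Delta> b) v = zz a (dd b v)"
    "app (\<Delta> a * \<Delta> b) v = dd a (dd b v)"
proof -
  have "app (Z b) v \<in> vecs (Sym N r)" "app (\<Delta> b) v \<in> vecs (Sym N r)"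
    using assms(2) uz[of "fst b" "snd b"] ud[of "fst b" "snd b"] unfolding vecs_iff app_times[symmetric]
    by (auto simp: mem_Times_iff)
  then show "app (Z a * Z b) v = zz a (zz b v)" "app (Z a * \<Delta> b) v = zz a (dd b v)"
    "app (\<Delta> a * \<Delta> b) v = dd a (dd b v)"
    by (simp_all add: app_times mult_op_eq[OF v] deriv_op_eq[OF v] mult_op_eq deriv_op_eq)
qed

lemma nat_act_T:
  assumes "i \<in> Ind r" "j \<in> Ind r"
  shows "nat_act N r (Emat i j) v = app (T i j) v"
proof -
  have "nat_act N r (Emat i j) v = (\<Sum>t = 1..N. \<Sum>a\<in>Ind r. if a = i then \<Sum>b\<in>Ind r.
      if b = j then zz (t, i) (dd (t, j) v) else 0 else 0)"
    unfolding nat_act_def by (intro sum.cong refl) (auto simp: Emat_def scl_zero intro!: sum.cong sum.neutral)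
  also have "\<dots> = (\<Sum>t = 1..N. zz (t, i) (dd (t, j) v))"
    using assms by (simp add: finite_Ind)
  also have "\<dots> = app (T i j) v"
    unfolding T_def app_sum_endo using assms by (intro sum.cong refl) (simp add: app_vars)
  finally show ?thesis .
qed

lemma nat_act_minus: "nat_act N r (\<lambda>a b. X a b - Y a b) v = nat_act N r X v - nat_act N r Y v"
  by (simp add: nat_act_def scl.scale_left_diff_distrib sum_subtractf)

lemma nat_act_plus: "nat_act N r (\<lambda>a b. X a b + Y a b) v = nat_act N r X v + nat_act N r Y v"
  by (simp add: nat_act_def scl.scale_left_distrib sum.distrib)

lemma nat_act_gens:
  assumes "i \<in> Ind r" "j \<in> Ind r"
  shows "nat_act N r (mat_a i j) v = app (T i j - T (- j) (- i)) v"
    and "i \<noteq> j \<Longrightarrow> nat_act N r (mat_b i j) v = app (T i (- j) + T j (- i)) v"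
    and "nat_act N r (mat_b i i) v = app (T i (- i)) v"
    and "nat_act N r (mat_c i j) v = app (T (- i) j - T (- j) i) v"
    and "i \<noteq> j \<Longrightarrow> nat_act N r (mat_bt i j) v = app (T (- i) j + T (- j) i) v"
    and "nat_act N r (mat_bt i i) v = app (T (- i) i) v"
    and "nat_act N r (mat_ct i j) v = app (T i (- j) - T j (- i)) v"
proof -
  have half: "(1 / 2) * (x + x) = x" for x :: 'k by simp
  note I = assms iffD2[OF Ind_uminus assms(1)] iffD2[OF Ind_uminus assms(2)]
  show "nat_act N r (mat_a i j) v = app (T i j - T (- j) (- i)) v"
    "nat_act N r (mat_c i j) v = app (T (- i) j - T (- j) i) v"
    "nat_act N r (mat_ct i j) v = app (T i (- j) - T j (- i)) v"
    unfolding mat_a_def mat_c_def mat_ct_def nat_act_minus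
    by (simp_all add: nat_act_T I app_minus)
  show "nat_act N r (mat_b i j) v = app (T i (- j) + T j (- i)) v" if "i \<noteq> j"
    using that by (simp add: mat_b_def nat_act_plus nat_act_T I app_plus)
  show "nat_act N r (mat_bt i j) v = app (T (- i) j + T (- j) i) v" if "i \<noteq> j"
    using that by (simp add: mat_bt_def nat_act_plus nat_act_T I app_plus)
  have "mat_b i i = (Emat i (- i) :: _ \<Rightarrow> _ \<Rightarrow> 'k)" "mat_bt i i = (Emat (- i) i :: _ \<Rightarrow> _ \<Rightarrow> 'k)"
    by (auto simp: fun_eq_iff mat_b_def mat_bt_def Emat_def)
  then show "nat_act N r (mat_b i i) v = app (T i (- i)) v" "nat_act N r (mat_bt i i) v = app (T (- i) i) v"
    by (simp_all add: nat_act_T I)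
qed

lemma gens_Ind:
  assumes "g \<in> gens k"
  shows "\<And>i. g \<in> {GE i, GF i, GB i, GC i} \<Longrightarrow> i \<in> {1..k} \<and> i + 1 \<in> {1..k}"
  using assms by (auto simp: gens_def)

lemma opA_p_eq:
  assumes "g \<in> gens r" "1 \<le> r"
  shows "opA_p N r g v = app (op_p N (\<lambda>k j. Z (k, j)) (\<lambda>k j. \<Delta> (k, j)) g) v"
proof (cases g)
  case GB11
  then show ?thesis
    using nat_act_gens(3)[of 1 1] assms(2) by (simp add: op_p_def periplectic_gen_def Ind_def)
next
  case (GE i)
  note I = Ind_int(1)[of i] Ind_int(1)[of "i + 1"] gens_Ind[OF assms(1), of i]
  then show ?thesis unfolding GE op_p_def periplectic_gen_def gen.case elA_def opA_p.simps
    using nat_act_gens(1)[of "int i" "int (i + 1)"] GE by (simp add: add.commute)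
next
  case (GF i)
  note I = Ind_int(1)[of i] Ind_int(1)[of "i + 1"] gens_Ind[OF assms(1), of i]
  then show ?thesis unfolding GF op_p_def periplectic_gen_def gen.case elA_def opA_p.simps
    using nat_act_gens(1)[of "int (i + 1)" "int i"] GF by (simp add: add.commute)
next
  case (GB i)
  note I = Ind_int(1)[of i] Ind_int(1)[of "i + 1"] gens_Ind[OF assms(1), of i]
  then show ?thesis unfolding GB op_p_def periplectic_gen_def gen.case elB_def opA_p.simps
    using nat_act_gens(2)[of "int i" "int (i + 1)"] GB by (simp add: add.commute)
next
  case (GC i)
  note I = Ind_int(1)[of i] Ind_int(1)[of "i + 1"] gens_Ind[OF assms(1), of i]
  then show ?thesis unfolding GC op_p_def periplectic_gen_def gen.case elC_def opA_p.simps
    using nat_act_gens(4)[of "int i" "int (i + 1)"] GC by (simp add: add.commute)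
qed

lemma opA'_pt_eq:
  assumes "g \<in> gens r" "1 \<le> r"
  shows "opA'_pt r N g v = app (op_pt N (\<lambda>k j. Z (k, j)) (\<lambda>k j. \<Delta> (k, j)) g) v"
proof (cases g)
  case GB11
  then show ?thesis
    using nat_act_gens(6)[of 1 1] assms(2) by (simp add: op_pt_def tilde_periplectic_gen_def Ind_def)
next
  case (GE i)
  note I = Ind_int(1)[of i] Ind_int(1)[of "i + 1"] gens_Ind[OF assms(1), of i]
  then show ?thesis unfolding GE op_pt_def tilde_periplectic_gen_def gen.case elA_def opA'_pt.simps
    using nat_act_gens(1)[of "int i" "int (i + 1)"] GE by (simp add: add.commute)
next
  case (GF i)
  note I = Ind_int(1)[of i] Ind_int(1)[of "i + 1"] gens_Ind[OF assms(1), of i]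
  then show ?thesis unfolding GF op_pt_def tilde_periplectic_gen_def gen.case elA_def opA'_pt.simps
    using nat_act_gens(1)[of "int (i + 1)" "int i"] GF by (simp add: add.commute)
next
  case (GB i)
  note I = Ind_int(1)[of i] Ind_int(1)[of "i + 1"] gens_Ind[OF assms(1), of i]
  then show ?thesis unfolding GB op_pt_def tilde_periplectic_gen_def gen.case opA'_pt.simps
    using nat_act_gens(5)[of "int i" "int (i + 1)"] GB by (simp add: add.commute)
next
  case (GC i)
  note I = Ind_int(1)[of i] Ind_int(1)[of "i + 1"] gens_Ind[OF assms(1), of i]
  then show ?thesis unfolding GC op_pt_def tilde_periplectic_gen_def gen.case opA'_pt.simps
    using nat_act_gens(7)[of "int i" "int (i + 1)"] GC by (simp add: add.commute)
qed

lemma app_invariants: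
  assumes "i \<in> {1..N}" "j \<in> {1..N}"
  shows "app (Euler i j) v = (\<Sum>a\<in>Ind r. zz (i, a) (dd (j, a) v))"
    and "app (Laplace i j) v = (\<Sum>a\<in>Ind r. dd (i, a) (dd (j, - a) v))"
    and "app (Form i j) v = (\<Sum>a\<in>Ind r. scl (ksign (ipar a)) (zz (i, a) (zz (j, - a) v)))"
  unfolding Euler_def Laplace_def Form_def app_sum_endo
  using assms by (auto intro!: sum.cong simp: app_vars Ind_uminus ipar_def ksign_def app_uminus)

lemma opA_pt_eq:
  assumes "g \<in> gens N" "1 \<le> N"
  shows "opA_pt N r g v = app (op_pt r (dual_z (\<lambda>k j. Z (k, j)) (\<lambda>k j. \<Delta> (k, j)))
    (dual_d (\<lambda>k j. Z (k, j)) (\<lambda>k j. \<Delta> (k, j))) g) v"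
proof (cases g)
  case GB11
  \<comment> \<open>The generator is a sum over \<open>l > 0\<close> only, which is half of the contraction.\<close>
  have swap: "dd (1, - int l) (dd (1, int l) v) = dd (1, int l) (dd (1, - int l) v)" if "l \<in> {1..r}" for l
  proof -
    have "app (\<Delta> (1, - int l) * \<Delta> (1, int l)) v = app (\<Delta> (1, int l) * \<Delta> (1, - int l)) v"
      using dd[of 1 1 "- int l" "int l"] assms(2) Ind_int[OF that] by (simp add: isign_def)
    then show ?thesis
      using assms(2) Ind_int[OF that] by (simp add: app_vars)
  qed
  have "app (Laplace 1 1) v = (\<Sum>l = 1..r. dd (1, int l) (dd (1, - int l) v) + dd (1, int l) (dd (1, - int l) v))"
    using assms(2) swap by (subst app_invariants(2)) (auto simp: sum_Ind intro!: sum.cong)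
  then have "app (scalar (1/2) * Laplace 1 1) v =
      scl (1/2) ((\<Sum>l = 1..r. dd (1, int l) (dd (1, - int l) v)) + (\<Sum>l = 1..r. dd (1, int l) (dd (1, - int l) v)))"
    by (simp only: app_times app_scalar sum.distrib)
  also have "\<dots> = (\<Sum>l = 1..r. dd (1, int l) (dd (1, - int l) v))"
    by (simp only: scl.scale_right_distrib scl.scale_left_distrib[symmetric]) simp
  also have "\<dots> = (\<Sum>a = 1..int r. dd (1, a) (dd (1, - a) v))"
    by (rule sum.reindex_bij_witness[where i = nat and j = int]) auto
  finally show ?thesis using dual_gens[OF assms] GB11 by simp
next
  case (GE i)
  then show ?thesis using dual_gens[OF assms] gens_Ind[OF assms(1), of i] by (simp add: app_invariants)
next
  case (GF i)
  then show ?thesis using dual_gens[OF assms] gens_Ind[OF assms(1), of i] by (simp add: app_invariants)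
next
  case (GB i)
  then show ?thesis using dual_gens[OF assms] gens_Ind[OF assms(1), of i] by (simp add: app_invariants)
next
  case (GC i)
  then show ?thesis using dual_gens[OF assms] gens_Ind[OF assms(1), of i] by (simp add: app_invariants)
qed

lemma opA'_p_eq:
  assumes "g \<in> gens N" "1 \<le> N"
  shows "opA'_p r N g v = app (op_p r (dual_z (\<lambda>k j. Z (k, j)) (\<lambda>k j. \<Delta> (k, j)))
    (dual_d (\<lambda>k j. Z (k, j)) (\<lambda>k j. \<Delta> (k, j))) g) v"
proof -
  interpret dual: super_weyl r N "restr (Sym N r) :: (mono, 'k) endo"
    "dual_z (\<lambda>k j. Z (k, j)) (\<lambda>k j. \<Delta> (k, j))" "dual_d (\<lambda>k j. Z (k, j)) (\<lambda>k j. \<Delta> (k, j))"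
    by (rule dual)
  have pt: "op_pt r (dual_z (\<lambda>k j. Z (k, j)) (\<lambda>k j. \<Delta> (k, j))) (dual_d (\<lambda>k j. Z (k, j)) (\<lambda>k j. \<Delta> (k, j))) g =
      dual.tilde_periplectic_gen g" for g
    by (simp add: op_pt_def)
  show ?thesis
  proof (cases g)
    case GB11
    have "app (dual.T 1 (- 1)) v = (\<Sum>l = 1..r. zz (1, int l) (zz (1, - int l) v))"
      using assms(2) dual_simps[of 1 "\<lambda>k j. Z (k, j)" "\<lambda>k j. \<Delta> (k, j)"]
      by (simp add: dual.T_def app_sum_endo app_vars Ind_int)
    also have "\<dots> = (\<Sum>a = 1..int r. zz (1, a) (zz (1, - a) v))"
      by (rule sum.reindex_bij_witness[where i = nat and j = int]) auto
    finally show ?thesis using GB11 by (simp add: op_p_def dual.periplectic_gen_def zz'_def)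
  next
    case (GE i)
    then have "app (op_pt r (dual_z (\<lambda>k j. Z (k, j)) (\<lambda>k j. \<Delta> (k, j))) (dual_d (\<lambda>k j. Z (k, j)) (\<lambda>k j. \<Delta> (k, j))) g) v =
        app (Euler i (i + 1)) v"
      using dual_gens[OF assms] by simp
    then show ?thesis using GE gens_Ind[OF assms(1), of i]
      by (simp add: pt op_p_def dual.tilde_periplectic_gen_def dual.periplectic_gen_def app_invariants zz'_def dd'_def)
  next
    case (GF i)
    then have "app (op_pt r (dual_z (\<lambda>k j. Z (k, j)) (\<lambda>k j. \<Delta> (k, j))) (dual_d (\<lambda>k j. Z (k, j)) (\<lambda>k j. \<Delta> (k, j))) g) v =
        app (Euler (i + 1) i) v"
      using dual_gens[OF assms] by simp
    then show ?thesis using GF gens_Ind[OF assms(1), of i]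
      by (simp add: pt op_p_def dual.tilde_periplectic_gen_def dual.periplectic_gen_def app_invariants zz'_def dd'_def)
  next
    case (GB i)
    then have i: "i \<in> {1..N}" "i + 1 \<in> {1..N}" using gens_Ind[OF assms(1), of i] by auto
    have "Z (i + 1, int l) * Z (i, - int l) = Z (i, - int l) * Z (i + 1, int l)" if "l \<in> {1..r}" for l
      using zz[OF i(2,1) Ind_int[OF that]] by (simp add: isign_def)
    then have "dual.elB i (i + 1) = (\<Sum>a\<in>Ind r. Z (i, a) * Z (i + 1, - a))"
      using i by (simp add: dual.elB_def dual.T_def dual_simps[of i] dual_simps[of "Suc i", OF zero_less_Suc] sum_Ind sum.distrib del: of_nat_Suc)
    then have "app (dual.elB i (i + 1)) v = (\<Sum>a\<in>Ind r. zz (i, a) (zz (i + 1, - a) v))"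
      using i by (simp add: app_sum_endo app_vars Ind_uminus)
    then show ?thesis using GB by (simp add: op_p_def dual.periplectic_gen_def zz'_def)
  next
    case (GC i)
    then have i: "i \<in> {1..N}" "i + 1 \<in> {1..N}" using gens_Ind[OF assms(1), of i] by auto
    have sw: "dd (i + 1, - int l) (dd (i, int l) v) = dd (i, int l) (dd (i + 1, - int l) v)" if "l \<in> {1..r}" for l
    proof -
      have "app (\<Delta> (i + 1, - int l) * \<Delta> (i, int l)) v = app (\<Delta> (i, int l) * \<Delta> (i + 1, - int l)) v"
        using dd[OF i(2,1) Ind_int(2,1)[OF that]] by (simp add: isign_def)
      then show ?thesis using i Ind_int[OF that] by (simp add: app_vars)
    qed
    have "app (dual.elC i (i + 1)) v = (\<Sum>l = 1..r. dd (i, - int l) (dd (i + 1, int l) v) -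
        dd (i, int l) (dd (i + 1, - int l) v))"
      using i sw by (simp add: dual.elC_def dual.T_def dual_simps[of i] dual_simps[of "Suc i", OF zero_less_Suc]
          app_minus app_sum_endo sum_subtractf app_vars Ind_int del: of_nat_Suc)
    also have "\<dots> = (\<Sum>a\<in>Ind r. scl (ksign (ipar a)) (dd (i, - a) (dd (i + 1, a) v)))"
      unfolding sum_Ind by (intro sum.cong refl) (auto simp: ipar_def ksign_def)
    finally show ?thesis using GC by (simp add: op_p_def dual.periplectic_gen_def dd'_def)
  qed
qed

end

section \<open>The map \<open>\<phi>\<close>\<close>

text \<open>The monomial of \<open>\<phi>(e)\<close>: the even exponents are transposed, the odd ones transposed and
  complemented.\<close>

definition flip :: "nat \<Rightarrow> nat \<Rightarrow> mono \<Rightarrow> mono" where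
  "flip m n e = (\<Sum>k = 1..m. \<Sum>l = 1..n. Poly_Mapping.single (k, int l) (lookup e (l, int k)) +
     Poly_Mapping.single (k, - int l) (1 - lookup e (l, - int k)))"

definition phi_sign :: "nat \<Rightarrow> nat \<Rightarrow> mono \<Rightarrow> 'k::field" where
  "phi_sign m n e = (- 1) ^ (kappa m n (\<lambda>k l. lookup e (l, - int k)) + chi m n (\<lambda>k l. lookup e (l, - int k)))"

lemma phi_basvec: "phi m n (basvec e) = Poly_Mapping.single (flip m n e) (phi_sign m n e)"
  by (simp add: phi_def flip_def phi_sign_def Let_def)

lemma phi_sign_square: "phi_sign m n e * phi_sign m n e = (1 :: 'k::field)"
  by (simp add: phi_sign_def power_add[symmetric] flip: mult_2)

lemma lookup_flip:
  "lookup (flip m n e) (k, j) = (if k \<in> {1..m} \<and> j \<in> Ind n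
     then if 0 < j then lookup e (nat j, int k) else 1 - lookup e (nat (- j), - int k) else 0)"
proof -
  have "lookup (flip m n e) (k, j) = (\<Sum>k' = 1..m. \<Sum>l = 1..n. if k' = k
      then (if int l = j then lookup e (l, int k) else 0) + (if - int l = j then 1 - lookup e (l, - int k) else 0) else 0)"
    unfolding flip_def lookup_sum
    by (intro sum.cong refl) (auto simp: lookup_add lookup_single when_def)
  also have "\<dots> = (\<Sum>k' = 1..m. if k' = k then \<Sum>l = 1..n.
      (if int l = j then lookup e (l, int k) else 0) + (if - int l = j then 1 - lookup e (l, - int k) else 0) else 0)"
    by (intro sum.cong refl) auto
  also have "\<dots> = (if k \<in> {1..m} then (\<Sum>l = 1..n. if int l = j then lookup e (l, int k) else 0) +
      (\<Sum>l = 1..n. if - int l = j then 1 - lookup e (l, - int k) else 0) else 0)"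
    by (simp add: sum.distrib)
  also have "(\<Sum>l = 1..n. if int l = j then lookup e (l, int k) else 0) =
      (if 0 < j \<and> j \<in> Ind n then lookup e (nat j, int k) else 0)"
  proof -
    have "(\<Sum>l = 1..n. if int l = j then lookup e (l, int k) else 0) =
        (\<Sum>l = 1..n. if l = nat j then if 0 < j then lookup e (nat j, int k) else 0 else 0)"
      by (intro sum.cong refl) auto
    then show ?thesis by (auto simp: Ind_def)
  qed
  also have "(\<Sum>l = 1..n. if - int l = j then 1 - lookup e (l, - int k) else 0) =
      (if j < 0 \<and> j \<in> Ind n then 1 - lookup e (nat (- j), - int k) else 0)"
  proof -
    have "(\<Sum>l = 1..n. if - int l = j then 1 - lookup e (l, - int k) else 0) =
        (\<Sum>l = 1..n. if l = nat (- j) then if j < 0 then 1 - lookup e (nat (- j), - int k) else 0 else 0)"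
      by (intro sum.cong refl) auto
    then show ?thesis by (auto simp: Ind_def)
  qed
  finally show ?thesis using zero_notin_Ind[of n] by (auto)
qed

lemma lookup_flip_int:
  assumes "k \<in> {1..m}" "l \<in> {1..n}"
  shows "lookup (flip m n e) (k, int l) = lookup e (l, int k)"
    and "lookup (flip m n e) (k, - int l) = 1 - lookup e (l, - int k)"
  using assms by (auto simp: lookup_flip Ind_def)

lemma sym_basis_iff: "e \<in> sym_basis N r \<longleftrightarrow>
    (\<forall>a. a \<notin> {1..N} \<times> Ind r \<longrightarrow> lookup e a = 0) \<and> (\<forall>a. snd a < 0 \<longrightarrow> lookup e a \<le> 1)"
proof
  assume e: "e \<in> sym_basis N r"
  then have "keys e \<subseteq> {1..N} \<times> Ind r" by (simp add: sym_basis_def)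
  then have "lookup e a = 0" if "a \<notin> {1..N} \<times> Ind r" for a
    using that by (metis in_keys_iff subsetD)
  then show "(\<forall>a. a \<notin> {1..N} \<times> Ind r \<longrightarrow> lookup e a = 0) \<and> (\<forall>a. snd a < 0 \<longrightarrow> lookup e a \<le> 1)"
    using sym_basis_odd[OF e] by simp
next
  assume a: "(\<forall>a. a \<notin> {1..N} \<times> Ind r \<longrightarrow> lookup e a = 0) \<and> (\<forall>a. snd a < 0 \<longrightarrow> lookup e a \<le> 1)"
  show "e \<in> sym_basis N r"
    unfolding sym_basis_def
  proof (intro CollectI conjI subsetI ballI)
    fix x assume "x \<in> keys e"
    then have x: "lookup e x \<noteq> 0" by (simp add: in_keys_iff)
    with conjunct1[OF a, rule_format, of x] show "x \<in> {1..N} \<times> Ind r" by metis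
    have "lookup e x = 1" if "snd x < 0"
    proof -
      have "lookup e x \<le> 1" using conjunct2[OF a, rule_format, of x] that .
      then show ?thesis using x by linarith
    qed
    then show "case x of (t, j) \<Rightarrow> j < 0 \<longrightarrow> lookup e (t, j) = 1" by (cases x) simp
  qed
qed

lemma flip_sym_basis: "flip m n e \<in> sym_basis m n"
  unfolding sym_basis_iff by (auto simp: lookup_flip)

lemma flip_flip:
  assumes "e \<in> sym_basis n m"
  shows "flip n m (flip m n e) = e"
proof (rule poly_mapping_eqI)
  fix a :: var
  obtain l i where a: "a = (l, i)" by (cases a)
  show "lookup (flip n m (flip m n e)) a = lookup e a"
  proof (cases "l \<in> {1..n} \<and> i \<in> Ind m")
    case True
    then have l: "l \<in> {1..n}" by blast
    from True have "i \<in> Ind m" by blast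
    then show ?thesis
    proof (cases rule: Ind_cases)
      case (pos k)
      then show ?thesis using l by (simp add: a lookup_flip_int)
    next
      case (neg k)
      then have "lookup e (l, - int k) \<le> 1" using assms by (auto simp: sym_basis_iff)
      then show ?thesis using l neg by (simp add: a lookup_flip_int)
    qed
  next
    case False
    then show ?thesis using assms flip_sym_basis[of n m "flip m n e"] unfolding sym_basis_iff a by auto
  qed
qed

lemma flip_plus:
  assumes "k \<in> {1..m}" "l \<in> {1..n}"
  shows "flip m n (e + var_mono (l, int k)) = flip m n e + var_mono (k, int l)"
    and "flip m n (e + var_mono (l, - int k)) = flip m n e - var_mono (k, - int l)"
proof -
  have "lookup (flip m n (e + var_mono (l, int k))) (k', i) = lookup (flip m n e + var_mono (k, int l)) (k', i) \<and>
      lookup (flip m n (e + var_mono (l, - int k))) (k', i) = lookup (flip m n e - var_mono (k, - int l)) (k', i)"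
    for k' i
  proof (cases "k' \<in> {1..m} \<and> i \<in> Ind n")
    case True
    then have "i \<in> Ind n" "k' \<in> {1..m}" by auto
    then show ?thesis
      using assms
      by (cases rule: Ind_cases)
        (auto simp: lookup_flip_int lookup_add lookup_minus lookup_var_mono)
  next
    case False
    then have "(k, int l) \<noteq> (k', i)" "(k, - int l) \<noteq> (k', i)" using assms by (auto simp: Ind_def)
    then show ?thesis using False by (auto simp: lookup_flip lookup_add lookup_minus lookup_var_mono)
  qed
  then show "flip m n (e + var_mono (l, int k)) = flip m n e + var_mono (k, int l)"
    "flip m n (e + var_mono (l, - int k)) = flip m n e - var_mono (k, - int l)"
    by (auto intro: poly_mapping_eqI)
qed

text \<open>Complementing the \<open>m\<close> odd exponents with index \<open>l\<close> turns the contribution \<open>\<Sum>\<epsilon>\<close> to the degree into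
  \<open>-\<Sum>(1 - \<epsilon>)\<close> in the weight, a difference of \<open>m\<close>. This is the shift by \<open>m\<delta>\<^sub>n\<close>.\<close>

lemma mweight_flip:
  assumes "e \<in> sym_basis n m"
  shows "mweight (flip m n e) + adelta m n = mdegree e"
proof (rule poly_mapping_eqI)
  fix i
  show "lookup (mweight (flip m n e) + adelta m n) i = lookup (mdegree e) i"
  proof (cases "i \<in> {1..n}")
    case True
    have "int (1 - lookup e (i, - int t)) = 1 - int (lookup e (i, - int t))" if "t \<in> {1..m}" for t
    proof -
      have "lookup e (i, - int t) \<le> 1" using assms that unfolding sym_basis_iff by auto
      then show ?thesis by simp
    qed
    then show ?thesis using True
      by (simp add: lookup_add lookup_mweight[OF flip_sym_basis True] lookup_adelta lookup_mdegree[OF assms True]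
          sum_Ind lookup_flip_int sum.distrib sum_subtractf)
  next
    case False
    then have "i \<notin> keys (mweight (flip m n e))" "i \<notin> keys (mdegree e)"
      using mweight_Xwt[OF flip_sym_basis, of m n e] mdegree_Xwt[OF assms] by (auto simp: Xwt_def)
    then show ?thesis using False by (auto simp: lookup_add lookup_adelta in_keys_iff)
  qed
qed

lemma mdegree_flip:
  assumes "e \<in> sym_basis n m"
  shows "mdegree (flip m n e) = mweight e + adelta n m"
  using mweight_flip[OF flip_sym_basis[of m n e]]
    flip_flip[OF assms] by simp

text \<open>The positions of the odd variables that are absent from a monomial.\<close>

definition holes :: "nat \<Rightarrow> nat \<Rightarrow> mono \<Rightarrow> (nat \<times> nat) set" where
  "holes m n e = {(k, l). k \<in> {1..m} \<and> l \<in> {1..n} \<and> lookup e (l, - int k) = 0}"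

definition inversions :: "(nat \<times> nat) set \<Rightarrow> (nat \<times> nat \<times> nat \<times> nat) set" where
  "inversions S = {(k, k', l, l'). (k, l) \<in> S \<and> (k', l') \<in> S \<and> k < k' \<and> l' < l}"

lemma finite_holes: "finite (holes m n e)"
  by (rule finite_subset[of _ "{1..m} \<times> {1..n}"]) (auto simp: holes_def)

lemma finite_inversions: "finite S \<Longrightarrow> finite (inversions S)"
  by (rule finite_subset[of _ "fst ` S \<times> fst ` S \<times> snd ` S \<times> snd ` S"])
    (auto simp: inversions_def image_iff, (metis fst_conv snd_conv)+)

lemma kappa_eq:
  assumes "e \<in> sym_basis n m"
  shows "kappa m n (\<lambda>k l. lookup e (l, - int k)) = card (inversions (holes m n e))"
proof -
  let ?Q = "{(k, k', l, l'). 1 \<le> k \<and> k < k' \<and> k' \<le> m \<and> 1 \<le> l' \<and> l' < l \<and> l \<le> n}"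
  have fin: "finite ?Q"
    by (rule finite_subset[of _ "{..m} \<times> {..m} \<times> {..n} \<times> {..n}"]) auto
  have "lookup e (l, - int k) \<le> 1" if "1 \<le> k" for k l
    using assms that by (auto simp: sym_basis_iff)
  then have "kappa m n (\<lambda>k l. lookup e (l, - int k)) =
      (\<Sum>x\<in>?Q. if x \<in> inversions (holes m n e) then 1 else 0)"
    unfolding kappa_def
    by (intro sum.cong refl) (fastforce simp: inversions_def holes_def le_Suc_eq)
  also have "\<dots> = card (?Q \<inter> inversions (holes m n e))"
    using fin by (simp add: sum.inter_restrict[symmetric])
  also have "?Q \<inter> inversions (holes m n e) = inversions (holes m n e)"
    by (auto simp: inversions_def holes_def)
  finally show ?thesis .
qed

lemma card_inversions_insert:
  assumes "finite S" "(k0, l0) \<notin> S"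
  shows "card (inversions (insert (k0, l0) S)) = card (inversions S) +
    card {(k, l) \<in> S. k < k0 \<and> l0 < l \<or> k0 < k \<and> l < l0}"
proof -
  let ?L = "{(k, l) \<in> S. k < k0 \<and> l0 < l}" and ?R = "{(k, l) \<in> S. k0 < k \<and> l < l0}"
  have fin: "finite ?L" "finite ?R" "finite (inversions S)"
    using assms(1) finite_inversions by (auto intro: finite_subset[of _ S])
  have ins: "inversions (insert (k0, l0) S) = inversions S \<union>
      ((\<lambda>(k, l). (k, k0, l, l0)) ` ?L \<union> (\<lambda>(k, l). (k0, k, l0, l)) ` ?R)"
    by (auto simp: inversions_def image_iff)
  have "inversions S \<inter> ((\<lambda>(k, l). (k, k0, l, l0)) ` ?L \<union> (\<lambda>(k, l). (k0, k, l0, l)) ` ?R) = {}"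
    using assms(2) by (auto simp: inversions_def)
  moreover have "(\<lambda>(k, l). (k, k0, l, l0)) ` ?L \<inter> (\<lambda>(k, l). (k0, k, l0, l)) ` ?R = {}"
    by auto
  moreover have "card ((\<lambda>(k, l). (k, k0, l, l0)) ` ?L) = card ?L"
    "card ((\<lambda>(k, l). (k0, k, l0, l)) ` ?R) = card ?R"
    by (auto intro!: card_image simp: inj_on_def)
  ultimately have "card (inversions (insert (k0, l0) S)) = card (inversions S) + (card ?L + card ?R)"
    unfolding ins using fin by (simp add: card_Un_disjoint)
  moreover have "card ?L + card ?R = card (?L \<union> ?R)"
    using fin by (intro card_Un_disjoint[symmetric]) auto
  moreover have "?L \<union> ?R = {(k, l) \<in> S. k < k0 \<and> l0 < l \<or> k0 < k \<and> l < l0}" by auto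
  ultimately show ?thesis by simp
qed

lemma holes_plus_odd:
  assumes "k \<in> {1..m}" "l \<in> {1..n}"
  shows "holes m n (e + var_mono (l, - int k)) = holes m n e - {(k, l)}"
  using assms by (auto simp: holes_def lookup_add lookup_var_mono)

lemma chi_plus_odd:
  assumes "k \<in> {1..m}" "l \<in> {1..n}"
  shows "chi m n (\<lambda>k' l'. lookup (e + var_mono (l, - int k)) (l', - int k')) =
    chi m n (\<lambda>k' l'. lookup e (l', - int k')) + (m * l + m + m * n + k + 1)"
proof -
  have "chi m n (\<lambda>k' l'. lookup (e + var_mono (l, - int k)) (l', - int k')) =
      (\<Sum>k' = 1..m. \<Sum>l' = 1..n. (m * l' + m + m * n + k' + 1) * lookup e (l', - int k') +
        (if k' = k then if l' = l then m * l + m + m * n + k + 1 else 0 else 0))"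
    unfolding chi_def by (intro sum.cong refl) (auto simp: lookup_add lookup_var_mono algebra_simps)
  also have "\<dots> = chi m n (\<lambda>k' l'. lookup e (l', - int k')) +
      (\<Sum>k' = 1..m. \<Sum>l' = 1..n. if k' = k then if l' = l then m * l + m + m * n + k + 1 else 0 else 0)"
    unfolding chi_def by (simp only: sum.distrib)
  also have "(\<Sum>k' = 1..m. \<Sum>l' = 1..n. if k' = k then if l' = l then m * l + m + m * n + k + 1 else 0 else 0) =
      (\<Sum>k' = 1..m. if k' = k then m * l + m + m * n + k + 1 else 0)"
    using assms(2) by (intro sum.cong refl) auto
  also have "\<dots> = m * l + m + m * n + k + 1" using assms(1) by simp
  finally show ?thesis .
qed

lemma oddvars_holes:
  assumes "e \<in> sym_basis n m"
  shows "oddvars e = (\<lambda>(k, l). (l, - int k)) ` ({1..m} \<times> {1..n} - holes m n e)"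
    and "oddvars (flip m n e) = (\<lambda>(k, l). (k, - int l)) ` holes m n e"
proof -
  have odd: "\<exists>k l. b = (l, - int k) \<and> l \<in> {1..N} \<and> k \<in> {1..r}"
    if "f \<in> sym_basis N r" "b \<in> oddvars f" for f b N r
  proof -
    have "b \<in> {1..N} \<times> Ind r" "snd b < 0" using that by (auto simp: sym_basis_def oddvars_def)
    then show ?thesis by (cases b) (auto elim!: Ind_cases)
  qed
  show "oddvars e = (\<lambda>(k, l). (l, - int k)) ` ({1..m} \<times> {1..n} - holes m n e)"
  proof (intro set_eqI iffI)
    fix b assume b: "b \<in> oddvars e"
    from odd[OF assms b] obtain k l where "b = (l, - int k)" "l \<in> {1..n}" "k \<in> {1..m}" by blast
    then show "b \<in> (\<lambda>(k, l). (l, - int k)) ` ({1..m} \<times> {1..n} - holes m n e)"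
      using b by (intro image_eqI[of _ _ "(k, l)"]) (auto simp: holes_def oddvars_def in_keys_iff)
  qed (auto simp: holes_def in_keys_iff oddvars_def)
  show "oddvars (flip m n e) = (\<lambda>(k, l). (k, - int l)) ` holes m n e"
  proof (intro set_eqI iffI)
    fix b assume b: "b \<in> oddvars (flip m n e)"
    from odd[OF flip_sym_basis b] obtain k l where "b = (k, - int l)" "l \<in> {1..n}" "k \<in> {1..m}" by blast
    then show "b \<in> (\<lambda>(k, l). (k, - int l)) ` holes m n e"
      using b by (intro image_eqI[of _ _ "(k, l)"])
        (auto simp: holes_def oddvars_def in_keys_iff lookup_flip_int)
  qed (auto simp: holes_def in_keys_iff oddvars_def lookup_flip_int)
qed

lemma inj_on_positions:
  "inj_on (\<lambda>(k :: nat, l :: nat). (l, - int k)) S" "inj_on (\<lambda>(k :: nat, l :: nat). (k, - int l)) S"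
  by (auto simp: inj_on_def)

lemma cbelow_oddvars:
  assumes "e \<in> sym_basis n m" "k \<in> {1..m}" "l \<in> {1..n}"
  shows "cbelow (l, - int k) (oddvars e) =
    card ({(k', l') \<in> {1..m} \<times> {1..n}. l' < l \<or> l' = l \<and> k' < k} - holes m n e)"
proof -
  have "{b \<in> oddvars e. vless b (l, - int k)} = (\<lambda>(k', l'). (l', - int k')) `
      ({(k', l') \<in> {1..m} \<times> {1..n}. l' < l \<or> l' = l \<and> k' < k} - holes m n e)"
    unfolding oddvars_holes(1)[OF assms(1)] by (auto simp: vless_def)
  then show ?thesis by (simp add: cbelow_def card_image inj_on_positions)
qed

lemma cbelow_oddvars_flip:
  assumes "e \<in> sym_basis n m" "k \<in> {1..m}" "l \<in> {1..n}"
  shows "cbelow (k, - int l) (oddvars (flip m n e)) =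
    card {(k', l') \<in> holes m n e. k' < k \<or> k' = k \<and> l' < l}"
proof -
  have "{b \<in> oddvars (flip m n e). vless b (k, - int l)} = (\<lambda>(k', l'). (k', - int l')) `
      {(k', l') \<in> holes m n e. k' < k \<or> k' = k \<and> l' < l}"
    unfolding oddvars_holes(2)[OF assms(1)] by (auto simp: vless_def)
  then show ?thesis by (simp add: cbelow_def card_image inj_on_positions)
qed

lemma minus_one_power_cong: "even (a + b) \<Longrightarrow> (- 1 :: 'k::field) ^ a = (- 1) ^ b"
  by (simp add: minus_one_power_iff)

text \<open>Multiplication by \<open>w\<^bsub>-k\<^esub>\<close> in the factor \<open>l\<close> fills the hole \<open>(k, l)\<close>. Modulo two, \<open>\<kappa>\<close> changes by the
  number of holes that are inverted with \<open>(k, l)\<close>. The sign \<open>osign\<close> of the derivation on the other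
  side counts the holes before \<open>(k, l)\<close> in the lexicographic order of \<open>(k, l)\<close>; together with
  the inverted holes these are the holes before \<open>(k, l)\<close> in the lexicographic order of
  \<open>(l, k)\<close>. The sign of the multiplication counts the occupied positions before \<open>(k, l)\<close> in the
  latter order. Holes and occupied positions add up to all \<open>m(l - 1) + (k - 1)\<close> positions, and the
  change \<open>ml + m + mn + k + 1\<close> of \<open>\<chi>\<close> turns this into \<open>mn\<close>.\<close>

lemma phi_sign_plus_odd:
  assumes e: "e \<in> sym_basis n m" and k: "k \<in> {1..m}" and l: "l \<in> {1..n}"
    and hole: "(l, - int k) \<notin> oddvars e"
  shows "phi_sign m n (e + var_mono (l, - int k)) * osign (l, - int k) e =
    (- 1) ^ (m * n) * (phi_sign m n e * osign (k, - int l) (flip m n e) :: 'k::field)"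
proof -
  define C where "C = holes m n e"
  define S where "S = {(k', l') \<in> {1..m} \<times> {1..n}. l' < l \<or> l' = l \<and> k' < k}"
  define X where "X = chi m n (\<lambda>k l. lookup e (l, - int k))"
  define \<kappa>' where "\<kappa>' = card (inversions (C - {(k, l)}))"
  let ?U = "{(k', l') \<in> C. k' < k \<or> k' = k \<and> l' < l}"
  let ?V = "{(k', l') \<in> C. k' < k \<and> l < l' \<or> k < k' \<and> l' < l}"
  have kl: "0 < k" "0 < l" using k l by auto
  have finC: "finite C" unfolding C_def by (rule finite_holes)
  have inC: "(k, l) \<in> C"
    using hole k l sym_basis_odd[OF e, of "(l, - int k)"] by (auto simp: C_def holes_def)
  have e': "e + var_mono (l, - int k) \<in> sym_basis n m"
    by (rule sym_basis_plus[OF e]) (use hole k l in \<open>auto simp: Ind_def\<close>)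
  have \<kappa>: "card (inversions C) = \<kappa>' + card ?V"
  proof -
    have "card (inversions (insert (k, l) (C - {(k, l)}))) = \<kappa>' +
        card {(k', l') \<in> C - {(k, l)}. k' < k \<and> l < l' \<or> k < k' \<and> l' < l}"
      unfolding \<kappa>'_def by (rule card_inversions_insert) (use finC in auto)
    moreover have "{(k', l') \<in> C - {(k, l)}. k' < k \<and> l < l' \<or> k < k' \<and> l' < l} = ?V" by auto
    ultimately show ?thesis using inC by (simp add: insert_absorb)
  qed
  \<comment> \<open>The holes with \<open>k' < k\<close> and \<open>l < l'\<close> are counted in both \<open>?U\<close> and \<open>?V\<close>.\<close>
  have UV: "card ?U + card ?V = card (S \<inter> C) + 2 * card {(k', l') \<in> C. k' < k \<and> l < l'}"
  proof -
    have C_sub: "C \<subseteq> {1..m} \<times> {1..n}" by (auto simp: C_def holes_def)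
    have fin: "finite {x \<in> C. Q x}" for Q using finC by simp
    have "card ?U = card {(k', l') \<in> C. k' < k \<and> l < l'} + card {(k', l') \<in> C. k' < k \<and> l' \<le> l \<or> k' = k \<and> l' < l}"
      by (subst card_Un_disjoint[symmetric]) (use finC in \<open>auto intro!: arg_cong[where f = card] intro: finite_subset[OF _ finC]\<close>)
    moreover have "card ?V = card {(k', l') \<in> C. k' < k \<and> l < l'} + card {(k', l') \<in> C. k < k' \<and> l' < l}"
      by (subst card_Un_disjoint[symmetric]) (use finC in \<open>auto intro!: arg_cong[where f = card] intro: finite_subset[OF _ finC]\<close>)
    moreover have "card (S \<inter> C) = card {(k', l') \<in> C. k' < k \<and> l' \<le> l \<or> k' = k \<and> l' < l} +
        card {(k', l') \<in> C. k < k' \<and> l' < l}"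
      by (subst card_Un_disjoint[symmetric])
        (use finC C_sub in \<open>auto simp: S_def intro!: arg_cong[where f = card] intro: finite_subset[OF _ finC]\<close>)
    ultimately show ?thesis by simp
  qed
  have cardS: "card S = m * (l - 1) + (k - 1)"
  proof -
    have "S = {1..m} \<times> {1..<l} \<union> {1..<k} \<times> {l}" using k l by (auto simp: S_def)
    moreover have "({1..m} \<times> {1..<l}) \<inter> ({1..<k} \<times> {l}) = {}" by auto
    ultimately show ?thesis by (simp add: card_Un_disjoint)
  qed
  have "finite S" by (rule finite_subset[of _ "{1..m} \<times> {1..n}"]) (auto simp: S_def)
  then have SC: "card (S - C) + card (S \<inter> C) = card S"
    by (metis card_Diff_subset_Int card_mono finite_Int inf_le1 le_add_diff_inverse2)
  have "phi_sign m n (e + var_mono (l, - int k)) * osign (l, - int k) e =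
      (- 1 :: 'k) ^ (\<kappa>' + (X + (m * l + m + m * n + k + 1)) + card (S - C))"
    using k kappa_eq[OF e'] cbelow_oddvars[OF e k l] unfolding phi_sign_def chi_plus_odd[OF k l] holes_plus_odd[OF k l]
    by (simp add: osign_def \<kappa>'_def X_def S_def C_def power_add)
  moreover have "(- 1) ^ (m * n) * (phi_sign m n e * osign (k, - int l) (flip m n e)) =
      (- 1 :: 'k) ^ (m * n + (\<kappa>' + card ?V + X) + card ?U)"
    using l kappa_eq[OF e] cbelow_oddvars_flip[OF e k l] \<kappa> unfolding phi_sign_def
    by (simp add: osign_def X_def C_def power_add)
  moreover have "even ((\<kappa>' + (X + (m * l + m + m * n + k + 1)) + card (S - C)) +
      (m * n + (\<kappa>' + card ?V + X) + card ?U))"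
  proof -
    have "(\<kappa>' + (X + (m * l + m + m * n + k + 1)) + card (S - C)) + (m * n + (\<kappa>' + card ?V + X) + card ?U) =
        2 * (\<kappa>' + X + m * n + card {(k', l') \<in> C. k' < k \<and> l < l'}) + (m * l + m + k + 1 + card S)"
      using UV SC by simp
    moreover have "m * l + m + k + 1 + card S = 2 * (m * l + k)"
      using kl unfolding cardS by (cases k; cases l) (auto simp: algebra_simps)
    moreover have "a = 2 * b + c \<Longrightarrow> c = 2 * d \<Longrightarrow> even a" for a b c d :: nat
      by simp
    ultimately show ?thesis by blast
  qed
  then have "(- 1 :: 'k) ^ (\<kappa>' + (X + (m * l + m + m * n + k + 1)) + card (S - C)) =
      (- 1) ^ (m * n + (\<kappa>' + card ?V + X) + card ?U)"
    by (rule minus_one_power_cong)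
  ultimately show ?thesis by simp
qed

lemma phi_sign_plus_even:
  "phi_sign m n (e + var_mono (l, int k)) = phi_sign m n e"
proof -
  have "lookup (e + var_mono (l, int k)) (l', - int k') = lookup e (l', - int k')" if "1 \<le> k'" for l' k'
    using that by (simp add: lookup_add lookup_var_mono)
  then have "kappa m n (\<lambda>k' l'. lookup (e + var_mono (l, int k)) (l', - int k')) = kappa m n (\<lambda>k l. lookup e (l, - int k))"
    "chi m n (\<lambda>k' l'. lookup (e + var_mono (l, int k)) (l', - int k')) = chi m n (\<lambda>k l. lookup e (l, - int k))"
    unfolding kappa_def chi_def by (intro sum.cong refl; auto)+
  then show ?thesis by (simp add: phi_sign_def)
qed

lemma mpar_flip:
  assumes "e \<in> sym_basis n m"
  shows "mpar (flip m n e) = mpar e + of_nat (m * n)"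
proof -
  let ?R = "{1..m} \<times> {1..n}"
  have 1: "card (oddvars e) = card (?R - holes m n e)"
    and 2: "card (oddvars (flip m n e)) = card (holes m n e)"
    by (simp_all add: oddvars_holes[OF assms] card_image inj_on_positions)
  have "holes m n e \<subseteq> ?R" by (auto simp: holes_def)
  then have "card (oddvars e) + card (oddvars (flip m n e)) = m * n"
    unfolding 1 2 using card_mono[of ?R "holes m n e"] by (simp add: card_Diff_subset finite_holes)
  then have "card (oddvars (flip m n e)) + 2 * card (oddvars e) = card (oddvars e) + m * n" by simp
  then have "of_nat (card (oddvars (flip m n e)) + 2 * card (oddvars e)) = (of_nat (card (oddvars e) + m * n) :: bit)"
    by (rule arg_cong)
  moreover have "of_nat (2 * card (oddvars e)) = (0 :: bit)" by simp
  ultimately show ?thesis by (simp only: mpar_def of_nat_add add_0_right)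
qed

definition phi_op :: "nat \<Rightarrow> nat \<Rightarrow> (mono, 'k::field_char_0) endo" where
  "phi_op m n = elin (\<lambda>e. if e \<in> sym_basis n m then phi m n (basvec e) else 0)"

lemma app_phi_op: "app (phi_op m n) (Poly_Mapping.single e c) =
    (if e \<in> sym_basis n m then Poly_Mapping.single (flip m n e) (c * phi_sign m n e) else 0)"
  by (simp add: phi_op_def app_elin lin_single phi_basvec scl_single scl_zero)

abbreviation "phi_par m n \<equiv> of_nat (m * n) :: bit"

lemma ksign_of_nat: "ksign (of_nat a) = (- 1 :: 'k::field) ^ a"
  by (induction a) (auto simp: ksign_def)

lemma odd_position:
  assumes "e \<in> sym_basis n m" "k \<in> {1..m}" "l \<in> {1..n}"
  shows "(k, - int l) \<in> oddvars (flip m n e) \<longleftrightarrow> (l, - int k) \<notin> oddvars e"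
proof -
  have "lookup e (l, - int k) = (if (l, - int k) \<in> oddvars e then 1 else 0)"
    using sym_basis_odd[OF assms(1), of "(l, - int k)"] assms(2) by simp
  then show ?thesis
    using assms(2,3) by (auto simp: oddvars_def in_keys_iff lookup_flip_int)
qed

text \<open>The last statement is the third one read backwards: all signs are \<open>\<plusminus>1\<close>, so \<open>phi_sign_plus_odd\<close> can be
  solved for the sign of the smaller monomial.\<close>

lemma phi_op_vars:
  assumes k: "k \<in> {1..m}" and l: "l \<in> {1..n}"
  shows "phi_op m n * mult_op n m (l, int k) = mult_op m n (k, int l) * (phi_op m n :: (mono, 'k::field_char_0) endo)"
    and "phi_op m n * deriv_op n m (l, int k) = deriv_op m n (k, int l) * (phi_op m n :: (mono, 'k) endo)"
    and "phi_op m n * mult_op n m (l, - int k) =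
      scalar (ksign (phi_par m n)) * (deriv_op m n (k, - int l) * (phi_op m n :: (mono, 'k) endo))"
    and "phi_op m n * deriv_op n m (l, - int k) =
      scalar (ksign (phi_par m n)) * (mult_op m n (k, - int l) * (phi_op m n :: (mono, 'k) endo))"
proof -
  have r: "(l, int k) \<in> {1..n} \<times> Ind m" "(l, - int k) \<in> {1..n} \<times> Ind m" "0 < k" "0 < l"
    using k l by (auto simp: Ind_def)
  show "phi_op m n * mult_op n m (l, int k) = mult_op m n (k, int l) * (phi_op m n :: (mono, 'k) endo)"
    by (rule endo_eqI) (auto simp: app_times app_phi_op app_mult_op sym_basis_plus[OF _ r(1)] flip_sym_basis
        flip_plus(1)[OF k l] phi_sign_plus_even osign_def)
  have minus: "flip m n (e - var_mono (l, int k)) = flip m n e - var_mono (k, int l) \<and>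
      phi_sign m n (e - var_mono (l, int k)) = (phi_sign m n e :: 'k)" if "lookup e (l, int k) \<noteq> 0" for e
  proof -
    let ?e = "e - var_mono (l, int k)"
    have e: "?e + var_mono (l, int k) = e" by (rule minus_plus_mono[OF that])
    have "phi_sign m n (?e + var_mono (l, int k)) = (phi_sign m n ?e :: 'k)" by (rule phi_sign_plus_even)
    then show ?thesis using flip_plus(1)[OF k l, of ?e] unfolding e by simp
  qed
  show "phi_op m n * deriv_op n m (l, int k) = deriv_op m n (k, int l) * (phi_op m n :: (mono, 'k) endo)"
    by (rule endo_eqI) (auto simp: app_times app_phi_op app_deriv_op sym_basis_minus flip_sym_basis
        minus lookup_flip_int[OF k l] osign_def mult.commute)
  let ?a = "(l, - int k)" and ?b = "(k, - int l)" and ?s = "(- 1 :: 'k) ^ (m * n)"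
  have s: "ksign (phi_par m n) = ?s" by (rule ksign_of_nat)
  have ss: "?s * ?s = 1" by (simp add: power_add[symmetric] flip: mult_2)
  show "phi_op m n * mult_op n m ?a = scalar (ksign (phi_par m n)) * (deriv_op m n ?b * (phi_op m n :: (mono, 'k) endo))"
  proof (rule endo_eqI)
    fix e
    show "app (phi_op m n * mult_op n m ?a) (basvec e) =
        app (scalar (ksign (phi_par m n)) * (deriv_op m n ?b * phi_op m n)) (basvec e :: mono \<Rightarrow>\<^sub>0 'k)"
    proof (cases "e \<in> sym_basis n m \<and> ?a \<notin> oddvars e")
      case True
      then have e: "e \<in> sym_basis n m" and a: "?a \<notin> oddvars e" by auto
      have one: "lookup (flip m n e) ?b = 1"
        using odd_position[OF e k l] a sym_basis_odd[OF flip_sym_basis, of ?b m n e] r by simp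
      show ?thesis
        unfolding s using e a one sym_basis_plus[OF e r(2)] phi_sign_plus_odd[OF e k l a, where 'k = 'k]
        by (simp add: app_times app_phi_op app_mult_op app_deriv_op app_scalar flip_sym_basis
            flip_plus(2)[OF k l] scl_single mult.commute[of "osign ?a e"])
    next
      case False
      have "lookup (flip m n e) ?b = 0" if "e \<in> sym_basis n m"
        using odd_position[OF that k l] False that sym_basis_odd[OF flip_sym_basis, of ?b m n e] r by simp
      then show ?thesis using False r
        by (auto simp: app_times app_phi_op app_mult_op app_deriv_op app_scalar scl_zero)
    qed
  qed
  show "phi_op m n * deriv_op n m ?a = scalar (ksign (phi_par m n)) * (mult_op m n ?b * (phi_op m n :: (mono, 'k) endo))"
  proof (rule endo_eqI)
    fix e
    show "app (phi_op m n * deriv_op n m ?a) (basvec e) =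
        app (scalar (ksign (phi_par m n)) * (mult_op m n ?b * phi_op m n)) (basvec e :: mono \<Rightarrow>\<^sub>0 'k)"
    proof (cases "e \<in> sym_basis n m \<and> ?a \<in> oddvars e")
      case True
      then have e: "e \<in> sym_basis n m" and a: "?a \<in> oddvars e" by auto
      have one: "lookup e ?a = 1" using sym_basis_odd[OF e, of ?a] a r by simp
      define e0 where "e0 = e - var_mono ?a"
      have e0: "e0 + var_mono ?a = e" "e0 \<in> sym_basis n m" "?a \<notin> oddvars e0"
        using minus_plus_mono[of e ?a] one sym_basis_minus[OF e, of ?a] oddvars_minus[OF e, of ?a] r
        by (auto simp: e0_def)
      have b: "?b \<notin> oddvars (flip m n e)" using odd_position[OF e k l] a by simp
      have b0: "lookup (flip m n e0) ?b \<noteq> 0"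
        using odd_position[OF e0(2) k l] e0(3) by (auto simp: oddvars_def in_keys_iff)
      have fl: "flip m n e = flip m n e0 - var_mono ?b" using flip_plus(2)[OF k l, of e0] e0(1) by simp
      have fl0: "flip m n e0 = flip m n e + var_mono ?b" unfolding fl by (rule minus_plus_mono[OF b0, symmetric])
      have o1: "osign ?a e = (osign ?a e0 :: 'k)"
      proof -
        have "osign ?a (e0 + var_mono ?a) = osign ?a e0 * (vsign ?a ?a :: 'k)"
          by (rule osign_plus) (simp add: e0(3))
        then show ?thesis by (simp add: e0(1) vsign_self)
      qed
      have o2: "osign ?b (flip m n e) = (osign ?b (flip m n e0) :: 'k)"
      proof -
        have "osign ?b (flip m n e0 - var_mono ?b) = osign ?b (flip m n e0) * (vsign ?b ?b :: 'k)"
          by (rule osign_minus[OF flip_sym_basis b0])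
        then show ?thesis by (simp add: fl vsign_self)
      qed
      have key: "phi_sign m n e * osign ?a e0 = ?s * (phi_sign m n e0 * osign ?b (flip m n e0) :: 'k)"
        using phi_sign_plus_odd[OF e0(2) k l e0(3), where 'k = 'k] e0(1) by simp
      have "phi_sign m n e0 * osign ?a e0 =
          phi_sign m n e0 * (phi_sign m n e * phi_sign m n e) * (osign ?a e0 :: 'k)"
        by (simp add: phi_sign_square)
      also have "\<dots> = phi_sign m n e0 * phi_sign m n e * (phi_sign m n e * osign ?a e0)"
        by (simp only: mult_ac)
      also have "\<dots> = (phi_sign m n e0 * phi_sign m n e0) * ?s * (phi_sign m n e * osign ?b (flip m n e0))"
        unfolding key by (simp only: mult_ac)
      also have "\<dots> = ?s * (phi_sign m n e * osign ?b (flip m n e0))" by (simp add: phi_sign_square)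
      finally have *: "phi_sign m n e0 * osign ?a e0 = ?s * (phi_sign m n e * osign ?b (flip m n e0) :: 'k)" .
      show ?thesis
        unfolding s using e one b * e0(2) fl0
        by (simp add: app_times app_phi_op app_mult_op app_deriv_op app_scalar flip_sym_basis
            scl_single e0_def[symmetric] o1 o2 mult.commute[of "osign ?a e0"])
    next
      case False
      have "lookup e ?a = 0 \<and> ?b \<in> oddvars (flip m n e)" if "e \<in> sym_basis n m"
        using odd_position[OF that k l] False that sym_basis_odd[OF that, of ?a] r by simp
      then show ?thesis using False r
        by (auto simp: app_times app_phi_op app_mult_op app_deriv_op app_scalar scl_zero)
    qed
  qed
qed

lemma phi_op_grade: "grade (Sym m n) * phi_op m n =
    scalar (ksign (phi_par m n)) * (phi_op m n * (grade (Sym n m) :: (mono, 'k::field_char_0) endo))"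
proof (rule endo_eqI)
  fix e
  have "ksign (mpar (flip m n e)) = ksign (phi_par m n) * (ksign (mpar e) :: 'k)" if "e \<in> sym_basis n m"
    unfolding mpar_flip[OF that] ksign_add by (rule mult.commute)
  then show "app (grade (Sym m n) * phi_op m n) (basvec e) =
      app (scalar (ksign (phi_par m n)) * (phi_op m n * grade (Sym n m))) (basvec e :: mono \<Rightarrow>\<^sub>0 'k)"
    by (auto simp: app_times app_phi_op app_scalar grade_def app_diag_single Sym_def scl_single scl_zero mult_ac)
qed

lemma phi_op_restr:
  "phi_op m n * restr (Sym n m) = phi_op m n" "restr (Sym m n) * phi_op m n = phi_op m n"
  by (auto intro!: endo_eqI simp: app_times app_phi_op app_restr_Sym flip_sym_basis)

lemma phi_op_inverse:
  "elin (\<lambda>e. Poly_Mapping.single (flip n m e) (phi_sign m n (flip n m e))) * phi_op m n =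
     (restr (Sym n m) :: (mono, 'k::field_char_0) endo)"
  "phi_op m n * elin (\<lambda>e. if e \<in> sym_basis m n then Poly_Mapping.single (flip n m e) (phi_sign m n (flip n m e)) else 0) =
     (restr (Sym m n) :: (mono, 'k::field_char_0) endo)"
  by (auto intro!: endo_eqI simp: app_times app_phi_op app_elin lin_single scl_single app_restr_Sym flip_flip
      flip_sym_basis phi_sign_square)

lemma diag_phi_op:
  assumes "\<And>e. e \<in> sym_basis n m \<Longrightarrow> h' (flip m n e) = h e"
  shows "diag h' * phi_op m n = phi_op m n * diag h"
  by (rule endo_eqI) (auto simp: app_times app_phi_op app_diag_single assms)

section \<open>Transport of the generators\<close>

text \<open>All generators are combinations of the operators \<open>T\<close> with coefficients that do not depend on the
  representation.\<close>

lemma op_intertwine: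
  fixes \<Psi> :: "('b, 'k::field_char_0) endo"
  assumes "super_weyl m n u z d" "super_weyl m n u' z' d'" "1 \<le> n"
    and T: "\<And>i j. i \<in> Ind n \<Longrightarrow> j \<in> Ind n \<Longrightarrow> \<Psi> * super_weyl.T m z' d' i j = super_weyl.T m z d i j * \<Psi>"
    and g: "g \<in> gens n"
  shows "\<Psi> * op_p m z' d' g = op_p m z d g * \<Psi>" and "\<Psi> * op_pt m z' d' g = op_pt m z d g * \<Psi>"
proof -
  interpret A: super_weyl m n u z d by fact
  interpret B: super_weyl m n u' z' d' by fact
  have TT: "\<Psi> * B.T i j = A.T i j * \<Psi>" if "i \<in> Ind n" "j \<in> Ind n" for i j using T that .
  have I: "1 \<in> Ind n" "- 1 \<in> Ind n" using assms(3) by (auto simp: Ind_def)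
  have J: "int i \<in> Ind n \<and> int (i + 1) \<in> Ind n \<and> - int i \<in> Ind n \<and> - int (i + 1) \<in> Ind n"
    if "g \<in> {GE i, GF i, GB i, GC i}" for i
    using that g by (auto simp: gens_def Ind_def)
  show "\<Psi> * op_p m z' d' g = op_p m z d g * \<Psi>"
    unfolding op_p_def A.periplectic_gen_def B.periplectic_gen_def A.elA_def B.elA_def A.elB_def B.elB_def
      A.elC_def B.elC_def
    using I J by (cases g) (simp_all only: gen.case distrib_left distrib_right left_diff_distrib right_diff_distrib
        TT insert_iff simp_thms)
  show "\<Psi> * op_pt m z' d' g = op_pt m z d g * \<Psi>"
    unfolding op_pt_def A.tilde_periplectic_gen_def B.tilde_periplectic_gen_def A.elA_def B.elA_def
    using I J by (cases g) (simp_all only: gen.case distrib_left distrib_right left_diff_distrib right_diff_distrib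
        TT insert_iff simp_thms)
qed

lemma T_intertwine:
  assumes "super_weyl m n u z d" "super_weyl m n u' z' d'"
    and "\<And>k j. k \<in> {1..m} \<Longrightarrow> j \<in> Ind n \<Longrightarrow> \<Psi> * z' k j = z k j * \<Psi>"
    and "\<And>k j. k \<in> {1..m} \<Longrightarrow> j \<in> Ind n \<Longrightarrow> \<Psi> * d' k j = d k j * \<Psi>"
    and "i \<in> Ind n" "j \<in> Ind n"
  shows "\<Psi> * super_weyl.T m z' d' i j = super_weyl.T m z d i j * \<Psi>"
proof -
  interpret A: super_weyl m n u z d by fact
  interpret B: super_weyl m n u' z' d' by fact
  have "\<Psi> * (z' k i * d' k j) = z k i * d k j * \<Psi>" if "k \<in> {1..m}" for k
    using assms(3)[OF that assms(5)] assms(4)[OF that assms(6)] by (metis mult.assoc)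
  then show ?thesis by (simp add: A.T_def B.T_def sum_distrib_left sum_distrib_right)
qed

text \<open>Both factors of a summand of \<open>T\<close> have the same first index, so \<open>T\<close> preserves the degree in it.
  Applied to the generators this is the compatibility of the action of one algebra with the
  weights of the other.\<close>

lemma T_commute:
  assumes "super_weyl m n u z d"
    and "\<And>k j \<mu>. k \<in> {1..m} \<Longrightarrow> j \<in> Ind n \<Longrightarrow> z k j * P \<mu> = P (\<mu> + eps k) * z k j"
    and "\<And>k j \<mu>. k \<in> {1..m} \<Longrightarrow> j \<in> Ind n \<Longrightarrow> d k j * P \<mu> = P (\<mu> - eps k) * d k j"
    and "i \<in> Ind n" "j \<in> Ind n"
  shows "P \<mu> * super_weyl.T m z d i j = super_weyl.T m z d i j * P \<mu>"
proof -
  interpret super_weyl m n u z d by fact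
  have "z k i * d k j * P \<mu> = P \<mu> * (z k i * d k j)" if k: "k \<in> {1..m}" for k
    using assms(2)[OF k assms(4), of "\<mu> - eps k"] assms(3)[OF k assms(5), of \<mu>]
    by (simp add: mult.assoc) (simp add: mult.assoc[symmetric])
  then show ?thesis by (simp add: T_def sum_distrib_left sum_distrib_right)
qed

lemma base_commute:
  assumes "g \<in> gens r" "1 \<le> r"
  shows "deg_proj N r \<mu> * op_p N (lz N r) (ld N r) g =
      op_p N (lz N r) (ld N r) g * (deg_proj N r \<mu> :: (_, 'k::field_char_0) endo)"
    and "deg_proj N r \<mu> * op_pt N (lz N r) (ld N r) g =
      op_pt N (lz N r) (ld N r) g * (deg_proj N r \<mu> :: (_, 'k) endo)"
proof -
  interpret base: super_weyl N r "restr (SymL N r)" "lz N r" "ld N r :: _ \<Rightarrow> _ \<Rightarrow> (_, 'k) endo"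
    by (rule super_weyl_SymL)
  have T: "deg_proj N r \<mu> * super_weyl.T N (lz N r) (ld N r) i j =
      super_weyl.T N (lz N r) (ld N r) i j * (deg_proj N r \<mu> :: (_, 'k) endo)"
    if "i \<in> Ind r" "j \<in> Ind r" for i j
    by (rule T_commute[OF base.super_weyl_axioms _ _ that])
      (auto intro!: lz_weight[where w = mdegree] ld_weight[where w = mdegree] simp: mdegree_plus)
  show "deg_proj N r \<mu> * op_p N (lz N r) (ld N r) g =
      op_p N (lz N r) (ld N r) g * (deg_proj N r \<mu> :: (_, 'k) endo)"
    by (rule op_intertwine(1)[OF base.super_weyl_axioms base.super_weyl_axioms assms(2) T assms(1)])
  show "deg_proj N r \<mu> * op_pt N (lz N r) (ld N r) g =
      op_pt N (lz N r) (ld N r) g * (deg_proj N r \<mu> :: (_, 'k) endo)"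
    by (rule op_intertwine(2)[OF base.super_weyl_axioms base.super_weyl_axioms assms(2) T assms(1)])
qed

lemma dual_commute:
  assumes "g \<in> gens N" "1 \<le> N"
  shows "nat_proj N r \<mu> * op_p r (lz_dual N r) (ld_dual N r) g =
      op_p r (lz_dual N r) (ld_dual N r) g * (nat_proj N r \<mu> :: (_, 'k::field_char_0) endo)"
    and "nat_proj N r \<mu> * op_pt r (lz_dual N r) (ld_dual N r) g =
      op_pt r (lz_dual N r) (ld_dual N r) g * (nat_proj N r \<mu> :: (_, 'k) endo)"
proof -
  interpret base: super_weyl N r "restr (SymL N r)" "lz N r" "ld N r :: _ \<Rightarrow> _ \<Rightarrow> (_, 'k) endo"
    by (rule super_weyl_SymL)
  have z: "lz N r k j * nat_proj N r \<mu> =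
      nat_proj N r (\<mu> + var_weight j) * (lz N r k j :: (_, 'k) endo)"
    if "k \<in> {1..N}" "j \<in> Ind r" for k j \<mu>
    using lz_weight[of k j N r "\<lambda>e. mweight e + adelta N r" "var_weight j"] that by (simp add: mweight_plus)
  have d: "ld N r k j * nat_proj N r \<mu> =
      nat_proj N r (\<mu> - var_weight j) * (ld N r k j :: (_, 'k) endo)" for k j \<mu>
    using ld_weight[of "\<lambda>e. mweight e + adelta N r" k j "var_weight j"] by (simp add: mweight_plus)
  have w: "var_weight (int l) = eps l" "var_weight (- int l) = - eps l" if "0 < l" for l
    using that by (simp_all add: var_weight_def eps_def single_uminus)
  have zh: "lz_dual N r l j * nat_proj N r \<mu> =
        nat_proj N r (\<mu> + eps l) * (lz_dual N r l j :: (_, 'k) endo) \<and>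
      ld_dual N r l j * nat_proj N r \<mu> =
        nat_proj N r (\<mu> - eps l) * (ld_dual N r l j :: (_, 'k) endo)"
    if l: "l \<in> {1..r}" and j: "j \<in> Ind N" for l j \<mu>
    using j
  proof (cases rule: Ind_cases)
    case (pos k)
    then show ?thesis using l z[OF pos(1), of "int l"] d[of k "int l"] w[of l]
      by (simp add: dual_simps Ind_def)
  next
    case (neg k)
    then show ?thesis using l z[OF neg(1), of "- int l"] d[of k "- int l"] w[of l]
      by (simp add: dual_simps Ind_def)
  qed
  have T: "nat_proj N r \<mu> * super_weyl.T r (lz_dual N r) (ld_dual N r) i j =
      super_weyl.T r (lz_dual N r) (ld_dual N r) i j * (nat_proj N r \<mu> :: (_, 'k) endo)"
    if "i \<in> Ind N" "j \<in> Ind N" for i j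
    by (rule T_commute[OF base.dual _ _ that]) (use zh in blast)+
  show "nat_proj N r \<mu> * op_p r (lz_dual N r) (ld_dual N r) g =
      op_p r (lz_dual N r) (ld_dual N r) g * (nat_proj N r \<mu> :: (_, 'k) endo)"
    by (rule op_intertwine(1)[OF base.dual base.dual assms(2) T assms(1)])
  show "nat_proj N r \<mu> * op_pt r (lz_dual N r) (ld_dual N r) g =
      op_pt r (lz_dual N r) (ld_dual N r) g * (nat_proj N r \<mu> :: (_, 'k) endo)"
    by (rule op_intertwine(2)[OF base.dual base.dual assms(2) T assms(1)])
qed

lemma op_dual_dual:
  assumes "g \<in> gens r" "1 \<le> r"
  shows "op_pt N (dual_z (lz_dual N r) (ld_dual N r))
      (dual_d (lz_dual N r) (ld_dual N r)) g =
    (op_pt N (lz N r) (ld N r) g :: (_, 'k::field_char_0) endo)"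
proof -
  interpret base: super_weyl N r "restr (SymL N r)" "lz N r" "ld N r :: _ \<Rightarrow> _ \<Rightarrow> (_, 'k) endo"
    by (rule super_weyl_SymL)
  interpret dual: super_weyl r N "restr (SymL N r)" "lz_dual N r"
      "ld_dual N r :: _ \<Rightarrow> _ \<Rightarrow> (_, 'k) endo"
    by (rule base.dual)
  have "1 * super_weyl.T N (lz N r) (ld N r) i j = super_weyl.T N
      (dual_z (lz_dual N r) (ld_dual N r))
      (dual_d (lz_dual N r) (ld_dual N r)) i j * (1 :: (_, 'k) endo)"
    if "i \<in> Ind r" "j \<in> Ind r" for i j
    by (rule T_intertwine[OF dual.dual base.super_weyl_axioms _ _ that]) (simp_all only: dual_dual mult_1 mult_1_right)
  from op_intertwine(2)[OF dual.dual base.super_weyl_axioms assms(2) this assms(1)]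
  show ?thesis by simp
qed

text \<open>The \<open>p\<close>-th power of the parity operator. Composition with it converts homomorphisms of parity \<open>p\<close>
  into maps that commute strictly with the action, and conversely.\<close>

definition parity_twist :: "bit \<Rightarrow> 'b sspace \<Rightarrow> ('b, 'k::field) endo" where
  "parity_twist p M = (if p = 0 then 1 else grade M)"

lemma parity_twist_square: "parity_twist p M * parity_twist p M = 1"
  by (simp add: parity_twist_def grade_square)

lemma parity_twist_homog:
  assumes "homog M q f"
  shows "parity_twist p M * f = scalar (ksign (p * q)) * (f * parity_twist p M)"
  using assms by (cases p) (simp_all add: parity_twist_def homog_def, simp add: ksign_def)

definition twisted_phi :: "nat \<Rightarrow> nat \<Rightarrow> (mono \<times> unit, 'k::field_char_0) endo" where
  "twisted_phi m n = parity_twist (phi_par m n) (SymL m n) * Lift (phi_op m n)"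

text \<open>On odd generators \<open>\<phi>\<close> and the twist both contribute the sign \<open>(-1)\<^bsup>mn\<^esup>\<close>; on even ones neither does.\<close>

lemma twisted_phi_vars:
  assumes k: "k \<in> {1..m}" and j: "j \<in> Ind n"
  shows "twisted_phi m n * lz_dual n m k j = lz m n k j * (twisted_phi m n :: (_, 'k::field_char_0) endo)"
    and "twisted_phi m n * ld_dual n m k j = ld m n k j * (twisted_phi m n :: (_, 'k) endo)"
proof -
  let ?p = "phi_par m n" and ?\<Phi> = "Lift (phi_op m n) :: (mono \<times> unit, 'k) endo"
  have lift2: "?\<Phi> * Lift f = scalar c * (Lift g * ?\<Phi>)" if "phi_op m n * f = scalar c * (g * phi_op m n)" for f g c
    unfolding Lift_mult[symmetric] that Lift_scalar[symmetric] ..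
  have "?\<Phi> * lz_dual n m k j = scalar (ksign (?p * ipar j)) * (lz m n k j * ?\<Phi>) \<and>
      ?\<Phi> * ld_dual n m k j = scalar (ksign (?p * ipar j)) * (ld m n k j * ?\<Phi>)"
    using j
  proof (cases rule: Ind_cases)
    case (pos l)
    then have l0: "0 < l" and "ipar j = 0" by (auto simp: ipar_def)
    then have one: "scalar (ksign (?p * ipar j)) = (1 :: (mono \<times> unit, 'k) endo)" by (simp add: ksign_def)
    have lift1: "?\<Phi> * Lift f = Lift g * ?\<Phi>" if "phi_op m n * f = g * phi_op m n" for f g
      unfolding Lift_mult[symmetric] that ..
    show ?thesis
      unfolding one mult_1 unfolding pos(2) dual_simps(1,3)[OF l0] lz_def ld_def
      by (intro conjI lift1 phi_op_vars(1,2)[OF k pos(1)])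
  next
    case (neg l)
    then have l0: "0 < l" and "ipar j = 1" by (auto simp: ipar_def)
    then have p: "?p * ipar j = ?p" by simp
    show ?thesis
      unfolding p unfolding neg(2) dual_simps(2,4)[OF l0] lz_def ld_def
      by (intro conjI lift2 phi_op_vars(3,4)[OF k neg(1)])
  qed
  moreover have "twisted_phi m n * F = f * (twisted_phi m n :: (_, 'k) endo)"
    if F: "?\<Phi> * F = scalar (ksign (?p * ipar j)) * (f * ?\<Phi>)" and f: "homog (SymL m n) (ipar j) f" for F f
  proof -
    define t where "t = (parity_twist ?p (SymL m n) :: (mono \<times> unit, 'k) endo)"
    define s :: "(mono \<times> unit, 'k) endo" where "s = scalar (ksign (?p * ipar j))"
    have ss: "s * (s * g) = g" for g
      by (simp only: s_def mult.assoc[symmetric] scalar_mult[symmetric] ksign_mult_self scalar_one mult_1)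
    have ts: "t * (s * g) = s * (t * g)" for g unfolding s_def by (rule scalar_left_commute)
    have tf: "t * f = s * (f * t)" unfolding t_def s_def by (rule parity_twist_homog[OF f])
    have "t * ?\<Phi> * F = s * (t * f * ?\<Phi>)"
      by (simp only: mult.assoc F s_def[symmetric] ts)
    also have "\<dots> = f * (t * ?\<Phi>)" by (simp add: tf mult.assoc ss)
    finally show ?thesis by (simp add: twisted_phi_def t_def)
  qed
  ultimately show "twisted_phi m n * lz_dual n m k j = lz m n k j * (twisted_phi m n :: (_, 'k) endo)"
    "twisted_phi m n * ld_dual n m k j = ld m n k j * (twisted_phi m n :: (_, 'k) endo)"
    using lz_ld_homog by blast+
qed

text \<open>Dualizing is an involution, so this is \<open>twisted_phi_vars\<close> in other coordinates.\<close>

lemma twisted_phi_dual_vars: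
  assumes l: "l \<in> {1..n}" and i: "i \<in> Ind m"
  shows "twisted_phi m n * lz n m l i = lz_dual m n l i * (twisted_phi m n :: (_, 'k::field_char_0) endo)"
    and "twisted_phi m n * ld n m l i = ld_dual m n l i * (twisted_phi m n :: (_, 'k) endo)"
proof -
  have l0: "0 < l" using l by simp
  have I: "int l \<in> Ind n" "- int l \<in> Ind n" using l by (auto simp: Ind_def)
  have "twisted_phi m n * lz n m l i = lz_dual m n l i * (twisted_phi m n :: (_, 'k) endo) \<and>
      twisted_phi m n * ld n m l i = ld_dual m n l i * (twisted_phi m n :: (_, 'k) endo)"
    using i
  proof (cases rule: Ind_cases)
    case (pos k)
    then have "0 < k" by simp
    then show ?thesis
      using twisted_phi_vars[OF pos(1) I(1), where 'k = 'k] by (simp add: pos(2) dual_simps l0)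
  next
    case (neg k)
    then have "0 < k" by simp
    then show ?thesis
      using twisted_phi_vars[OF neg(1) I(2), where 'k = 'k] by (simp add: neg(2) dual_simps l0)
  qed
  then show "twisted_phi m n * lz n m l i = lz_dual m n l i * (twisted_phi m n :: (_, 'k) endo)"
    "twisted_phi m n * ld n m l i = ld_dual m n l i * (twisted_phi m n :: (_, 'k) endo)"
    by auto
qed

lemma twisted_phi_gens:
  assumes "1 \<le> m" "1 \<le> n"
  shows "g \<in> gens n \<Longrightarrow> twisted_phi m n * op_p m (lz_dual n m) (ld_dual n m) g =
      op_p m (lz m n) (ld m n) g * (twisted_phi m n :: (_, 'k::field_char_0) endo)"
    and "h \<in> gens m \<Longrightarrow> twisted_phi m n * op_pt n (lz n m) (ld n m) h =
      op_pt n (lz_dual m n) (ld_dual m n) h * (twisted_phi m n :: (_, 'k) endo)"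
proof -
  interpret A: super_weyl m n "restr (SymL m n)" "lz m n" "ld m n :: _ \<Rightarrow> _ \<Rightarrow> (_, 'k) endo"
    by (rule super_weyl_SymL)
  interpret B: super_weyl n m "restr (SymL n m)" "lz n m" "ld n m :: _ \<Rightarrow> _ \<Rightarrow> (_, 'k) endo"
    by (rule super_weyl_SymL)
  show "g \<in> gens n \<Longrightarrow> twisted_phi m n * op_p m (lz_dual n m) (ld_dual n m) g =
      op_p m (lz m n) (ld m n) g * (twisted_phi m n :: (_, 'k) endo)"
    by (rule op_intertwine(1)[OF A.super_weyl_axioms B.dual assms(2) T_intertwine[OF A.super_weyl_axioms B.dual]])
      (simp_all only: twisted_phi_vars)
  show "h \<in> gens m \<Longrightarrow> twisted_phi m n * op_pt n (lz n m) (ld n m) h =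
      op_pt n (lz_dual m n) (ld_dual m n) h * (twisted_phi m n :: (_, 'k) endo)"
    by (rule op_intertwine(2)[OF A.dual B.super_weyl_axioms assms(1) T_intertwine[OF A.dual B.super_weyl_axioms]])
      (simp_all only: twisted_phi_dual_vars)
qed

lemma twisted_phi_weights:
  "twisted_phi m n * deg_proj n m \<mu> =
    nat_proj m n \<mu> * (twisted_phi m n :: (_, 'k::field_char_0) endo)"
  "twisted_phi m n * nat_proj n m \<mu> =
    deg_proj m n \<mu> * (twisted_phi m n :: (_, 'k) endo)"
proof -
  have tw: "parity_twist p (SymL m n) * diag h = diag h * (parity_twist p (SymL m n) :: (_, 'k) endo)" for p and h :: "_ \<Rightarrow> 'k"
    by (simp add: parity_twist_def grade_def diag_commute)
  have main: "twisted_phi m n * weight_proj (SymL n m) (\<lambda>b. w' (fst b)) \<mu> =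
      weight_proj (SymL m n) (\<lambda>b. w (fst b)) \<mu> * (twisted_phi m n :: (_, 'k) endo)"
    if "\<And>e. e \<in> sym_basis n m \<Longrightarrow> w (flip m n e) = w' e" for w w' :: "mono \<Rightarrow> weight"
  proof -
    let ?h = "\<lambda>e. if e \<in> sym_basis m n \<and> w e = \<mu> then 1 else (0 :: 'k)"
    let ?h' = "\<lambda>e. if e \<in> sym_basis n m \<and> w' e = \<mu> then 1 else (0 :: 'k)"
    have "diag ?h * phi_op m n = phi_op m n * diag ?h'"
      by (rule diag_phi_op) (simp add: flip_sym_basis that)
    then have "Lift (phi_op m n) * Lift (diag ?h') = Lift (diag ?h) * Lift (phi_op m n)"
      by (simp only: Lift_mult[symmetric])
    then show ?thesis
      unfolding weight_proj_SymL twisted_phi_def mult.assoc Lift_diag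
      by (simp only: mult.assoc[symmetric] tw)
  qed
  show "twisted_phi m n * deg_proj n m \<mu> =
    nat_proj m n \<mu> * (twisted_phi m n :: (_, 'k) endo)"
    by (rule main[of "\<lambda>e. mweight e + adelta m n" mdegree]) (rule mweight_flip)
  show "twisted_phi m n * nat_proj n m \<mu> =
    deg_proj m n \<mu> * (twisted_phi m n :: (_, 'k) endo)"
    by (rule main[of mdegree "\<lambda>e. mweight e + adelta n m"]) (rule mdegree_flip)
qed

section \<open>The two bimodules\<close>

text \<open>The operators through which the two algebras act on \<open>\<A>\<close> and \<open>\<A>'\<close>: in terms of the generators
  for the natural actions, of the dual generators for the other two.\<close>

definition "repA_p m n = presented_rel (Xwt n) (gens n) (nat_proj m n)
  (op_p m (lz m n) (ld m n) :: gen \<Rightarrow> (mono \<times> unit, 'k::field_char_0) endo)"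
definition "repA_pt m n = presented_rel (Xwt m) (gens m) (deg_proj m n)
  (op_pt n (lz_dual m n) (ld_dual m n) :: gen \<Rightarrow> (mono \<times> unit, 'k::field_char_0) endo)"
definition "repA'_p m n = presented_rel (Xwt n) (gens n) (deg_proj n m)
  (op_p m (lz_dual n m) (ld_dual n m) :: gen \<Rightarrow> (mono \<times> unit, 'k::field_char_0) endo)"
definition "repA'_pt m n = presented_rel (Xwt m) (gens m) (nat_proj n m)
  (op_pt n (lz n m) (ld n m) :: gen \<Rightarrow> (mono \<times> unit, 'k::field_char_0) endo)"

lemma tensor_map_proj:
  fixes v :: "mono \<times> unit \<Rightarrow>\<^sub>0 'k::field"
  assumes "v \<in> vecs (SymL N r)" "\<And>e. e \<in> sym_basis N r \<Longrightarrow> Q e \<longleftrightarrow> w e = \<mu>"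
  shows "tensor_map (proj Q) id v = app (weight_proj (SymL N r) (\<lambda>b. w (fst b)) \<mu>) v"
  unfolding weight_proj_SymL
  by (rule tensor_map_eq_Lift[OF _ assms(1)])
    (auto simp: proj_def app_diag_single assms(2) Sym_def)

lemma basvec_vecs: "e \<in> basis M \<Longrightarrow> basvec e \<in> vecs M"
  by (simp add: vecs_def)

lemma weight_proj_commute:
  "weight_proj M w \<mu> * weight_proj M w' \<nu> = weight_proj M w' \<nu> * weight_proj M w \<mu>"
  unfolding weight_proj_def by (rule diag_commute)

context
  fixes m n :: nat
  assumes m: "1 \<le> m" and n: "1 \<le> n"
begin

lemmas presented_A_p = periplectic_weights.presented_rep_p[OF periplectic_weights_natural[OF n, of m]]
lemmas presented_A_pt = periplectic_weights.presented_rep_pt[OF periplectic_weights_degree[OF m, of n]]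
lemmas presented_A'_p = periplectic_weights.presented_rep_p[OF periplectic_weights_degree[OF n, of m]]
lemmas presented_A'_pt = periplectic_weights.presented_rep_pt[OF periplectic_weights_natural[OF m, of n]]

lemma rep_A_p: "operator_rep (Udot_p n) (SymL m n) (repA_p m n :: _ \<Rightarrow> (_, 'k::field_char_0) endo \<Rightarrow> bool)"
  unfolding Udot_p_def repA_p_def by (rule presented_rep.presented_alg_rep[OF presented_A_p])

lemma rep_A_pt: "operator_rep (Udot_pt m) (SymL m n) (repA_pt m n :: _ \<Rightarrow> (_, 'k::field_char_0) endo \<Rightarrow> bool)"
  unfolding Udot_pt_def repA_pt_def by (rule presented_rep.presented_alg_rep[OF presented_A_pt])

lemma rep_A'_p: "operator_rep (Udot_p n) (SymL n m) (repA'_p m n :: _ \<Rightarrow> (_, 'k::field_char_0) endo \<Rightarrow> bool)"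
  unfolding Udot_p_def repA'_p_def by (rule presented_rep.presented_alg_rep[OF presented_A'_p])

lemma rep_A'_pt: "operator_rep (Udot_pt m) (SymL n m) (repA'_pt m n :: _ \<Rightarrow> (_, 'k::field_char_0) endo \<Rightarrow> bool)"
  unfolding Udot_pt_def repA'_pt_def by (rule presented_rep.presented_alg_rep[OF presented_A'_pt])

lemma actA_p_eq:
  assumes f: "repA_p m n Y f" and v: "v \<in> vecs (SymL m n)"
  shows "actA_p m n Y v = app f v"
  unfolding actA_p_def
proof (rule presented_rep.presented_act_eq[OF presented_A_p _ _ f[unfolded repA_p_def] v])
  fix \<mu> and v :: "mono \<times> unit \<Rightarrow>\<^sub>0 'a" assume v: "v \<in> vecs (SymL m n)"
  show "tensor_map (proj (\<lambda>e. mweight e = \<mu> - adelta m n)) id v =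
      app (nat_proj m n \<mu>) v"
    by (rule tensor_map_proj[OF v, where w = "\<lambda>e. mweight e + adelta m n"]) (auto simp: eq_diff_eq)
next
  fix g and v :: "mono \<times> unit \<Rightarrow>\<^sub>0 'a" assume g: "g \<in> gens n" and v: "v \<in> vecs (SymL m n)"
  show "tensor_map (opA_p m n g) id v = app (op_p m (lz m n) (ld m n) g) v"
    unfolding lz_ld_eq op_Lift(1)[OF super_weyl_Sym]
    by (rule tensor_map_eq_Lift[OF opA_p_eq[OF basvec_vecs g n] v]) simp_all
qed

lemma actA_pt_eq:
  assumes f: "repA_pt m n Y f" and v: "v \<in> vecs (SymL m n)"
  shows "actA_pt m n Y v = app f v"
  unfolding actA_pt_def
proof (rule presented_rep.presented_act_eq[OF presented_A_pt _ _ f[unfolded repA_pt_def] v])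
  fix \<mu> and v :: "mono \<times> unit \<Rightarrow>\<^sub>0 'a" assume v: "v \<in> vecs (SymL m n)"
  show "tensor_map (proj (\<lambda>e. mdegree e = \<mu>)) id v = app (deg_proj m n \<mu>) v"
    by (rule tensor_map_proj[OF v]) auto
next
  fix g and v :: "mono \<times> unit \<Rightarrow>\<^sub>0 'a" assume g: "g \<in> gens m" and v: "v \<in> vecs (SymL m n)"
  show "tensor_map (opA_pt m n g) id v =
      app (op_pt n (lz_dual m n) (ld_dual m n) g) v"
    unfolding lz_ld_eq dual_Lift op_Lift(2)[OF super_weyl.dual[OF super_weyl_Sym]]
    by (rule tensor_map_eq_Lift[OF opA_pt_eq[OF basvec_vecs g m] v]) simp_all
qed

lemma actA'_p_eq:
  assumes f: "repA'_p m n Y f" and v: "v \<in> vecs (SymL n m)"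
  shows "actA'_p m n Y v = app f v"
  unfolding actA'_p_def
proof (rule presented_rep.presented_act_eq[OF presented_A'_p _ _ f[unfolded repA'_p_def] v])
  fix \<mu> and v :: "mono \<times> unit \<Rightarrow>\<^sub>0 'a" assume v: "v \<in> vecs (SymL n m)"
  show "tensor_map (proj (\<lambda>e. mdegree e = \<mu>)) id v = app (deg_proj n m \<mu>) v"
    by (rule tensor_map_proj[OF v]) auto
next
  fix g and v :: "mono \<times> unit \<Rightarrow>\<^sub>0 'a" assume g: "g \<in> gens n" and v: "v \<in> vecs (SymL n m)"
  show "tensor_map (opA'_p m n g) id v =
      app (op_p m (lz_dual n m) (ld_dual n m) g) v"
    unfolding lz_ld_eq dual_Lift op_Lift(1)[OF super_weyl.dual[OF super_weyl_Sym]]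
    by (rule tensor_map_eq_Lift[OF opA'_p_eq[OF basvec_vecs g n] v]) simp_all
qed

lemma actA'_pt_eq:
  assumes f: "repA'_pt m n Y f" and v: "v \<in> vecs (SymL n m)"
  shows "actA'_pt m n Y v = app f v"
  unfolding actA'_pt_def
proof (rule presented_rep.presented_act_eq[OF presented_A'_pt _ _ f[unfolded repA'_pt_def] v])
  fix \<mu> and v :: "mono \<times> unit \<Rightarrow>\<^sub>0 'a" assume v: "v \<in> vecs (SymL n m)"
  show "tensor_map (proj (\<lambda>e. mweight e = \<mu> - adelta n m)) id v =
      app (nat_proj n m \<mu>) v"
    by (rule tensor_map_proj[OF v, where w = "\<lambda>e. mweight e + adelta n m"]) (auto simp: eq_diff_eq)
next
  fix g and v :: "mono \<times> unit \<Rightarrow>\<^sub>0 'a" assume g: "g \<in> gens m" and v: "v \<in> vecs (SymL n m)"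
  show "tensor_map (opA'_pt m n g) id v = app (op_pt n (lz n m) (ld n m) g) v"
    unfolding lz_ld_eq op_Lift(2)[OF super_weyl_Sym]
    by (rule tensor_map_eq_Lift[OF opA'_pt_eq[OF basvec_vecs g m] v]) simp_all
qed

lemma supercommute_A:
  assumes "repA_p m n Y f" "repA_pt m n Y' f'"
  shows "supercommute (SymL m n) f f'"
  by (rule supercommute_presented[OF presented_A_p presented_A_pt _ _ _ _
        assms[unfolded repA_p_def repA_pt_def]])
    (rule super_weyl.supercommute_gens[OF super_weyl_SymL _ _ m n] base_commute[OF _ n]
      base_commute[OF _ n, symmetric] dual_commute[OF _ m] dual_commute[OF _ m, symmetric]
      weight_proj_commute | assumption)+

text \<open>This is the statement for \<open>\<A>\<close> with the two algebras exchanged, applied to the dual generators: the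
  dual of the dual generators are the original ones.\<close>

lemma supercommute_A':
  assumes "repA'_p m n Y f" "repA'_pt m n Y' f'"
  shows "supercommute (SymL n m) f f'"
proof (rule supercommute_presented[OF presented_A'_p presented_A'_pt _ _ _ _
        assms[unfolded repA'_p_def repA'_pt_def]])
  fix g h assume g: "g \<in> gens n" and h: "h \<in> gens m"
  show "sign_commute (gpar g) (gpar h) (op_p m (lz_dual n m) (ld_dual n m) g)
      (op_pt n (lz n m) (ld n m) h :: (_, 'a) endo)"
    using super_weyl.supercommute_gens[OF super_weyl.dual[OF super_weyl_SymL] g h m n]
    unfolding op_dual_dual[OF h m] .
qed (rule base_commute[OF _ m] base_commute[OF _ m, symmetric] dual_commute[OF _ n]
    dual_commute[OF _ n, symmetric] weight_proj_commute | assumption)+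

lemma rep_A: "operator_rep (tensor_alg (Udot_p n) (Udot_pt m)) (MA m n)
    (tensor_rel (repA_p m n) (repA_pt m n :: _ \<Rightarrow> (_, 'k::field_char_0) endo \<Rightarrow> bool))"
  unfolding MA_def by (rule operator_rep_tensor[OF rep_A_p rep_A_pt supercommute_A])

lemma rep_A': "operator_rep (tensor_alg (Udot_p n) (Udot_pt m)) (MA' m n)
    (tensor_rel (repA'_p m n) (repA'_pt m n :: _ \<Rightarrow> (_, 'k::field_char_0) endo \<Rightarrow> bool))"
  unfolding MA'_def by (rule operator_rep_tensor[OF rep_A'_p rep_A'_pt supercommute_A'])

lemma actA_eq:
  assumes "tensor_rel (repA_p m n) (repA_pt m n) X f" and "v \<in> vecs (MA m n)"
  shows "actA m n X v = app f v"
  using assms unfolding actA_def MA_def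
  by (intro tensor_act_eq[OF rep_A_p rep_A_pt actA_p_eq actA_pt_eq])

lemma actA'_eq:
  assumes "tensor_rel (repA'_p m n) (repA'_pt m n) X f" and "v \<in> vecs (MA' m n)"
  shows "actA' m n X v = app f v"
  using assms unfolding actA'_def MA'_def
  by (intro tensor_act_eq[OF rep_A'_p rep_A'_pt actA'_p_eq actA'_pt_eq])

lemma twisted_phi_intertwines:
  "intertwines (twisted_phi m n :: (_, 'k::field_char_0) endo)
     (tensor_rel (repA'_p m n) (repA'_pt m n)) (tensor_rel (repA_p m n) (repA_pt m n))"
proof (rule intertwines_tensor[OF rep_A'_p rep_A'_pt rep_A_p rep_A_pt])
  show "intertwines (twisted_phi m n :: (_, 'k) endo) (repA'_p m n) (repA_p m n)"
    unfolding repA'_p_def repA_p_def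
    by (rule intertwines_presented) (simp_all only: twisted_phi_gens[OF m n] twisted_phi_weights)
  show "intertwines (twisted_phi m n :: (_, 'k) endo) (repA'_pt m n) (repA_pt m n)"
    unfolding repA'_pt_def repA_pt_def
    by (rule intertwines_presented) (simp_all only: twisted_phi_gens[OF m n] twisted_phi_weights)
qed

end

lemma tensor_map_phi:
  assumes "v \<in> vecs (MA' m n)"
  shows "tensor_map (phi m n) eta v = app (Lift (phi_op m n)) v"
  by (rule tensor_map_eq_Lift[OF _ assms[unfolded MA'_def]])
    (simp_all add: eta_def phi_op_def app_elin Sym_def)

text \<open>The signed inverse of \<open>\<phi>\<close> on monomials gives one-sided inverses relative to the projections
  onto the modules, which agree there.\<close>

lemma Lift_phi_op_bij:
  "bij_betw (app (Lift (phi_op m n) :: (_, 'k::field_char_0) endo)) (vecs (MA' m n)) (vecs (MA m n))"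
proof -
  let ?\<Phi> = "Lift (phi_op m n) :: (_, 'k) endo"
  obtain f g where f: "f * phi_op m n = (restr (Sym n m) :: (_, 'k) endo)"
    and g: "phi_op m n * g = (restr (Sym m n) :: (_, 'k) endo)"
    using phi_op_inverse by blast
  have f': "Lift f * ?\<Phi> = restr (MA' m n)" and g': "?\<Phi> * Lift g = restr (MA m n)"
    by (simp_all add: Lift_mult[symmetric] f g restr_Lift MA_def MA'_def)
  have r: "?\<Phi> * restr (MA' m n) = ?\<Phi>" "restr (MA m n) * ?\<Phi> = ?\<Phi>"
    unfolding MA_def MA'_def restr_Lift Lift_mult[symmetric] phi_op_restr by simp_all
  show ?thesis
  proof (rule bij_betw_byWitness[where f' = "\<lambda>w. app (restr (MA' m n)) (app (Lift g) w)"])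
    show "\<forall>v\<in>vecs (MA' m n). app (restr (MA' m n)) (app (Lift g) (app ?\<Phi> v)) = v"
    proof
      fix v :: "mono \<times> unit \<Rightarrow>\<^sub>0 'k" assume v: "v \<in> vecs (MA' m n)"
      have "restr (MA' m n) * Lift g * ?\<Phi> = Lift f * (?\<Phi> * Lift g) * ?\<Phi>"
        by (simp add: f'[symmetric] mult.assoc)
      also have "\<dots> = restr (MA' m n)" by (simp add: g' mult.assoc r f')
      finally show "app (restr (MA' m n)) (app (Lift g) (app ?\<Phi> v)) = v"
        using v by (simp add: app_times[symmetric] vecs_iff mult.assoc)
    qed
    show "\<forall>w\<in>vecs (MA m n). app ?\<Phi> (app (restr (MA' m n)) (app (Lift g) w)) = w"
      using g' r by (simp add: app_times[symmetric] vecs_iff mult.assoc[symmetric])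
    show "app ?\<Phi> ` vecs (MA' m n) \<subseteq> vecs (MA m n)"
      using r(2) by (auto simp: vecs_iff app_times[symmetric])
    have "restr (MA' m n) * restr (MA' m n) = (restr (MA' m n) :: (_, 'k) endo)"
      by (rule endo_eqI) (simp add: restr_def app_times app_diag_single)
    then show "(\<lambda>w. app (restr (MA' m n)) (app (Lift g) w)) ` vecs (MA m n) \<subseteq> vecs (MA' m n)"
      by (auto simp: vecs_iff app_times[symmetric] mult.assoc[symmetric])
  qed
qed

theorem theorem6p4p1:
  fixes m n :: nat
  assumes "m \<ge> 1" and "n \<ge> 1"
  shows "supermodule_iso
    (tensor_alg (Udot_p n) (Udot_pt m) ::
      ('k::{alg_closed_field, field_char_0}, weight \<times> weight, _) lusalg)
    (MA' m n) (actA' m n)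
    (MA m n) (actA m n)
    (tensor_map (phi m n) eta) (of_nat (m * n))"
proof -
  let ?U = "tensor_alg (Udot_p n) (Udot_pt m) :: ('k, weight \<times> weight, _) lusalg"
  let ?\<Phi> = "Lift (phi_op m n) :: (mono \<times> unit, 'k) endo"
  interpret A: operator_rep ?U "MA m n" "tensor_rel (repA_p m n) (repA_pt m n)"
    by (rule rep_A) (use assms in auto)
  interpret A': operator_rep ?U "MA' m n" "tensor_rel (repA'_p m n) (repA'_pt m n)"
    by (rule rep_A') (use assms in auto)
  have \<Phi>: "tensor_map (phi m n) eta v = app ?\<Phi> v" if "v \<in> vecs (MA' m n)" for v
    using tensor_map_phi[OF that] .
  interpret source: supermodule ?U "MA' m n" "actA' m n"
    by (rule A'.supermodule) (rule actA'_eq[OF assms])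
  interpret target: supermodule ?U "MA m n" "actA m n"
    by (rule A.supermodule) (rule actA_eq[OF assms])
  have grade: "grade (MA m n) * ?\<Phi> = scalar (ksign (phi_par m n)) * (?\<Phi> * grade (MA' m n))"
    unfolding MA_def MA'_def grade_Lift Lift_mult[symmetric] phi_op_grade
    by (simp only: Lift_mult Lift_scalar)
  show ?thesis
  proof unfold_locales
    fix v w :: "mono \<times> unit \<Rightarrow>\<^sub>0 'k" and c :: 'k and q
    show "tensor_map (phi m n) eta (v + w) = tensor_map (phi m n) eta v + tensor_map (phi m n) eta w"
      by (simp add: tensor_map_def lin_add)
    show "tensor_map (phi m n) eta (scl c v) = scl c (tensor_map (phi m n) eta v)"
      by (simp add: tensor_map_def lin_scl)
    assume "v \<in> hvecs (MA' m n) q"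
    then have v: "v \<in> vecs (MA' m n)" "app (grade (MA' m n)) v = scl (ksign q) v" by (auto simp: hvecs_iff)
    have "app (grade (MA m n)) (app ?\<Phi> v) = scl (ksign (q + phi_par m n)) (app ?\<Phi> v)"
      unfolding ksign_add app_times[symmetric] grade
      by (simp only: app_times app_scalar v(2) app_scl scl.scale_scale mult.commute)
    then show "tensor_map (phi m n) eta v \<in> hvecs (MA m n) (q + of_nat (m * n))"
      using bij_betwE[OF Lift_phi_op_bij] v(1) unfolding hvecs_iff \<Phi>[OF v(1)] by blast
  next
    fix x q and v :: "mono \<times> unit \<Rightarrow>\<^sub>0 'k"
    assume x: "x \<in> hcomp ?U q" and v: "v \<in> vecs (MA' m n)"
    then have "x \<in> carr ?U" by (simp add: hcomp_def)
    then obtain f f' where f: "tensor_rel (repA_p m n) (repA_pt m n) x f"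
      and f': "tensor_rel (repA'_p m n) (repA'_pt m n) x f'"
      using A.total A'.total by meson
    let ?t = "parity_twist (phi_par m n) (MA m n) :: (mono \<times> unit, 'k) endo"
    have "homog (MA m n) q f"
      using homog_component A.hcomp_component[OF x f] by metis
    then have t: "?t * f = scalar (ksign (phi_par m n * q)) * (f * ?t)"
      by (rule parity_twist_homog)
    have tt: "?t * (?t * g) = g" for g
      by (simp add: mult.assoc[symmetric] parity_twist_square)
    \<comment> \<open>Undoing the twist moves it past \<open>f\<close>, at the cost of the sign \<open>(-1)\<^bsup>mnq\<^esup>\<close>.\<close>
    have "?t * ?\<Phi> * f' = f * (?t * ?\<Phi>)"
      using twisted_phi_intertwines[OF assms] f f'
      unfolding intertwines_def twisted_phi_def MA_def by blast
    then have "?t * (?t * (?\<Phi> * f')) = ?t * (f * (?t * ?\<Phi>))" by (simp only: mult.assoc)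
    then have "?\<Phi> * f' = ?t * f * (?t * ?\<Phi>)" by (simp only: tt mult.assoc)
    also have "\<dots> = scalar (ksign (phi_par m n * q)) * (f * ?\<Phi>)"
      unfolding t by (simp only: mult.assoc tt)
    finally have comm: "?\<Phi> * f' = scalar (ksign (phi_par m n * q)) * (f * ?\<Phi>)" .
    have f'v: "app f' v \<in> vecs (MA' m n)" by (rule A'.app_closed[OF f' v])
    have \<Phi>v: "app ?\<Phi> v \<in> vecs (MA m n)" using bij_betwE[OF Lift_phi_op_bij] v by blast
    show "tensor_map (phi m n) eta (actA' m n x v) =
        scl (ksign (of_nat (m * n) * q)) (actA m n x (tensor_map (phi m n) eta v))"
      unfolding actA'_eq[OF assms f' v] \<Phi>[OF f'v] \<Phi>[OF v] actA_eq[OF assms f \<Phi>v]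
      unfolding app_times[symmetric] comm by (simp only: app_times app_scalar)
  next
    show "bij_betw (tensor_map (phi m n) eta) (vecs (MA' m n))
        (vecs (MA m n) :: (mono \<times> unit \<Rightarrow>\<^sub>0 'k) set)"
      by (rule bij_betw_cong[where g = "app ?\<Phi>", THEN iffD2]) (rule \<Phi>, assumption, rule Lift_phi_op_bij)
  qed
qed

end
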